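(* (Strong completeness) For any set $\Gamma\cup\{\phi\}$ of $\mathbf{FOT}$-formulas that contains countably many free variables, $\Gamma\models\phi\iff\Gamma\vdash_{\mathbf{FOT}}\phi$.
   Context: Vocabularies are first-order with equality; every model $M$ (its domain is also written $M$) is assumed to have at least two elements. A team $X$ of $M$ over a set $V$ of variables is a set of assignments $s:V\to M$; $X(a/x)=\{s(a/x)\mid s\in X\}$, with $s(a/x)$ being $s$ modified or extended to send $x$ to $a$. Barred letters denote finite sequences. $\mathbf{FOT}$: $\phi::=\lambda\mid \bar x\subseteq\bar y\mid\dot\sim\phi\mid\phi\wedge\phi\mid\phi\vee^1\phi\mid\exists^1x\phi\mid\forall^1x\phi$ ($\lambda$ a first-order atom; $\bar x,\bar y$ variable sequences of equal length). $M\models_X\lambda$ iff $M\models_s\lambda$ for all $s\in X$; $M\models_X\bar x\subseteq\bar y$ iff for all $s\in X$ there is $s'\in X$ with $s(\bar x)=s'(\bar y)$; $M\models_X\dot\sim\phi$ iff $X=\emptyset$ or $M\not\models_X\phi$; $\wedge$ is conjunction; $M\models_X\phi\vee^1\psi$ iff $M\models_X\phi$ or $M\models_X\psi$; $M\models_X\exists^1x\phi$ (resp. $\forall^1x\phi$) iff $M\models_{X(a/x)}\phi$ for some (resp. all) $a\in M$. $\Gamma\models\phi$: for all models $M$ and teams $X$ of $M$ whose domain contains the free variables, if $M\models_X\psi$ for all $\psi\in\Gamma$ then $M\models_X\phi$. Abbreviations: $=\!(\bar t)$ is $\exists^1\bar x(\bar x=\bar t)$ with $\bar x$ fresh; an inclusion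 atom with constant symbols as arguments, e.g. $c\bar x\subseteq v\bar y$, is short for $\exists^1u(u=c\wedge u\bar x\subseteq v\bar y)$, $u$ fresh; $\bot$ is $\exists^1x\,\dot\sim(x=x)$. $\mathsf{Fv}$ denotes the set of free variables. Substituted terms are assumed free for the variables replaced. Fresh constant and relation symbols are always available in derivations. The natural deduction system ($\Gamma\vdash_{\mathbf{FOT}}\phi$, written $\Gamma\vdash\phi$) has the rules: - $\Gamma\vdash\phi$ if $\phi\in\Gamma$. $\Gamma\vdash t=t$. From $\Gamma\vdash t=t'$ and $\Gamma\vdash\phi(t/x)$ infer $\Gamma\vdash\phi(t'/x)$. - $\wedge$-introduction and both $\wedge$-eliminations. From $\Gamma\vdash\phi$ infer $\Gamma\vdash\phi\vee^1\psi$ and $\Gamma\vdash\psi\vee^1\phi$. From $\Gamma\vdash\phi\vee^1\psi$, $\Gamma,\phi\vdash\chi$, $\Gamma,\psi\vdash\chi$ infer $\Gamma\vdash\chi$. - From $\Gamma\vdash\phi(t/x)$ and $\Gamma\vdash{=\!(t)}$ infer $\Gamma\vdash\exists^1x\phi$. From $\Gamma\vdash\exists^1x\phi$ and $\Gamma,\phi(v/x),{=\!(v)}\vdash\psi$ infer $\Gamma\vdash\psi$, if $v\notin\mathsf{Fv}(\Gamma\cup\{\phi,\psi\})$. From $\Gamma\vdash\exists^1x\phi$ and $\Gamma,\phi(c/x)\vdash\psi$ infer $\Gamma\vdash\psi$, if the constant symbol $c$ does not occur in $\Gamma,\phi,\psi$. - From $\Gamma,{=\!(v)}\vdash\phi(v/x)$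 infer $\Gamma\vdash\forall^1x\phi$, if $v\notin\mathsf{Fv}(\Gamma\cup\{\phi\})$. From $\Gamma\vdash\phi(c/x)$ infer $\Gamma\vdash\forall^1x\phi$, if $c$ does not occur in $\Gamma,\phi$. From $\Gamma\vdash\forall^1x\phi$ and $\Gamma\vdash{=\!(t)}$ infer $\Gamma\vdash\phi(t/x)$. - From $\Gamma,\phi\vdash\bot$ infer $\Gamma\vdash\dot\sim\phi$. From $\Gamma\vdash\phi$ and $\Gamma\vdash\dot\sim\phi$ infer $\Gamma\vdash\psi$. From $\Gamma,\dot\sim\phi\vdash\bot$ infer $\Gamma\vdash\phi$. - $\Gamma\vdash{=\!(\bar c)}$ for constant symbols $\bar c$. From $\Gamma\vdash{=\!(\bar t)}$ infer $\Gamma\vdash{=\!(f\bar t)}$ for a function symbol $f$. - $\Gamma\vdash\bar x\subseteq\bar x$. From $\Gamma\vdash\bar x\subseteq\bar y$ and $\Gamma\vdash\bar y\subseteq\bar z$ infer $\Gamma\vdash\bar x\subseteq\bar z$. From $\Gamma\vdash x_1\dots x_n\subseteq y_1\dots y_n$ infer $\Gamma\vdash x_{i_1}\dots x_{i_k}\subseteq y_{i_1}\dots y_{i_k}$ for $\{i_1,\dots,i_k\}\subseteq\{1,\dots,n\}$. - From $\Gamma\vdash\bar x\subseteq\bar y$ and $\Gamma\vdash\alpha(\bar y/\bar z)$ infer $\Gamma\vdash\alpha(\bar x/\bar z)$, if $\alpha$ contains neither $\dot\sim$ nor inclusion atoms and its free variables are among $\bar z$. - From $\Gamma\vdash{=\!(\bar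 x)}$ and $\Gamma\vdash\bar y\subseteq\bar z$ infer $\Gamma\vdash\bar x\bar y\subseteq\bar x\bar z$. From $\Gamma\vdash{=\!(\bar x)}$ and $\Gamma\vdash\bar x\subseteq\bar y$ infer $\Gamma\vdash\exists^1\bar z(\bar z\bar x\subseteq\bar w\bar y)$. - From $\Gamma\vdash\dot\sim\,\bar x\subseteq\bar y$ and $\Gamma,\bar c\subseteq\bar x,\dot\sim\,\bar c\subseteq\bar y\vdash\phi$ infer $\Gamma\vdash\phi$; from $\Gamma\vdash\dot\sim\lambda(\bar x)$ and $\Gamma,\bar c\subseteq\bar x,\dot\sim\lambda(\bar c)\vdash\phi$ infer $\Gamma\vdash\phi$; in both, $\bar c$ is a sequence of constant symbols not occurring in $\Gamma$ or $\phi$, and $\lambda$ is a first-order atom. - From $\Gamma,\exists^1\bar zR\bar z,\phi(R)\vdash\bot$ infer $\Gamma,\phi(\bar v)\vdash\bot$, where $\Gamma$ is a set of sentences in which $R$ does not occur, $\phi(R)$ is an inclusion-atom-free sentence in which $R$ occurs only in the form $R\bar x$ ($\bar x$ variables), and $\phi(\bar v)$ is the formula with free variables $\bar v$ obtained from $\phi(R)$ by replacing every $R\bar x$ by $\bar x\subseteq\bar v$.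
   Formalization: Literal claim fails: ∃¹x∃¹y∼(x=y) is valid in models with ≥2 elements but not derivable. Proved: the equivalence over all nonempty models, and over models with ≥2 elements with that sentence added to Γ before ⊢. Witness constants must be distinct and, in the atom rule, not occur in λ. *)

theory Defs
  imports Main "HOL-Library.FuncSet" "HOL-Library.Countable_Set"
begin

section \<open>Syntax\<close>

text \<open>A symbol has no declared arity: \<open>f\<close> applied to lists of different lengths counts as different
  symbols.  Constant symbols are the nullary function symbols \<open>Fn c []\<close>.\<close>

datatype (fsyms_tm: 'f, vars_tm: 'v) tm =
    is_Var: Var (the_Var: 'v)
  | Fn 'f "('f, 'v) tm list"

text \<open>The inclusion atom $x_1 \dots x_n \subseteq y_1 \dots y_n$ is
  \<open>Inc [(x\<^sub>1, y\<^sub>1), \<dots>, (x\<^sub>n, y\<^sub>n)]\<close>, so that both sides have the same length by construction.\<close>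

datatype (fsyms: 'f, rsyms: 'r, vars: 'v) fm =
    Eq "('f, 'v) tm" "('f, 'v) tm"
  | Rel 'r "('f, 'v) tm list"
  | Inc "('v \<times> 'v) list"
  | Dneg "('f, 'r, 'v) fm"
  | And "('f, 'r, 'v) fm" "('f, 'r, 'v) fm"
  | Or1 "('f, 'r, 'v) fm" "('f, 'r, 'v) fm"
  | Ex1 'v "('f, 'r, 'v) fm"
  | All1 'v "('f, 'r, 'v) fm"

primrec fv :: "('f, 'r, 'v) fm \<Rightarrow> 'v set" where
  "fv (Eq t u) = vars_tm t \<union> vars_tm u"
| "fv (Rel R ts) = (\<Union>t\<in>set ts. vars_tm t)"
| "fv (Inc ps) = fst ` set ps \<union> snd ` set ps"
| "fv (Dneg \<phi>) = fv \<phi>"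
| "fv (And \<phi> \<psi>) = fv \<phi> \<union> fv \<psi>"
| "fv (Or1 \<phi> \<psi>) = fv \<phi> \<union> fv \<psi>"
| "fv (Ex1 x \<phi>) = fv \<phi> - {x}"
| "fv (All1 x \<phi>) = fv \<phi> - {x}"

definition fvs :: "('f, 'r, 'v) fm set \<Rightarrow> 'v set" where
  "fvs \<Gamma> = (\<Union>\<psi>\<in>\<Gamma>. fv \<psi>)"

definition all_fsyms :: "('f, 'r, 'v) fm set \<Rightarrow> 'f set" where
  "all_fsyms \<Gamma> = (\<Union>\<psi>\<in>\<Gamma>. fsyms \<psi>)"

definition all_rsyms :: "('f, 'r, 'v) fm set \<Rightarrow> 'r set" where
  "all_rsyms \<Gamma> = (\<Union>\<psi>\<in>\<Gamma>. rsyms \<psi>)"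


section \<open>Team semantics\<close>

record ('f, 'r, 'm) struct =
  carrier :: "'m set"
  fun_int :: "'f \<Rightarrow> 'm list \<Rightarrow> 'm"
  rel_int :: "'r \<Rightarrow> 'm list \<Rightarrow> bool"

definition structures :: "('f, 'r, 'm) struct set" where
  "structures = {M. carrier M \<noteq> {} \<and>
     (\<forall>f as. set as \<subseteq> carrier M \<longrightarrow> fun_int M f as \<in> carrier M)}"

text \<open>The models proper, which have at least two elements.  The rules below do not reflect this
  restriction (see \<open>two_elements_not_derivable\<close>), so the unrestricted class is needed as well.\<close>

definition models :: "('f, 'r, 'm) struct set" where
  "models = {M \<in> structures. \<exists>a\<in>carrier M. \<exists>b\<in>carrier M. a \<noteq> b}"

text \<open>An assignment with domain \<open>V\<close> is an extensional function, i.e. \<open>undefined\<close> outside \<open>V\<close>;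
  updating it at \<open>x\<close> yields an assignment with domain \<open>insert x V\<close>.\<close>

definition team :: "('f, 'r, 'm) struct \<Rightarrow> 'v set \<Rightarrow> ('v \<Rightarrow> 'm) set \<Rightarrow> bool" where
  "team M V X \<longleftrightarrow> X \<subseteq> (V \<rightarrow>\<^sub>E carrier M)"

definition team_upd :: "('v \<Rightarrow> 'm) set \<Rightarrow> 'v \<Rightarrow> 'm \<Rightarrow> ('v \<Rightarrow> 'm) set" where
  "team_upd X x a = (\<lambda>s. s(x := a)) ` X"

primrec eval :: "('f, 'r, 'm) struct \<Rightarrow> ('v \<Rightarrow> 'm) \<Rightarrow> ('f, 'v) tm \<Rightarrow> 'm" where
  "eval M s (Var x) = s x"
| "eval M s (Fn f ts) = fun_int M f (map (eval M s) ts)"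

primrec sat :: "('f, 'r, 'm) struct \<Rightarrow> ('v \<Rightarrow> 'm) set \<Rightarrow> ('f, 'r, 'v) fm \<Rightarrow> bool" where
  "sat M X (Eq t u) \<longleftrightarrow> (\<forall>s\<in>X. eval M s t = eval M s u)"
| "sat M X (Rel R ts) \<longleftrightarrow> (\<forall>s\<in>X. rel_int M R (map (eval M s) ts))"
| "sat M X (Inc ps) \<longleftrightarrow> (\<forall>s\<in>X. \<exists>s'\<in>X. map s (map fst ps) = map s' (map snd ps))"
| "sat M X (Dneg \<phi>) \<longleftrightarrow> X = {} \<or> \<not> sat M X \<phi>"
| "sat M X (And \<phi> \<psi>) \<longleftrightarrow> sat M X \<phi> \<and> sat M X \<psi>"
| "sat M X (Or1 \<phi> \<psi>) \<longleftrightarrow> sat M X \<phi> \<or> sat M X \<psi>"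
| "sat M X (Ex1 x \<phi>) \<longleftrightarrow> (\<exists>a\<in>carrier M. sat M (team_upd X x a) \<phi>)"
| "sat M X (All1 x \<phi>) \<longleftrightarrow> (\<forall>a\<in>carrier M. sat M (team_upd X x a) \<phi>)"

text \<open>Consequence over a class \<open>K\<close> of structures; the type \<open>'m\<close> from which the carriers are drawn
  is determined by \<open>K\<close>.  Quantification over the models of all cardinalities is not expressible;
  carriers are arbitrary subsets of \<open>'m\<close>, and by the downward Loewenheim-Skolem argument it is
  enough that \<open>'m\<close> is infinite and at least as large as the vocabulary.\<close>

definition entails ::
  "('f, 'r, 'm) struct set \<Rightarrow> ('f, 'r, 'v) fm set \<Rightarrow> ('f, 'r, 'v) fm \<Rightarrow> bool" where
  "entails K \<Gamma> \<phi> \<longleftrightarrow> (\<forall>M\<in>K. \<forall>V X. team M V X \<longrightarrow> fvs (insert \<phi> \<Gamma>) \<subseteq> V \<longrightarrow>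
     (\<forall>\<psi>\<in>\<Gamma>. sat M X \<psi>) \<longrightarrow> sat M X \<phi>)"


section \<open>Abbreviations and substitution\<close>

definition fresh :: "nat \<Rightarrow> 'v set \<Rightarrow> 'v list" where
  "fresh n A = (SOME xs. length xs = n \<and> distinct xs \<and> set xs \<inter> A = {})"

definition exs :: "'v list \<Rightarrow> ('f, 'r, 'v) fm \<Rightarrow> ('f, 'r, 'v) fm" where
  "exs xs \<phi> = foldr Ex1 xs \<phi>"

definition bot_fm :: "('f, 'r, 'v) fm" where
  "bot_fm = (let x = (SOME x. True) in Ex1 x (Dneg (Eq (Var x) (Var x))))"

fun conjs :: "('f, 'r, 'v) fm list \<Rightarrow> ('f, 'r, 'v) fm" where
  "conjs [] = Dneg bot_fm"
| "conjs [\<phi>] = \<phi>"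
| "conjs (\<phi> # \<psi> # \<chi>s) = And \<phi> (conjs (\<psi> # \<chi>s))"

definition eqs :: "'v list \<Rightarrow> ('f, 'v) tm list \<Rightarrow> ('f, 'r, 'v) fm list" where
  "eqs xs ts = map2 (\<lambda>x t. Eq (Var x) t) xs ts"

text \<open>The constancy atom $=\!(\bar t)$.\<close>

definition cst :: "('f, 'v) tm list \<Rightarrow> ('f, 'r, 'v) fm" where
  "cst ts = (let xs = fresh (length ts) (\<Union>t\<in>set ts. vars_tm t) in exs xs (conjs (eqs xs ts)))"

text \<open>The inclusion atom whose arguments are variables or constant symbols: every constant symbol
  \<open>c\<close> among the arguments is replaced by a fresh variable \<open>u\<close>, bound by $\exists^1 u$ and
  constrained by $u = c$.  Arguments of any other form are excluded where \<open>incl\<close> is used.\<close>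

definition incl :: "(('f, 'v) tm \<times> ('f, 'v) tm) list \<Rightarrow> ('f, 'r, 'v) fm" where
  "incl ps =
    (let cs = remdups (filter (\<lambda>t. \<not> is_Var t) (map fst ps @ map snd ps));
         us = fresh (length cs) (\<Union>(t, u)\<in>set ps. vars_tm t \<union> vars_tm u);
         \<rho> = (\<lambda>t. if is_Var t then the_Var t else the (map_of (zip cs us) t))
     in exs us (conjs (eqs us cs @ [Inc (map (\<lambda>(t, u). (\<rho> t, \<rho> u)) ps)])))"

primrec subst_tm :: "('v \<Rightarrow> ('f, 'v) tm) \<Rightarrow> ('f, 'v) tm \<Rightarrow> ('f, 'v) tm" where
  "subst_tm \<sigma> (Var x) = \<sigma> x"
| "subst_tm \<sigma> (Fn f ts) = Fn f (map (subst_tm \<sigma>) ts)"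

primrec subst :: "('v \<Rightarrow> ('f, 'v) tm) \<Rightarrow> ('f, 'r, 'v) fm \<Rightarrow> ('f, 'r, 'v) fm" where
  "subst \<sigma> (Eq t u) = Eq (subst_tm \<sigma> t) (subst_tm \<sigma> u)"
| "subst \<sigma> (Rel R ts) = Rel R (map (subst_tm \<sigma>) ts)"
| "subst \<sigma> (Inc ps) = incl (map (\<lambda>(x, y). (\<sigma> x, \<sigma> y)) ps)"
| "subst \<sigma> (Dneg \<phi>) = Dneg (subst \<sigma> \<phi>)"
| "subst \<sigma> (And \<phi> \<psi>) = And (subst \<sigma> \<phi>) (subst \<sigma> \<psi>)"
| "subst \<sigma> (Or1 \<phi> \<psi>) = Or1 (subst \<sigma> \<phi>) (subst \<sigma> \<psi>)"
| "subst \<sigma> (Ex1 x \<phi>) = Ex1 x (subst (\<sigma>(x := Var x)) \<phi>)"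
| "subst \<sigma> (All1 x \<phi>) = All1 x (subst (\<sigma>(x := Var x)) \<phi>)"

definition simple :: "('f, 'v) tm \<Rightarrow> bool" where
  "simple t \<longleftrightarrow> (\<exists>y. t = Var y) \<or> (\<exists>c. t = Fn c [])"

text \<open>No variable is captured, and only variables and constant symbols are put into inclusion
  atoms (which have no other arguments).\<close>

primrec substitutable :: "('v \<Rightarrow> ('f, 'v) tm) \<Rightarrow> ('f, 'r, 'v) fm \<Rightarrow> bool" where
  "substitutable \<sigma> (Eq t u) \<longleftrightarrow> True"
| "substitutable \<sigma> (Rel R ts) \<longleftrightarrow> True"
| "substitutable \<sigma> (Inc ps) \<longleftrightarrow> (\<forall>(x, y)\<in>set ps. simple (\<sigma> x) \<and> simple (\<sigma> y))"
| "substitutable \<sigma> (Dneg \<phi>) \<longleftrightarrow> substitutable \<sigma> \<phi>"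
| "substitutable \<sigma> (And \<phi> \<psi>) \<longleftrightarrow> substitutable \<sigma> \<phi> \<and> substitutable \<sigma> \<psi>"
| "substitutable \<sigma> (Or1 \<phi> \<psi>) \<longleftrightarrow> substitutable \<sigma> \<phi> \<and> substitutable \<sigma> \<psi>"
| "substitutable \<sigma> (Ex1 x \<phi>) \<longleftrightarrow>
     (\<forall>y\<in>fv \<phi> - {x}. x \<notin> vars_tm (\<sigma> y)) \<and> substitutable (\<sigma>(x := Var x)) \<phi>"
| "substitutable \<sigma> (All1 x \<phi>) \<longleftrightarrow>
     (\<forall>y\<in>fv \<phi> - {x}. x \<notin> vars_tm (\<sigma> y)) \<and> substitutable (\<sigma>(x := Var x)) \<phi>"

definition subst1 :: "('f, 'r, 'v) fm \<Rightarrow> ('f, 'v) tm \<Rightarrow> 'v \<Rightarrow> ('f, 'r, 'v) fm" where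
  "subst1 \<phi> t x = subst (Var(x := t)) \<phi>"

definition free_for :: "('f, 'v) tm \<Rightarrow> 'v \<Rightarrow> ('f, 'r, 'v) fm \<Rightarrow> bool" where
  "free_for t x \<phi> \<longleftrightarrow> substitutable (Var(x := t)) \<phi>"

definition simul :: "'v list \<Rightarrow> ('f, 'v) tm list \<Rightarrow> 'v \<Rightarrow> ('f, 'v) tm" where
  "simul zs ts x = (case map_of (zip zs ts) x of None \<Rightarrow> Var x | Some t \<Rightarrow> t)"

abbreviation vs_tms :: "'v list \<Rightarrow> ('f, 'v) tm list" where
  "vs_tms xs \<equiv> map Var xs"

abbreviation cs_tms :: "'f list \<Rightarrow> ('f, 'v) tm list" where
  "cs_tms cs \<equiv> map (\<lambda>c. Fn c []) cs"


section \<open>Natural deduction\<close>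

fun is_atom :: "('f, 'r, 'v) fm \<Rightarrow> bool" where
  "is_atom (Eq t u) \<longleftrightarrow> True"
| "is_atom (Rel R ts) \<longleftrightarrow> True"
| "is_atom _ \<longleftrightarrow> False"

primrec neg_inc_free :: "('f, 'r, 'v) fm \<Rightarrow> bool" where
  "neg_inc_free (Eq t u) \<longleftrightarrow> True"
| "neg_inc_free (Rel R ts) \<longleftrightarrow> True"
| "neg_inc_free (Inc ps) \<longleftrightarrow> False"
| "neg_inc_free (Dneg \<phi>) \<longleftrightarrow> False"
| "neg_inc_free (And \<phi> \<psi>) \<longleftrightarrow> neg_inc_free \<phi> \<and> neg_inc_free \<psi>"
| "neg_inc_free (Or1 \<phi> \<psi>) \<longleftrightarrow> neg_inc_free \<phi> \<and> neg_inc_free \<psi>"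
| "neg_inc_free (Ex1 x \<phi>) \<longleftrightarrow> neg_inc_free \<phi>"
| "neg_inc_free (All1 x \<phi>) \<longleftrightarrow> neg_inc_free \<phi>"

text \<open>\<open>rel_replaceable R vs \<phi>\<close>: there are no inclusion atoms in \<open>\<phi>\<close>, the symbol \<open>R\<close> occurs only
  applied to \<open>length vs\<close> variables, and no occurrence of \<open>R\<close> is in the scope of a quantifier that
  binds a variable of \<open>vs\<close>.\<close>

primrec rel_replaceable :: "'r \<Rightarrow> 'v list \<Rightarrow> ('f, 'r, 'v) fm \<Rightarrow> bool" where
  "rel_replaceable R vs (Eq t u) \<longleftrightarrow> True"
| "rel_replaceable R vs (Rel S ts) \<longleftrightarrow>
     (S = R \<longrightarrow> length ts = length vs \<and> (\<forall>t\<in>set ts. is_Var t))"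
| "rel_replaceable R vs (Inc ps) \<longleftrightarrow> False"
| "rel_replaceable R vs (Dneg \<phi>) \<longleftrightarrow> rel_replaceable R vs \<phi>"
| "rel_replaceable R vs (And \<phi> \<psi>) \<longleftrightarrow> rel_replaceable R vs \<phi> \<and> rel_replaceable R vs \<psi>"
| "rel_replaceable R vs (Or1 \<phi> \<psi>) \<longleftrightarrow> rel_replaceable R vs \<phi> \<and> rel_replaceable R vs \<psi>"
| "rel_replaceable R vs (Ex1 x \<phi>) \<longleftrightarrow> (R \<in> rsyms \<phi> \<longrightarrow> x \<notin> set vs) \<and> rel_replaceable R vs \<phi>"
| "rel_replaceable R vs (All1 x \<phi>) \<longleftrightarrow> (R \<in> rsyms \<phi> \<longrightarrow> x \<notin> set vs) \<and> rel_replaceable R vs \<phi>"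

primrec rel_to_inc :: "'r \<Rightarrow> 'v list \<Rightarrow> ('f, 'r, 'v) fm \<Rightarrow> ('f, 'r, 'v) fm" where
  "rel_to_inc R vs (Eq t u) = Eq t u"
| "rel_to_inc R vs (Rel S ts) = (if S = R then Inc (zip (map the_Var ts) vs) else Rel S ts)"
| "rel_to_inc R vs (Inc ps) = Inc ps"
| "rel_to_inc R vs (Dneg \<phi>) = Dneg (rel_to_inc R vs \<phi>)"
| "rel_to_inc R vs (And \<phi> \<psi>) = And (rel_to_inc R vs \<phi>) (rel_to_inc R vs \<psi>)"
| "rel_to_inc R vs (Or1 \<phi> \<psi>) = Or1 (rel_to_inc R vs \<phi>) (rel_to_inc R vs \<psi>)"
| "rel_to_inc R vs (Ex1 x \<phi>) = Ex1 x (rel_to_inc R vs \<phi>)"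
| "rel_to_inc R vs (All1 x \<phi>) = All1 x (rel_to_inc R vs \<phi>)"

text \<open>\<open>Weaken\<close> expresses that \<open>\<Gamma>\<close> need only contain the assumptions of the derivation; it is not
  admissible otherwise, because of the restriction on the context in \<open>RelInc\<close>.  In \<open>AtomWit\<close>, the
  symbols \<open>cs\<close> must also be new to the atom, and in both witness rules they must be distinct:
  both are necessary for soundness.  Fresh constant and relation symbols are taken from the unused
  elements of \<open>'f\<close> and \<open>'r\<close>; completeness therefore presupposes that infinitely many of them do
  not occur in \<open>\<Gamma>\<close> and \<open>\<phi>\<close>.\<close>

inductive deriv :: "('f, 'r, 'v) fm set \<Rightarrow> ('f, 'r, 'v) fm \<Rightarrow> bool" (infix \<open>\<turnstile>\<close> 50) where
  Assm: "\<phi> \<in> \<Gamma> \<Longrightarrow> \<Gamma> \<turnstile> \<phi>"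
| Weaken: "\<Gamma> \<turnstile> \<phi> \<Longrightarrow> \<Gamma> \<subseteq> \<Delta> \<Longrightarrow> \<Delta> \<turnstile> \<phi>"
| EqI: "\<Gamma> \<turnstile> Eq t t"
| EqE: "\<Gamma> \<turnstile> Eq t u \<Longrightarrow> \<Gamma> \<turnstile> subst1 \<phi> t x \<Longrightarrow> free_for t x \<phi> \<Longrightarrow> free_for u x \<phi>
    \<Longrightarrow> \<Gamma> \<turnstile> subst1 \<phi> u x"
| AndI: "\<Gamma> \<turnstile> \<phi> \<Longrightarrow> \<Gamma> \<turnstile> \<psi> \<Longrightarrow> \<Gamma> \<turnstile> And \<phi> \<psi>"
| AndE1: "\<Gamma> \<turnstile> And \<phi> \<psi> \<Longrightarrow> \<Gamma> \<turnstile> \<phi>"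
| AndE2: "\<Gamma> \<turnstile> And \<phi> \<psi> \<Longrightarrow> \<Gamma> \<turnstile> \<psi>"
| OrI1: "\<Gamma> \<turnstile> \<phi> \<Longrightarrow> \<Gamma> \<turnstile> Or1 \<phi> \<psi>"
| OrI2: "\<Gamma> \<turnstile> \<phi> \<Longrightarrow> \<Gamma> \<turnstile> Or1 \<psi> \<phi>"
| OrE: "\<Gamma> \<turnstile> Or1 \<phi> \<psi> \<Longrightarrow> insert \<phi> \<Gamma> \<turnstile> \<chi> \<Longrightarrow> insert \<psi> \<Gamma> \<turnstile> \<chi> \<Longrightarrow> \<Gamma> \<turnstile> \<chi>"
| ExI: "\<Gamma> \<turnstile> subst1 \<phi> t x \<Longrightarrow> free_for t x \<phi> \<Longrightarrow> \<Gamma> \<turnstile> cst [t] \<Longrightarrow> \<Gamma> \<turnstile> Ex1 x \<phi>"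
| ExE_var: "\<Gamma> \<turnstile> Ex1 x \<phi> \<Longrightarrow> insert (subst1 \<phi> (Var v) x) (insert (cst [Var v]) \<Gamma>) \<turnstile> \<psi>
    \<Longrightarrow> free_for (Var v) x \<phi> \<Longrightarrow> v \<notin> fvs (insert \<phi> (insert \<psi> \<Gamma>)) \<Longrightarrow> \<Gamma> \<turnstile> \<psi>"
| ExE_const: "\<Gamma> \<turnstile> Ex1 x \<phi> \<Longrightarrow> insert (subst1 \<phi> (Fn c []) x) \<Gamma> \<turnstile> \<psi>
    \<Longrightarrow> c \<notin> all_fsyms (insert \<phi> (insert \<psi> \<Gamma>)) \<Longrightarrow> \<Gamma> \<turnstile> \<psi>"
| AllI_var: "insert (cst [Var v]) \<Gamma> \<turnstile> subst1 \<phi> (Var v) x \<Longrightarrow> free_for (Var v) x \<phi>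
    \<Longrightarrow> v \<notin> fvs (insert \<phi> \<Gamma>) \<Longrightarrow> \<Gamma> \<turnstile> All1 x \<phi>"
| AllI_const: "\<Gamma> \<turnstile> subst1 \<phi> (Fn c []) x \<Longrightarrow> c \<notin> all_fsyms (insert \<phi> \<Gamma>) \<Longrightarrow> \<Gamma> \<turnstile> All1 x \<phi>"
| AllE: "\<Gamma> \<turnstile> All1 x \<phi> \<Longrightarrow> \<Gamma> \<turnstile> cst [t] \<Longrightarrow> free_for t x \<phi> \<Longrightarrow> \<Gamma> \<turnstile> subst1 \<phi> t x"
| NegI: "insert \<phi> \<Gamma> \<turnstile> bot_fm \<Longrightarrow> \<Gamma> \<turnstile> Dneg \<phi>"
| NegE: "\<Gamma> \<turnstile> \<phi> \<Longrightarrow> \<Gamma> \<turnstile> Dneg \<phi> \<Longrightarrow> \<Gamma> \<turnstile> \<psi>"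
| RAA: "insert (Dneg \<phi>) \<Gamma> \<turnstile> bot_fm \<Longrightarrow> \<Gamma> \<turnstile> \<phi>"
| CstConst: "\<Gamma> \<turnstile> cst (cs_tms cs)"
| CstFun: "\<Gamma> \<turnstile> cst ts \<Longrightarrow> \<Gamma> \<turnstile> cst [Fn f ts]"
| IncRefl: "\<Gamma> \<turnstile> Inc (zip xs xs)"
| IncTrans: "\<Gamma> \<turnstile> Inc (zip xs ys) \<Longrightarrow> \<Gamma> \<turnstile> Inc (zip ys zs)
    \<Longrightarrow> length xs = length ys \<Longrightarrow> length ys = length zs \<Longrightarrow> \<Gamma> \<turnstile> Inc (zip xs zs)"
| IncProj: "\<Gamma> \<turnstile> Inc ps \<Longrightarrow> set is \<subseteq> {..<length ps} \<Longrightarrow> \<Gamma> \<turnstile> Inc (map ((!) ps) is)"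
| IncCompress: "\<Gamma> \<turnstile> Inc (zip xs ys) \<Longrightarrow> \<Gamma> \<turnstile> subst (simul zs (vs_tms ys)) \<alpha>
    \<Longrightarrow> length xs = length zs \<Longrightarrow> length ys = length zs \<Longrightarrow> distinct zs
    \<Longrightarrow> neg_inc_free \<alpha> \<Longrightarrow> fv \<alpha> \<subseteq> set zs
    \<Longrightarrow> substitutable (simul zs (vs_tms xs)) \<alpha> \<Longrightarrow> substitutable (simul zs (vs_tms ys)) \<alpha>
    \<Longrightarrow> \<Gamma> \<turnstile> subst (simul zs (vs_tms xs)) \<alpha>"
| IncCst: "\<Gamma> \<turnstile> cst (vs_tms xs) \<Longrightarrow> \<Gamma> \<turnstile> Inc ps \<Longrightarrow> \<Gamma> \<turnstile> Inc (zip xs xs @ ps)"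
| IncExt: "\<Gamma> \<turnstile> cst (vs_tms xs) \<Longrightarrow> \<Gamma> \<turnstile> Inc (zip xs ys) \<Longrightarrow> length xs = length ys
    \<Longrightarrow> length zs = length ws \<Longrightarrow> distinct zs \<Longrightarrow> set zs \<inter> (set xs \<union> set ys \<union> set ws) = {}
    \<Longrightarrow> \<Gamma> \<turnstile> exs zs (Inc (zip zs ws @ zip xs ys))"
| IncWit: "\<Gamma> \<turnstile> Dneg (Inc (zip xs ys))
    \<Longrightarrow> insert (incl (zip (cs_tms cs) (vs_tms xs)))
          (insert (Dneg (incl (zip (cs_tms cs) (vs_tms ys)))) \<Gamma>) \<turnstile> \<phi>
    \<Longrightarrow> length xs = length ys \<Longrightarrow> length cs = length xs \<Longrightarrow> distinct cs
    \<Longrightarrow> set cs \<inter> all_fsyms (insert \<phi> \<Gamma>) = {} \<Longrightarrow> \<Gamma> \<turnstile> \<phi>"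
| AtomWit: "\<Gamma> \<turnstile> Dneg l
    \<Longrightarrow> insert (incl (zip (cs_tms cs) (vs_tms xs)))
          (insert (Dneg (subst (simul xs (cs_tms cs)) l)) \<Gamma>) \<turnstile> \<phi>
    \<Longrightarrow> is_atom l \<Longrightarrow> fv l \<subseteq> set xs \<Longrightarrow> distinct xs \<Longrightarrow> length cs = length xs \<Longrightarrow> distinct cs
    \<Longrightarrow> set cs \<inter> all_fsyms (insert l (insert \<phi> \<Gamma>)) = {} \<Longrightarrow> \<Gamma> \<turnstile> \<phi>"
| RelInc: "insert (exs zs (Rel R (vs_tms zs))) (insert \<phi> \<Gamma>) \<turnstile> bot_fm
    \<Longrightarrow> fvs \<Gamma> = {} \<Longrightarrow> R \<notin> all_rsyms \<Gamma> \<Longrightarrow> fv \<phi> = {} \<Longrightarrow> rel_replaceable R vs \<phi>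
    \<Longrightarrow> distinct vs \<Longrightarrow> distinct zs \<Longrightarrow> length zs = length vs
    \<Longrightarrow> insert (rel_to_inc R vs \<phi>) \<Gamma> \<turnstile> bot_fm"


section \<open>The sentence stating that there are two elements\<close>

definition two_elements :: "'v \<Rightarrow> 'v \<Rightarrow> ('f, 'r, 'v) fm" where
  "two_elements x y = Ex1 x (Ex1 y (Dneg (Eq (Var x) (Var y))))"

text \<open>All rules are sound in one-element structures as well.  Hence for distinct \<open>x\<close> and \<open>y\<close> the
  sentence \<open>two_elements x y\<close> holds in all \<open>models\<close> but is not derivable.\<close>

text \<open>Satisfaction by a nonempty team in the one-element structure in which \<open>R\<close>, as an \<open>n\<close>-ary
  symbol, is interpreted by \<open>I R n\<close>.\<close>

primrec one_sat :: "('r \<Rightarrow> nat \<Rightarrow> bool) \<Rightarrow> ('f, 'r, 'v) fm \<Rightarrow> bool" where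
  "one_sat I (Eq t u) \<longleftrightarrow> True"
| "one_sat I (Rel R ts) \<longleftrightarrow> I R (length ts)"
| "one_sat I (Inc ps) \<longleftrightarrow> True"
| "one_sat I (Dneg \<phi>) \<longleftrightarrow> \<not> one_sat I \<phi>"
| "one_sat I (And \<phi> \<psi>) \<longleftrightarrow> one_sat I \<phi> \<and> one_sat I \<psi>"
| "one_sat I (Or1 \<phi> \<psi>) \<longleftrightarrow> one_sat I \<phi> \<or> one_sat I \<psi>"
| "one_sat I (Ex1 x \<phi>) \<longleftrightarrow> one_sat I \<phi>"
| "one_sat I (All1 x \<phi>) \<longleftrightarrow> one_sat I \<phi>"

lemma one_sat_bot: "\<not> one_sat I bot_fm"
  by (simp add: bot_fm_def Let_def)

lemma one_sat_exs: "one_sat I (exs xs \<phi>) = one_sat I \<phi>"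
  unfolding exs_def by (induction xs) auto

lemma one_sat_conjs: "one_sat I (conjs \<phi>s) \<longleftrightarrow> (\<forall>\<phi>\<in>set \<phi>s. one_sat I \<phi>)"
  by (induction \<phi>s rule: conjs.induct) (auto simp: one_sat_bot)

lemma one_sat_cst: "one_sat I (cst ts)"
  by (auto simp: cst_def Let_def one_sat_exs one_sat_conjs eqs_def)

lemma one_sat_incl: "one_sat I (incl ps)"
  by (auto simp: incl_def Let_def one_sat_exs one_sat_conjs eqs_def)

lemma one_sat_subst: "one_sat I (subst \<sigma> \<phi>) = one_sat I \<phi>"
  by (induction \<phi> arbitrary: \<sigma>) (auto simp: one_sat_incl)

lemma one_sat_cong:
  "(\<And>R. R \<in> rsyms \<phi> \<Longrightarrow> I R = J R) \<Longrightarrow> one_sat I \<phi> = one_sat J \<phi>"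
  by (induction \<phi>) auto

lemma one_sat_rel_to_inc:
  "rel_replaceable R vs \<phi> \<Longrightarrow> one_sat I (rel_to_inc R vs \<phi>) = one_sat (I(R := (\<lambda>_. True))) \<phi>"
  by (induction \<phi>) auto

lemma one_sat_deriv: "\<Gamma> \<turnstile> \<phi> \<Longrightarrow> \<forall>\<psi>\<in>\<Gamma>. one_sat I \<psi> \<Longrightarrow> one_sat I \<phi>"
proof (induction arbitrary: I rule: deriv.induct)
  case (RelInc zs R \<phi> \<Gamma> vs)
  let ?J = "I(R := (\<lambda>_. True))"
  have "one_sat ?J \<psi>" if "\<psi> \<in> \<Gamma>" for \<psi>
  proof -
    have "R \<notin> rsyms \<psi>" using RelInc.hyps that by (auto simp: all_rsyms_def)
    then have "one_sat ?J \<psi> = one_sat I \<psi>" by (intro one_sat_cong) auto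
    then show ?thesis using RelInc.prems that by simp
  qed
  moreover have "one_sat ?J \<phi>"
    using RelInc.prems one_sat_rel_to_inc RelInc.hyps by fastforce
  ultimately have "\<forall>\<psi>\<in>insert (exs zs (Rel R (vs_tms zs))) (insert \<phi> \<Gamma>). one_sat ?J \<psi>"
    by (simp add: one_sat_exs)
  then have False using RelInc.IH one_sat_bot by blast
  then show ?case ..
qed (auto simp: one_sat_bot one_sat_exs one_sat_cst one_sat_incl one_sat_subst subst1_def)

lemma two_elements_not_derivable: "\<not> {} \<turnstile> two_elements x y"
  using one_sat_deriv[of "{}" "two_elements x y" "\<lambda>_ _. True"] by (auto simp: two_elements_def)

lemma two_elements_valid:
  fixes x y :: 'v
  assumes "x \<noteq> y"
  shows "entails (models :: ('f, 'r, 'm) struct set) {} (two_elements x y :: ('f, 'r, 'v) fm)"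
  using assms
  by (fastforce simp: entails_def models_def two_elements_def team_upd_def)

end

theory Submission
  imports Defs
begin

text \<open>Soundness is an induction on derivations.  For completeness, a model and a team are read off from a
  maximal consistent set \<open>S\<close> in which every true existential formula has a witness.

  The witnesses are variables with a constant value, the \<^emph>\<open>Henkin variables\<close>; modulo provable equality
  they are the elements of the model.  A tuple \<open>cs\<close> of them is to be the value of a tuple \<open>ys\<close> of free
  variables at some member of the team exactly if the inclusion of \<open>cs\<close> in \<open>ys\<close> belongs to \<open>S\<close>.  For
  the tuples of the first \<open>n\<close> free variables this prescribes a relation for each \<open>n\<close>, and by \<open>IncProj\<close>
  and \<open>IncExt\<close> each of these relations is the projection of the next one.  As there are countably many
  free variables, a tuple can be extended step by step to a whole assignment
  (\<open>team_seqs_exists\<close>), so the team of all assignments whose finite parts satisfy these relations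
  realizes them.  In the truth lemma (\<open>truth\<close>) an atom in \<open>S\<close> holds at each member of the team by
  \<open>IncCompress\<close>, and an inclusion in \<open>S\<close> holds by transitivity; for atoms and inclusions outside \<open>S\<close> the
  rules \<open>AtomWit\<close> and \<open>IncWit\<close> provide a tuple of values that refutes them.  The connectives follow from
  maximality and the quantifiers from the existence of witnesses.

  Two points need care.  The given formulas may use up all variables and all constant symbols, so that
  no fresh ones are left for \<open>S\<close>.  Therefore \<open>S\<close> lives over an extended set of variables, and its
  consistency means that every finite subset, renamed injectively to the original variables, derives no
  contradiction there (\<open>realizes\<close>, \<open>Henkin_set_exists\<close>); finite contexts always leave fresh symbols.
  Secondly, the carrier must fit into a type that need only be as large as the vocabulary, while there may
  be more variables than that.  Therefore bound variables are first brought into a normal form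
  (\<open>alpha_nf_deq\<close>), and a Henkin variable is named by the formula in normal form that it witnesses; such
  names are coded injectively in the given type (\<open>inj_hvar_exists\<close>).

  Finally, a structure with a nonempty team has two elements exactly if the team satisfies
  \<open>two_elements x y\<close>, so consequence over \<open>models\<close> is consequence over \<open>structures\<close> with this
  sentence as an additional assumption (\<open>entails_models\<close>).\<close>

section \<open>Bound variables, renaming and substitution\<close>

primrec bv :: "('f, 'r, 'v) fm \<Rightarrow> 'v set" where
  "bv (Eq t u) = {}"
| "bv (Rel R ts) = {}"
| "bv (Inc ps) = {}"
| "bv (Dneg \<phi>) = bv \<phi>"
| "bv (And \<phi> \<psi>) = bv \<phi> \<union> bv \<psi>"
| "bv (Or1 \<phi> \<psi>) = bv \<phi> \<union> bv \<psi>"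
| "bv (Ex1 x \<phi>) = insert x (bv \<phi>)"
| "bv (All1 x \<phi>) = insert x (bv \<phi>)"

lemma vars_eq: "vars \<phi> = fv \<phi> \<union> bv \<phi>"
proof (induction \<phi>)
  case (Inc ps)
  then show ?case by (auto simp: prod_set_defs)
qed auto

lemma fv_subset_vars: "fv \<phi> \<subseteq> vars \<phi>"
  by (simp add: vars_eq)

lemma finite_fv [simp]: "finite (fv \<phi>)"
  by (induction \<phi>) auto

lemma finite_bv [simp]: "finite (bv \<phi>)"
  by (induction \<phi>) auto

lemma finite_fvs: "finite \<Gamma> \<Longrightarrow> finite (fvs \<Gamma>)"
  by (simp add: fvs_def)

lemma finite_all_fsyms: "finite \<Gamma> \<Longrightarrow> finite (all_fsyms \<Gamma>)"
  by (simp add: all_fsyms_def)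

lemma fvs_insert: "fvs (insert \<phi> \<Gamma>) = fv \<phi> \<union> fvs \<Gamma>"
  by (simp add: fvs_def)

lemma fresh_props:
  assumes "infinite (UNIV :: 'v set)" "finite (A :: 'v set)"
  shows "length (fresh n A) = n" "distinct (fresh n A)" "set (fresh n A) \<inter> A = {}"
proof -
  obtain B where B: "finite B" "card B = n" "B \<subseteq> - A"
    using infinite_arbitrarily_large[of "- A" n] assms by (auto simp: Compl_eq_Diff_UNIV)
  obtain xs where "set xs = B" "distinct xs" using finite_distinct_list[OF B(1)] by blast
  then have "length xs = n \<and> distinct xs \<and> set xs \<inter> A = {}"
    using B distinct_card[of xs] by auto
  then have "length (fresh n A) = n \<and> distinct (fresh n A) \<and> set (fresh n A) \<inter> A = {}"
    unfolding fresh_def by (rule someI)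
  then show "length (fresh n A) = n" "distinct (fresh n A)" "set (fresh n A) \<inter> A = {}" by auto
qed

lemma ex_fresh:
  assumes "infinite (UNIV :: 'a set)" "finite (A :: 'a set)"
  obtains v where "v \<notin> A"
  using assms by (metis ex_new_if_finite)

definition ren :: "('v \<Rightarrow> 'w) \<Rightarrow> 'v \<Rightarrow> ('f, 'w) tm" where
  "ren \<theta> x = Var (\<theta> x)"

lemma vars_ren [simp]: "vars_tm (ren \<theta> x) = {\<theta> x}"
  by (simp add: ren_def)

lemma subst_tm_cong: "(\<And>x. x \<in> vars_tm t \<Longrightarrow> \<sigma> x = \<tau> x) \<Longrightarrow> subst_tm \<sigma> t = subst_tm \<tau> t"
  by (induction t) auto

lemma subst_tm_Var [simp]: "subst_tm Var t = t"
  by (induction t) (auto simp: map_idI)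

lemma subst_tm_comp: "subst_tm \<tau> (subst_tm \<sigma> t) = subst_tm (\<lambda>x. subst_tm \<tau> (\<sigma> x)) t"
  by (induction t) auto

lemma subst_tm_ren: "subst_tm (ren h) t = map_tm (\<lambda>x. x) h t"
  by (induction t) (auto simp: ren_def)

lemma vars_subst_tm: "vars_tm (subst_tm \<sigma> t) = (\<Union>x\<in>vars_tm t. vars_tm (\<sigma> x))"
  by (induction t) auto

lemma subst_cong: "(\<And>x. x \<in> fv \<phi> \<Longrightarrow> \<sigma> x = \<tau> x) \<Longrightarrow> subst \<sigma> \<phi> = subst \<tau> \<phi>"
proof (induction \<phi> arbitrary: \<sigma> \<tau>)
  case (Inc ps)
  then have "map (\<lambda>(x, y). (\<sigma> x, \<sigma> y)) ps = map (\<lambda>(x, y). (\<tau> x, \<tau> y)) ps"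
    by (force simp: image_iff)
  then show ?case by (simp only: subst.simps)
next
  case (Ex1 x \<phi>)
  then have "subst (\<sigma>(x := Var x)) \<phi> = subst (\<tau>(x := Var x)) \<phi>"
    by (intro Ex1.IH) auto
  then show ?case by simp
next
  case (All1 x \<phi>)
  then have "subst (\<sigma>(x := Var x)) \<phi> = subst (\<tau>(x := Var x)) \<phi>"
    by (intro All1.IH) auto
  then show ?case by simp
next
  case (Eq t u)
  then show ?case by (auto intro: subst_tm_cong)
next
  case (Rel R ts)
  then show ?case by (auto intro!: subst_tm_cong)
next
  case (And \<phi> \<psi>)
  then show ?case by (metis UnCI fv.simps(5) subst.simps(5))
next
  case (Or1 \<phi> \<psi>)
  then show ?case by (metis UnCI fv.simps(6) subst.simps(6))
next
  case (Dneg \<phi>)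
  then show ?case by (metis fv.simps(4) subst.simps(4))
qed

lemma fresh_0 [simp]: "fresh 0 A = []"
  by (simp add: fresh_def cong: conj_cong)

lemma incl_vars: "incl (map (\<lambda>(x, y). (Var x, Var y)) ps) = Inc ps"
proof -
  have *: "filter (\<lambda>t. \<not> is_Var t) (map fst (map (\<lambda>(x, y). (Var x, Var y)) ps) @
      map snd (map (\<lambda>(x, y). (Var x, Var y)) ps)) = []"
    by (auto simp: filter_empty_conv)
  show ?thesis unfolding incl_def * by (auto simp: exs_def eqs_def Let_def case_prod_unfold comp_def)
qed

lemma subst_ren_Inc [simp]: "subst (ren \<theta>) (Inc ps) = Inc (map (\<lambda>(x, y). (\<theta> x, \<theta> y)) ps)"
  using incl_vars[of "map (\<lambda>(x, y). (\<theta> x, \<theta> y)) ps"] by (simp add: comp_def case_prod_unfold ren_def)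

lemma ren_upd [simp]: "(ren \<theta>)(x := Var y) = ren (\<theta>(x := y))"
  by (auto simp: ren_def)

lemma Var_upd_id: "Var(x := Var y) = ren ((\<lambda>x. x)(x := y))"
  by (auto simp: ren_def)

lemma ren_id [simp]: "ren id = Var" "ren (\<lambda>x. x) = Var"
  by (auto simp: ren_def)

lemma subst_Var [simp]: "subst Var \<phi> = \<phi>"
proof (induction \<phi>)
  case (Inc ps)
  show ?case using subst_ren_Inc[of id ps] by simp
qed (auto simp: map_idI)

text \<open>A renaming may keep a variable that is bound elsewhere in the formula, provided that it
  keeps it in place.\<close>

definition safe :: "('v \<Rightarrow> 'v) \<Rightarrow> ('f, 'r, 'v) fm \<Rightarrow> bool" where
  "safe \<theta> \<phi> \<longleftrightarrow> (\<forall>y\<in>fv \<phi>. \<theta> y = y \<or> \<theta> y \<notin> bv \<phi>)"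

lemma safe_Ex_neq: "safe \<theta> (Ex1 x \<phi>) \<Longrightarrow> y \<in> fv \<phi> \<Longrightarrow> y \<noteq> x \<Longrightarrow> x \<noteq> \<theta> y"
  unfolding safe_def by (metis DiffI bv.simps(7) fv.simps(7) insertCI singletonD)

lemma safe_Ex: "safe \<theta> (Ex1 x \<phi>) \<Longrightarrow> safe (\<theta>(x := x)) \<phi>"
  by (auto simp: safe_def)

lemma safe_All_neq: "safe \<theta> (All1 x \<phi>) \<Longrightarrow> y \<in> fv \<phi> \<Longrightarrow> y \<noteq> x \<Longrightarrow> x \<noteq> \<theta> y"
  unfolding safe_def by (metis DiffI bv.simps(8) fv.simps(8) insertCI singletonD)

lemma safe_All: "safe \<theta> (All1 x \<phi>) \<Longrightarrow> safe (\<theta>(x := x)) \<phi>"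
  by (auto simp: safe_def)

lemma safe_And: "safe \<theta> (And \<phi> \<psi>) \<Longrightarrow> safe \<theta> \<phi> \<and> safe \<theta> \<psi>"
  by (auto simp: safe_def)

lemma safe_Or: "safe \<theta> (Or1 \<phi> \<psi>) \<Longrightarrow> safe \<theta> \<phi> \<and> safe \<theta> \<psi>"
  by (auto simp: safe_def)

lemma safe_Dneg: "safe \<theta> (Dneg \<phi>) \<Longrightarrow> safe \<theta> \<phi>"
  by (auto simp: safe_def)

lemma safe_substitutable: "safe \<theta> \<phi> \<Longrightarrow> substitutable (ren \<theta>) \<phi>"
proof (induction \<phi> arbitrary: \<theta>)
  case (Ex1 x \<phi>)
  have "x \<noteq> \<theta> y" if "y \<in> fv \<phi> - {x}" for y
    using that safe_Ex_neq[OF Ex1.prems] by blast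
  then show ?case using Ex1.IH[OF safe_Ex[OF Ex1.prems]] by (auto simp del: fun_upd_apply)
next
  case (All1 x \<phi>)
  have "x \<noteq> \<theta> y" if "y \<in> fv \<phi> - {x}" for y
    using that safe_All_neq[OF All1.prems] by blast
  then show ?case using All1.IH[OF safe_All[OF All1.prems]] by (auto simp del: fun_upd_apply)
qed (auto simp: safe_def simple_def ren_def)

lemma free_for_ren: "v \<notin> bv \<phi> \<Longrightarrow> free_for (Var v) x \<phi>"
  unfolding free_for_def Var_upd_id by (rule safe_substitutable) (auto simp: safe_def)

lemma subst1_Var: "subst1 \<phi> (Var v) x = subst (ren ((\<lambda>x. x)(x := v))) \<phi>"
  by (simp add: subst1_def Var_upd_id)

text \<open>Renamings compose exactly.  For constant symbols this fails: \<open>subst\<close> turns an inclusion atom into an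
  existential formula with freshly chosen bound variables.  Hence the witnesses in the completeness
  proof are variables with a constant value, not constant symbols.\<close>

lemma subst_ren_comp:
  "safe \<theta> \<phi> \<Longrightarrow> subst (ren \<eta>) (subst (ren \<theta>) \<phi>) = subst (ren (\<lambda>y. \<eta> (\<theta> y))) \<phi>"
proof (induction \<phi> arbitrary: \<theta> \<eta>)
  case (Eq t u)
  then show ?case by (auto simp: subst_tm_comp ren_def)
next
  case (Rel R ts)
  then show ?case by (auto simp: subst_tm_comp ren_def)
next
  case (Inc ps)
  show ?case unfolding subst_ren_Inc by (auto simp: case_prod_unfold)
next
  case (Ex1 x \<phi>)
  have "x \<noteq> \<theta> y" if "y \<in> fv \<phi> - {x}" for y
    using that safe_Ex_neq[OF Ex1.prems] by blast
  then have *: "subst (ren (\<lambda>y. (\<eta>(x := x)) ((\<theta>(x := x)) y))) \<phi> = subst (ren ((\<lambda>y. \<eta> (\<theta> y))(x := x))) \<phi>"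
    by (intro subst_cong) (auto simp: ren_def)
  have "subst (ren (\<eta>(x := x))) (subst (ren (\<theta>(x := x))) \<phi>)
      = subst (ren (\<lambda>y. (\<eta>(x := x)) ((\<theta>(x := x)) y))) \<phi>"
    by (rule Ex1.IH[OF safe_Ex[OF Ex1.prems]])
  then show ?case using * by simp
next
  case (All1 x \<phi>)
  have "x \<noteq> \<theta> y" if "y \<in> fv \<phi> - {x}" for y
    using that safe_All_neq[OF All1.prems] by blast
  then have *: "subst (ren (\<lambda>y. (\<eta>(x := x)) ((\<theta>(x := x)) y))) \<phi> = subst (ren ((\<lambda>y. \<eta> (\<theta> y))(x := x))) \<phi>"
    by (intro subst_cong) (auto simp: ren_def)
  have "subst (ren (\<eta>(x := x))) (subst (ren (\<theta>(x := x))) \<phi>)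
      = subst (ren (\<lambda>y. (\<eta>(x := x)) ((\<theta>(x := x)) y))) \<phi>"
    by (rule All1.IH[OF safe_All[OF All1.prems]])
  then show ?case using * by simp
qed (auto dest: safe_And safe_Or safe_Dneg)

text \<open>A change of the type of variables.  It also moves the bound variables, so it commutes with
  substitution only where \<open>h\<close> is injective.\<close>

abbreviation mv :: "('v \<Rightarrow> 'w) \<Rightarrow> ('f, 'r, 'v) fm \<Rightarrow> ('f, 'r, 'w) fm" where
  "mv h \<equiv> map_fm (\<lambda>x. x) (\<lambda>x. x) h"

lemma mv_ren:
  "inj_on h (vars \<phi>) \<Longrightarrow> (\<And>y. y \<in> fv \<phi> \<Longrightarrow> \<theta>' (h y) = h (\<theta> y)) \<Longrightarrow>
    mv h (subst (ren \<theta>) \<phi>) = subst (ren \<theta>') (mv h \<phi>)"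
proof (induction \<phi> arbitrary: \<theta> \<theta>')
  case (Eq t u)
  then show ?case
    by (auto simp: subst_tm_ren tm.map_comp intro!: tm.map_cong)
next
  case (Rel R ts)
  then show ?case
    by (auto simp: subst_tm_ren tm.map_comp intro!: tm.map_cong) (metis UN_I)
next
  case (Inc ps)
  then show ?case unfolding subst_ren_Inc fm.map(3) by (force simp: image_iff)
next
  case (And \<phi> \<psi>)
  then show ?case by (simp add: inj_on_Un)
next
  case (Or1 \<phi> \<psi>)
  then show ?case by (simp add: inj_on_Un)
next
  case (Ex1 x \<phi>)
  have "mv h (subst (ren (\<theta>(x := x))) \<phi>) = subst (ren (\<theta>'(h x := h x))) (mv h \<phi>)"
    using Ex1.prems fv_subset_vars[of \<phi>]
    by (intro Ex1.IH; auto simp: inj_on_def; blast)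
  then show ?case by simp
next
  case (All1 x \<phi>)
  have "mv h (subst (ren (\<theta>(x := x))) \<phi>) = subst (ren (\<theta>'(h x := h x))) (mv h \<phi>)"
    using All1.prems fv_subset_vars[of \<phi>]
    by (intro All1.IH; auto simp: inj_on_def; blast)
  then show ?case by simp
qed auto

lemma mv_subst1:
  assumes "inj_on h (insert x (vars \<phi>))"
  shows "mv h (subst1 \<phi> (Var v) x) = subst1 (mv h \<phi>) (Var (h v)) (h x)"
  unfolding subst1_Var using assms fv_subset_vars[of \<phi>]
  by (intro mv_ren) (auto simp: inj_on_def)

text \<open>If \<open>h\<close> and \<open>k\<close> agree on the bound variables, the two images differ by a renaming of free
  variables.\<close>

lemma mv_change:
  "inj_on h (vars \<phi>) \<Longrightarrow> (\<And>y. y \<in> fv \<phi> \<Longrightarrow> \<theta> (h y) = k y) \<Longrightarrow> (\<And>y. y \<in> bv \<phi> \<Longrightarrow> h y = k y) \<Longrightarrow>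
    subst (ren \<theta>) (mv h \<phi>) = mv k \<phi>"
proof (induction \<phi> arbitrary: \<theta>)
  case (Eq t u)
  then show ?case
    by (auto simp: subst_tm_ren tm.map_comp intro!: tm.map_cong)
next
  case (Rel R ts)
  then show ?case
    by (auto simp: subst_tm_ren tm.map_comp intro!: tm.map_cong, blast+)
next
  case (Inc ps)
  then show ?case unfolding fm.map(3) subst_ren_Inc by (force simp: image_iff)
next
  case (And \<phi> \<psi>)
  then show ?case by (simp add: inj_on_Un)
next
  case (Or1 \<phi> \<psi>)
  then show ?case by (simp add: inj_on_Un)
next
  case (Ex1 x \<phi>)
  have "subst (ren (\<theta>(h x := h x))) (mv h \<phi>) = mv k \<phi>"
  proof (rule Ex1.IH)
    show "inj_on h (vars \<phi>)" using Ex1.prems(1) by (rule inj_on_subset) auto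
    show "(\<theta>(h x := h x)) (h y) = k y" if "y \<in> fv \<phi>" for y
    proof (cases "y = x")
      case False
      then have "h y \<noteq> h x"
        using that Ex1.prems(1) fv_subset_vars[of \<phi>] by (auto simp: inj_on_def)
      then show ?thesis using that False Ex1.prems(2) by simp
    qed (use Ex1.prems(3) in simp)
    show "h y = k y" if "y \<in> bv \<phi>" for y using that Ex1.prems(3) by simp
  qed
  then show ?case using Ex1.prems by simp
next
  case (All1 x \<phi>)
  have "subst (ren (\<theta>(h x := h x))) (mv h \<phi>) = mv k \<phi>"
  proof (rule All1.IH)
    show "inj_on h (vars \<phi>)" using All1.prems(1) by (rule inj_on_subset) auto
    show "(\<theta>(h x := h x)) (h y) = k y" if "y \<in> fv \<phi>" for y
    proof (cases "y = x")
      case False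
      then have "h y \<noteq> h x"
        using that All1.prems(1) fv_subset_vars[of \<phi>] by (auto simp: inj_on_def)
      then show ?thesis using that False All1.prems(2) by simp
    qed (use All1.prems(3) in simp)
    show "h y = k y" if "y \<in> bv \<phi>" for y using that All1.prems(3) by simp
  qed
  then show ?case using All1.prems by simp
qed auto

lemma vars_mv [simp]: "vars (mv h \<phi>) = h ` vars \<phi>"
  by (simp add: fm.set_map)

lemma bv_mv [simp]: "bv (mv h \<phi>) = h ` bv \<phi>"
  by (induction \<phi>) auto

lemma fv_mv: "inj_on h (vars \<phi>) \<Longrightarrow> fv (mv h \<phi>) = h ` fv \<phi>"
proof (induction \<phi>)
  case (Ex1 x \<phi>)
  then show ?case using fv_subset_vars[of \<phi>] by (auto simp: inj_on_def)
next
  case (All1 x \<phi>)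
  then show ?case using fv_subset_vars[of \<phi>] by (auto simp: inj_on_def)
qed (auto simp: inj_on_Un image_Un tm.set_map image_image case_prod_unfold map_prod_def)

lemma fv_mv_subset: "fv (mv h \<phi>) \<subseteq> h ` vars \<phi>"
  using fv_subset_vars[of "mv h \<phi>"] by simp

lemma mv_cong: "(\<And>x. x \<in> vars \<phi> \<Longrightarrow> h x = k x) \<Longrightarrow> mv h \<phi> = mv k \<phi>"
  by (rule fm.map_cong) auto

lemma fv_subst_ren_subset: "fv (subst (ren \<theta>) \<phi>) \<subseteq> \<theta> ` fv \<phi>"
proof (induction \<phi> arbitrary: \<theta>)
  case (Inc ps)
  show ?case unfolding subst_ren_Inc by (force simp: image_iff)
next
  case (Ex1 x \<phi>)
  then show ?case by (fastforce simp: image_iff)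
next
  case (All1 x \<phi>)
  then show ?case by (fastforce simp: image_iff)
next
  case (And \<phi> \<psi>)
  then show ?case by (simp add: image_Un) blast
next
  case (Or1 \<phi> \<psi>)
  then show ?case by (simp add: image_Un) blast
qed (auto simp: vars_subst_tm)

lemma bv_subst_ren [simp]: "bv (subst (ren \<theta>) \<phi>) = bv \<phi>"
proof (induction \<phi> arbitrary: \<theta>)
  case (Inc ps)
  show ?case unfolding subst_ren_Inc by simp
qed auto

lemma mv_exs: "mv h (exs zs \<phi>) = exs (map h zs) (mv h \<phi>)"
  by (induction zs) (auto simp: exs_def)

section \<open>Soundness\<close>

lemma eval_cong:
  assumes "\<And>x. x \<in> vars_tm t \<Longrightarrow> s x = s' x" "\<And>f. f \<in> fsyms_tm t \<Longrightarrow> fun_int M f = fun_int N f"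
  shows "eval M s t = eval N s' t"
  using assms
proof (induction t)
  case (Fn f ts)
  then have "map (eval M s) ts = map (eval N s') ts" by fastforce
  moreover have "fun_int M f = fun_int N f" using Fn.prems by simp
  ultimately show ?case by (simp only: eval.simps)
qed simp

lemma eval_subst_tm: "eval M s (subst_tm \<sigma> t) = eval M (\<lambda>x. eval M s (\<sigma> x)) t"
  by (induction t) (auto simp: comp_def cong: map_cong)

lemma structure_nonempty: "M \<in> structures \<Longrightarrow> \<exists>a. a \<in> carrier M"
  by (auto simp: structures_def)

lemma team_upd_image: "team_upd (f ` I) x a = (\<lambda>i. (f i)(x := a)) ` I"
  by (auto simp: team_upd_def)

text \<open>Truth in a team is local, but the team is a set of assignments and cannot be compared variable by
  variable.  Two teams that are indexed by the same set \<open>I\<close> can.\<close>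

lemma sat_cong:
  assumes "carrier M = carrier N"
    and "\<And>f. f \<in> fsyms \<phi> \<Longrightarrow> fun_int M f = fun_int N f"
    and "\<And>R. R \<in> rsyms \<phi> \<Longrightarrow> rel_int M R = rel_int N R"
    and "\<And>i x. i \<in> I \<Longrightarrow> x \<in> fv \<phi> \<Longrightarrow> f i x = g i x"
  shows "sat M (f ` I) \<phi> = sat N (g ` I) \<phi>"
  using assms(2-)
proof (induction \<phi> arbitrary: f g)
  case (Eq t u)
  then have "eval M (f i) t = eval N (g i) t" "eval M (f i) u = eval N (g i) u" if "i \<in> I" for i
    using that by (auto intro!: eval_cong)
  then show ?case by auto
next
  case (Rel R ts)
  have "map (eval M (f i)) ts = map (eval N (g i)) ts" if "i \<in> I" for i
    using that Rel.prems by (auto intro!: eval_cong) blast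
  then show ?case using Rel.prems(2)[of R] by (simp del: map_eq_conv)
next
  case (Inc ps)
  have "map (f i) (map fst ps) = map (g i) (map fst ps)" "map (f i) (map snd ps) = map (g i) (map snd ps)"
    if "i \<in> I" for i
    using that Inc.prems(3) by auto
  then show ?case by (simp del: map_map map_eq_conv)
next
  case (Dneg \<phi>)
  then have "sat M (f ` I) \<phi> = sat N (g ` I) \<phi>" by (intro Dneg.IH) auto
  then show ?case by auto
next
  case (And \<phi> \<psi>)
  have "sat M (f ` I) \<phi> = sat N (g ` I) \<phi>" using And.prems by (intro And.IH(1)) auto
  moreover have "sat M (f ` I) \<psi> = sat N (g ` I) \<psi>" using And.prems by (intro And.IH(2)) auto
  ultimately show ?case by simp
next
  case (Or1 \<phi> \<psi>)
  have "sat M (f ` I) \<phi> = sat N (g ` I) \<phi>" using Or1.prems by (intro Or1.IH(1)) auto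
  moreover have "sat M (f ` I) \<psi> = sat N (g ` I) \<psi>" using Or1.prems by (intro Or1.IH(2)) auto
  ultimately show ?case by simp
next
  case (Ex1 x \<phi>)
  have "sat M ((\<lambda>i. (f i)(x := a)) ` I) \<phi> = sat N ((\<lambda>i. (g i)(x := a)) ` I) \<phi>" for a
    using Ex1.prems by (intro Ex1.IH) auto
  then show ?case by (simp add: team_upd_image assms(1))
next
  case (All1 x \<phi>)
  have "sat M ((\<lambda>i. (f i)(x := a)) ` I) \<phi> = sat N ((\<lambda>i. (g i)(x := a)) ` I) \<phi>" for a
    using All1.prems by (intro All1.IH) auto
  then show ?case by (simp add: team_upd_image assms(1))
qed

lemma sat_agree:
  "(\<And>i x. i \<in> I \<Longrightarrow> x \<in> fv \<phi> \<Longrightarrow> f i x = g i x) \<Longrightarrow> sat M (f ` I) \<phi> = sat M (g ` I) \<phi>"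
  by (rule sat_cong) auto

lemma sat_upd_fresh: "v \<notin> fv \<phi> \<Longrightarrow> sat M (team_upd X v a) \<phi> = sat M X \<phi>"
  using sat_agree[of X \<phi> "\<lambda>s. s(v := a)" "\<lambda>s. s" M] by (simp add: team_upd_def) (metis fun_upd_other)

lemma sat_empty: "M \<in> structures \<Longrightarrow> sat M {} \<phi>"
  by (induction \<phi>) (auto simp: team_upd_def structures_def)

lemma sat_bot: "M \<in> structures \<Longrightarrow> sat M X bot_fm \<longleftrightarrow> X = {}"
  by (auto simp: bot_fm_def Let_def team_upd_def structures_def)

lemma sat_exs:
  fixes X :: "('v \<Rightarrow> 'm) set"
  shows "sat M X (exs xs \<phi>) \<longleftrightarrow>
    (\<exists>b. (\<forall>x\<in>set xs. b x \<in> carrier M) \<and> sat M ((\<lambda>s x. if x \<in> set xs then b x else s x) ` X) \<phi>)"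
proof (induction xs arbitrary: X)
  case Nil
  then show ?case by (simp add: exs_def)
next
  case (Cons y ys)
  let ?U = "\<lambda>(b :: 'v \<Rightarrow> 'm) (xs :: 'v list) s x. if x \<in> set xs then b x else (s :: 'v \<Rightarrow> 'm) x"
  have eq: "?U b ys ` team_upd X y a = ?U (if y \<in> set ys then b else b(y := a)) (y # ys) ` X" for b a
    unfolding team_upd_def image_image by (rule image_cong) (auto simp: fun_eq_iff)
  have "sat M X (exs (y # ys) \<phi>) \<longleftrightarrow> (\<exists>a\<in>carrier M. sat M (team_upd X y a) (exs ys \<phi>))"
    by (simp add: exs_def)
  also have "\<dots> \<longleftrightarrow> (\<exists>a\<in>carrier M. \<exists>b. (\<forall>x\<in>set ys. b x \<in> carrier M) \<and>
      sat M (?U (if y \<in> set ys then b else b(y := a)) (y # ys) ` X) \<phi>)"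
    by (simp only: Cons.IH eq)
  also have "\<dots> \<longleftrightarrow> (\<exists>b. (\<forall>x\<in>set (y # ys). b x \<in> carrier M) \<and> sat M (?U b (y # ys) ` X) \<phi>)"
    (is "?A \<longleftrightarrow> ?B")
  proof
    assume ?A
    then obtain a b where *: "a \<in> carrier M" "\<forall>x\<in>set ys. b x \<in> carrier M"
      "sat M (?U (if y \<in> set ys then b else b(y := a)) (y # ys) ` X) \<phi>" by blast
    then show ?B by (intro exI[of _ "if y \<in> set ys then b else b(y := a)"]) auto
  next
    assume ?B
    then obtain b where *: "\<forall>x\<in>set (y # ys). b x \<in> carrier M" "sat M (?U b (y # ys) ` X) \<phi>" by blast
    moreover have "(if y \<in> set ys then b else b(y := b y)) = b" by auto
    ultimately show ?A by (intro bexI[of _ "b y"] exI[of _ b]) (simp_all only:, auto)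
  qed
  finally show ?case .
qed

lemma sat_conjs: "M \<in> structures \<Longrightarrow> sat M X (conjs \<phi>s) \<longleftrightarrow> (\<forall>\<phi>\<in>set \<phi>s. sat M X \<phi>)"
  by (induction \<phi>s rule: conjs.induct) (auto simp: sat_bot)

lemma sat_eqs:
  assumes "M \<in> structures" "length xs = length ts"
  shows "(\<forall>\<phi>\<in>set (eqs xs ts). sat M X \<phi>) \<longleftrightarrow>
    (\<forall>i<length ts. \<forall>s\<in>X. s (xs ! i) = eval M s (ts ! i))"
  using assms(2) by (auto simp: eqs_def set_zip all_set_conv_all_nth)

text \<open>A derivation may mention variables outside the domain of a team, so soundness is proved for teams of
  assignments whose values all lie in the carrier.\<close>

definition total :: "('f, 'r, 'm) struct \<Rightarrow> ('v \<Rightarrow> 'm) set \<Rightarrow> bool" where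
  "total M X \<longleftrightarrow> (\<forall>s\<in>X. \<forall>x. s x \<in> carrier M)"

lemma total_upd: "total M X \<Longrightarrow> a \<in> carrier M \<Longrightarrow> total M (team_upd X x a)"
  by (auto simp: total_def team_upd_def)

lemma sat_cst:
  fixes ts :: "('f, 'v) tm list"
  assumes "infinite (UNIV :: 'v set)" and M: "M \<in> structures" and X: "total M X"
  shows "sat M X (cst ts) \<longleftrightarrow> (\<forall>t\<in>set ts. \<exists>a\<in>carrier M. \<forall>s\<in>X. eval M s t = a)"
proof -
  define A where "A = (\<Union>t\<in>set ts. vars_tm t)"
  define xs where "xs = fresh (length ts) A"
  have xs: "length xs = length ts" "distinct xs" "set xs \<inter> A = {}"
    using fresh_props[OF assms(1), of A] unfolding xs_def A_def by auto
  have hvar: "eval M (\<lambda>x. if x \<in> set xs then b x else s x) t = eval M s t" if "t \<in> set ts" for b s t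
    using that xs(3) by (intro eval_cong) (auto simp: A_def)
  have "sat M X (cst ts) \<longleftrightarrow> (\<exists>b. (\<forall>x\<in>set xs. b x \<in> carrier M) \<and>
      (\<forall>i<length ts. \<forall>s\<in>X. b (xs ! i) = eval M s (ts ! i)))"
    unfolding cst_def Let_def A_def[symmetric] xs_def[symmetric] sat_exs sat_conjs[OF M]
      sat_eqs[OF M xs(1)] using xs(1) by (auto simp: hvar)
  also have "\<dots> \<longleftrightarrow> (\<forall>t\<in>set ts. \<exists>a\<in>carrier M. \<forall>s\<in>X. eval M s t = a)" (is "?A \<longleftrightarrow> ?B")
  proof
    assume ?A
    then obtain b where b: "\<forall>x\<in>set xs. b x \<in> carrier M"
      "\<forall>i<length ts. \<forall>s\<in>X. b (xs ! i) = eval M s (ts ! i)" by blast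
    show ?B
    proof
      fix t
      assume "t \<in> set ts"
      then obtain i where "i < length ts" "t = ts ! i" by (auto simp: in_set_conv_nth)
      then show "\<exists>a\<in>carrier M. \<forall>s\<in>X. eval M s t = a"
        using b xs(1) by (intro bexI[of _ "b (xs ! i)"]) auto
    qed
  next
    assume ?B
    then obtain g where g: "\<And>t. t \<in> set ts \<Longrightarrow> g t \<in> carrier M \<and> (\<forall>s\<in>X. eval M s t = g t)"
      by metis
    define b where "b x = g (the (map_of (zip xs ts) x))" for x
    have b: "b (xs ! i) = g (ts ! i)" if "i < length ts" for i
      using that xs by (simp add: b_def map_of_zip_nth)
    have "b x \<in> carrier M" if "x \<in> set xs" for x
      using that b g xs(1) by (metis in_set_conv_nth nth_mem)
    then show ?A using b g by (intro exI[of _ b]) auto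
  qed
  finally show ?thesis .
qed

text \<open>In a nonempty team the equations force the bound variables to take the values of the constant
  symbols, which leaves the inclusion condition for the terms themselves.\<close>

lemma sat_incl:
  fixes ps :: "(('f, 'v) tm \<times> ('f, 'v) tm) list" and M :: "('f, 'r, 'm) struct"
  assumes "infinite (UNIV :: 'v set)" and M: "M \<in> structures"
    and ps: "\<forall>(t, u)\<in>set ps. simple t \<and> simple u"
  shows "sat M X (incl ps) \<longleftrightarrow>
    (\<forall>s\<in>X. \<exists>s'\<in>X. map (eval M s) (map fst ps) = map (eval M s') (map snd ps))"
proof (cases "X = {}")
  case True
  then show ?thesis by (simp add: sat_empty[OF M])
next
  case False
  define cs where "cs = remdups (filter (\<lambda>t. \<not> is_Var t) (map fst ps @ map snd ps))"
  define A where "A = (\<Union>(t, u)\<in>set ps. vars_tm t \<union> vars_tm u)"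
  define us where "us = fresh (length cs) A"
  define \<rho> where "\<rho> = (\<lambda>t. if is_Var t then the_Var t else the (map_of (zip cs us) t))"
  have "finite A" by (auto simp: A_def)
  then have us: "length us = length cs" "distinct us" "set us \<inter> A = {}"
    using fresh_props[OF assms(1), of A] unfolding us_def by auto
  have cs: "\<exists>c. t = Fn c []" if "t \<in> set cs" for t
    using that ps by (auto simp: cs_def simple_def)
  have incl: "incl ps = exs us (conjs (eqs us cs @ [Inc (map (\<lambda>(t, u). (\<rho> t, \<rho> u)) ps)]))"
    unfolding incl_def Let_def cs_def us_def A_def \<rho>_def ..
  define U where "U b s x = (if x \<in> set us then b x else s x)" for b s :: "'v \<Rightarrow> 'm" and x
  have hvar: "eval M (U b s) t = eval M s t" if "t \<in> set cs" for b s t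
    using cs[OF that] by auto
  have \<rho>: "U b s (\<rho> t) = eval M s t"
    if t: "t \<in> set (map fst ps @ map snd ps)"
      and b: "\<forall>i<length cs. b (us ! i) = eval M s (cs ! i)" for b s t
  proof (cases t)
    case (Var x)
    then have "x \<in> A" using t by (force simp: A_def)
    then show ?thesis using Var us(3) by (auto simp: \<rho>_def U_def)
  next
    case (Fn f ts)
    then have "t \<in> set cs" using t by (auto simp: cs_def)
    then obtain i where i: "i < length cs" "t = cs ! i" by (auto simp: in_set_conv_nth)
    have "distinct cs" by (simp add: cs_def)
    then have "\<rho> t = us ! i" using i us(1) Fn by (simp add: \<rho>_def map_of_zip_nth) (metis tm.disc(2))
    then show ?thesis using i us(1) b by (simp add: U_def)
  qed
  have "sat M X (incl ps) \<longleftrightarrow> (\<exists>b. (\<forall>x\<in>set us. b x \<in> carrier M) \<and>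
      (\<forall>i<length cs. \<forall>s\<in>X. b (us ! i) = eval M s (cs ! i)) \<and>
      (\<forall>s\<in>X. \<exists>s'\<in>X. map (\<lambda>p. U b s (\<rho> (fst p))) ps = map (\<lambda>p. U b s' (\<rho> (snd p))) ps))"
    unfolding incl sat_exs U_def[symmetric] sat_conjs[OF M] set_append ball_Un
      sat_eqs[OF M us(1)] using us(1) hvar by (simp add: case_prod_unfold comp_def) (simp add: U_def)
  also have "\<dots> \<longleftrightarrow> (\<exists>b. (\<forall>x\<in>set us. b x \<in> carrier M) \<and>
      (\<forall>i<length cs. \<forall>s\<in>X. b (us ! i) = eval M s (cs ! i)) \<and>
      (\<forall>s\<in>X. \<exists>s'\<in>X. map (\<lambda>p. eval M s (fst p)) ps = map (\<lambda>p. eval M s' (snd p)) ps))"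
  proof -
    have "map (\<lambda>p. U b s (\<rho> (fst p))) ps = map (\<lambda>p. eval M s (fst p)) ps"
      "map (\<lambda>p. U b s (\<rho> (snd p))) ps = map (\<lambda>p. eval M s (snd p)) ps"
      if "\<forall>i<length cs. \<forall>s\<in>X. b (us ! i) = eval M s (cs ! i)" "s \<in> X" for b s
      using that by (auto intro!: \<rho>, force)+
    then show ?thesis by (intro ex_cong1 conj_cong refl) simp
  qed
  also have "\<dots> \<longleftrightarrow> (\<forall>s\<in>X. \<exists>s'\<in>X. map (\<lambda>p. eval M s (fst p)) ps = map (\<lambda>p. eval M s' (snd p)) ps)"
  proof -
    obtain s0 where s0: "s0 \<in> X" using False by blast
    define b where "b x = eval M s0 (the (map_of (zip us cs) x))" for x
    have b: "b (us ! i) = eval M s (cs ! i)" if "i < length cs" for i s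
      using that us cs[of "cs ! i"] by (auto simp: b_def map_of_zip_nth)
    moreover have "b x \<in> carrier M" if x: "x \<in> set us" for x
    proof -
      obtain i where i: "i < length us" "x = us ! i" using x by (auto simp: in_set_conv_nth)
      then obtain c where "cs ! i = Fn c []" using cs[of "cs ! i"] us(1) by auto
      then show ?thesis using b[of i s0] i us(1) M by (simp add: structures_def)
    qed
    ultimately have "\<exists>b. (\<forall>x\<in>set us. b x \<in> carrier M) \<and>
        (\<forall>i<length cs. \<forall>s\<in>X. b (us ! i) = eval M s (cs ! i))" by blast
    then show ?thesis by blast
  qed
  finally show ?thesis by (simp add: comp_def)
qed


lemma substitutable_const:
  "(\<And>y. \<sigma> y = Var y \<or> (\<exists>c. \<sigma> y = Fn c [])) \<Longrightarrow> substitutable \<sigma> \<phi>"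
proof (induction \<phi> arbitrary: \<sigma>)
  case (Inc ps)
  then show ?case by (auto simp: simple_def)
next
  case (Ex1 x \<phi>)
  have "x \<notin> vars_tm (\<sigma> y)" if "y \<noteq> x" for y using Ex1.prems[of y] that by auto
  moreover have "substitutable (\<sigma>(x := Var x)) \<phi>" using Ex1.prems by (intro Ex1.IH) auto
  ultimately show ?case by simp
next
  case (All1 x \<phi>)
  have "x \<notin> vars_tm (\<sigma> y)" if "y \<noteq> x" for y using All1.prems[of y] that by auto
  moreover have "substitutable (\<sigma>(x := Var x)) \<phi>" using All1.prems by (intro All1.IH) auto
  ultimately show ?case by simp
next
  case (And \<phi> \<psi>)
  show ?case using And.IH(1)[OF And.prems] And.IH(2)[OF And.prems] by simp
next
  case (Or1 \<phi> \<psi>)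
  show ?case using Or1.IH(1)[OF Or1.prems] Or1.IH(2)[OF Or1.prems] by simp
next
  case (Dneg \<phi>)
  show ?case using Dneg.IH[OF Dneg.prems] by simp
qed auto

text \<open>Below a quantifier, updating at \<open>x\<close> commutes with evaluating the substitution because no
  substituted term contains \<open>x\<close>.\<close>

lemma sat_subst_binder:
  assumes "sat M ((\<lambda>i. (f i)(x := a)) ` I) (subst (\<sigma>(x := Var x)) \<phi>) =
      sat M ((\<lambda>i y. eval M ((f i)(x := a)) ((\<sigma>(x := Var x)) y)) ` I) \<phi>"
    and "\<forall>y\<in>fv \<phi> - {x}. x \<notin> vars_tm (\<sigma> y)"
  shows "sat M (team_upd (f ` I) x a) (subst (\<sigma>(x := Var x)) \<phi>) =
    sat M (team_upd ((\<lambda>i x. eval M (f i) (\<sigma> x)) ` I) x a) \<phi>"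
proof -
  have "sat M ((\<lambda>i y. eval M ((f i)(x := a)) ((\<sigma>(x := Var x)) y)) ` I) \<phi> =
      sat M ((\<lambda>i. (\<lambda>y. eval M (f i) (\<sigma> y))(x := a)) ` I) \<phi>"
    using assms(2) by (intro sat_agree) (auto intro!: eval_cong)
  then show ?thesis using assms(1) by (simp add: team_upd_image)
qed

lemma sat_subst:
  fixes \<phi> :: "('f, 'r, 'v) fm" and M :: "('f, 'r, 'm) struct"
  assumes "infinite (UNIV :: 'v set)" and M: "M \<in> structures"
  shows "(\<And>i x. i \<in> I \<Longrightarrow> f i x \<in> carrier M) \<Longrightarrow> substitutable \<sigma> \<phi> \<Longrightarrow>
    sat M (f ` I) (subst \<sigma> \<phi>) = sat M ((\<lambda>i x. eval M (f i) (\<sigma> x)) ` I) \<phi>"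
proof (induction \<phi> arbitrary: \<sigma> f)
  case (Eq t u)
  show ?case by (simp add: eval_subst_tm)
next
  case (Rel R ts)
  show ?case by (simp add: eval_subst_tm comp_def)
next
  case (Inc ps)
  have "\<forall>(t, u)\<in>set (map (\<lambda>(x, y). (\<sigma> x, \<sigma> y)) ps). simple t \<and> simple u"
    using Inc.prems by auto
  from sat_incl[OF assms this] show ?case by (simp add: case_prod_unfold comp_def)
next
  case (Ex1 x \<phi>)
  have "sat M (team_upd (f ` I) x a) (subst (\<sigma>(x := Var x)) \<phi>) =
      sat M (team_upd ((\<lambda>i x. eval M (f i) (\<sigma> x)) ` I) x a) \<phi>" if "a \<in> carrier M" for a
    by (rule sat_subst_binder, rule Ex1.IH) (use Ex1.prems that in \<open>auto simp del: fun_upd_apply\<close>, auto)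
  then show ?case by simp
next
  case (All1 x \<phi>)
  have "sat M (team_upd (f ` I) x a) (subst (\<sigma>(x := Var x)) \<phi>) =
      sat M (team_upd ((\<lambda>i x. eval M (f i) (\<sigma> x)) ` I) x a) \<phi>" if "a \<in> carrier M" for a
    by (rule sat_subst_binder, rule All1.IH) (use All1.prems that in \<open>auto simp del: fun_upd_apply\<close>, auto)
  then show ?case by simp
next
  case (Dneg \<phi>)
  have "sat M (f ` I) (subst \<sigma> \<phi>) = sat M ((\<lambda>i x. eval M (f i) (\<sigma> x)) ` I) \<phi>"
    using Dneg.prems by (intro Dneg.IH) auto
  then show ?case by simp
next
  case (And \<phi> \<psi>)
  have "sat M (f ` I) (subst \<sigma> \<phi>) = sat M ((\<lambda>i x. eval M (f i) (\<sigma> x)) ` I) \<phi>"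
    "sat M (f ` I) (subst \<sigma> \<psi>) = sat M ((\<lambda>i x. eval M (f i) (\<sigma> x)) ` I) \<psi>"
    using And.prems by (auto intro!: And.IH)
  then show ?case by simp
next
  case (Or1 \<phi> \<psi>)
  have "sat M (f ` I) (subst \<sigma> \<phi>) = sat M ((\<lambda>i x. eval M (f i) (\<sigma> x)) ` I) \<phi>"
    "sat M (f ` I) (subst \<sigma> \<psi>) = sat M ((\<lambda>i x. eval M (f i) (\<sigma> x)) ` I) \<psi>"
    using Or1.prems by (auto intro!: Or1.IH)
  then show ?case by simp
qed

lemma sat_subst_total:
  fixes \<phi> :: "('f, 'r, 'v) fm" and M :: "('f, 'r, 'm) struct"
  assumes "infinite (UNIV :: 'v set)" "M \<in> structures" "total M X" "substitutable \<sigma> \<phi>"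
  shows "sat M X (subst \<sigma> \<phi>) = sat M ((\<lambda>s x. eval M s (\<sigma> x)) ` X) \<phi>"
  using sat_subst[OF assms(1,2), of X "\<lambda>s. s" \<sigma> \<phi>] assms(3,4) by (simp add: total_def)

lemma sat_subst1:
  fixes \<phi> :: "('f, 'r, 'v) fm" and M :: "('f, 'r, 'm) struct"
  assumes "infinite (UNIV :: 'v set)" "M \<in> structures" "total M X" "free_for t x \<phi>"
  shows "sat M X (subst1 \<phi> t x) = sat M ((\<lambda>s. s(x := eval M s t)) ` X) \<phi>"
proof -
  have "(\<lambda>y. eval M s ((Var(x := t)) y)) = s(x := eval M s t)" for s by auto
  then show ?thesis
    unfolding subst1_def using sat_subst_total[OF assms(1-3), of "Var(x := t)" \<phi>] assms(4)
    by (simp add: free_for_def)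
qed

lemma sat_subst1_constant:
  fixes \<phi> :: "('f, 'r, 'v) fm" and M :: "('f, 'r, 'm) struct"
  assumes "infinite (UNIV :: 'v set)" "M \<in> structures" "total M X" "free_for t x \<phi>"
    and "\<And>s. s \<in> X \<Longrightarrow> eval M s t = a"
  shows "sat M X (subst1 \<phi> t x) = sat M (team_upd X x a) \<phi>"
  unfolding sat_subst1[OF assms(1-4)] team_upd_def using assms(5) by (metis (no_types, lifting) image_cong)

text \<open>Fresh constant symbols are sound because they can be reinterpreted.\<close>

definition reinterpret ::
  "('f, 'r, 'm) struct \<Rightarrow> 'f set \<Rightarrow> ('f \<Rightarrow> 'm) \<Rightarrow> ('f, 'r, 'm) struct" where
  "reinterpret M C k =
    M\<lparr>fun_int := (\<lambda>f as. if as = [] \<and> f \<in> C then k f else fun_int M f as)\<rparr>"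

lemma reinterpret_structure:
  "M \<in> structures \<Longrightarrow> (\<And>c. c \<in> C \<Longrightarrow> k c \<in> carrier M) \<Longrightarrow> reinterpret M C k \<in> structures"
  by (auto simp: structures_def reinterpret_def)

lemma reinterpret_simps [simp]:
  "carrier (reinterpret M C k) = carrier M"
  "rel_int (reinterpret M C k) = rel_int M"
  "total (reinterpret M C k) X = total M X"
  by (simp_all add: reinterpret_def total_def)

lemma fun_int_reinterpret:
  "c \<in> C \<Longrightarrow> fun_int (reinterpret M C k) c [] = k c"
  "f \<notin> C \<Longrightarrow> fun_int (reinterpret M C k) f = fun_int M f"
  by (auto simp: reinterpret_def)

lemma sat_reinterpret:
  assumes "C \<inter> fsyms \<phi> = {}"
  shows "sat (reinterpret M C k) X \<phi> = sat M X \<phi>"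
proof -
  have "sat (reinterpret M C k) ((\<lambda>s. s) ` X) \<phi> = sat M ((\<lambda>s. s) ` X) \<phi>"
    using assms by (intro sat_cong) (auto intro!: fun_int_reinterpret)
  then show ?thesis by simp
qed

text \<open>The value of a fresh variable is free, so it can be made to agree with the value of the
  quantified one.\<close>

lemma sat_fresh_var:
  fixes \<phi> :: "('f, 'r, 'v) fm" and M :: "('f, 'r, 'm) struct"
  assumes "infinite (UNIV :: 'v set)" "M \<in> structures" "total M X" "a \<in> carrier M"
    and "v \<notin> fv \<phi>" "free_for (Var v) x \<phi>"
  shows "sat M (team_upd X v a) (subst1 \<phi> (Var v) x) = sat M (team_upd X x a) \<phi>"
    and "sat M (team_upd X v a) (cst [Var v])"
proof -
  define Y where "Y = team_upd X v a"
  have Y: "total M Y" unfolding Y_def by (rule total_upd[OF assms(3,4)])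
  have "sat M Y (subst1 \<phi> (Var v) x) = sat M (team_upd Y x a) \<phi>"
    by (rule sat_subst1_constant[OF assms(1,2) Y assms(6)]) (auto simp: Y_def team_upd_def)
  also have "\<dots> = sat M ((\<lambda>s. s(v := a, x := a)) ` X) \<phi>"
    by (simp add: Y_def team_upd_def image_image)
  also have "\<dots> = sat M (team_upd X x a) \<phi>"
    unfolding team_upd_def using assms(5) by (intro sat_agree) auto
  finally show "sat M (team_upd X v a) (subst1 \<phi> (Var v) x) = sat M (team_upd X x a) \<phi>"
    by (simp add: Y_def)
  have "sat M Y (cst [Var v])"
    unfolding sat_cst[OF assms(1,2) Y] using assms(4) by (auto simp: Y_def team_upd_def)
  then show "sat M (team_upd X v a) (cst [Var v])" by (simp add: Y_def)
qed

lemma sat_fresh_const: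
  fixes \<phi> :: "('f, 'r, 'v) fm" and M :: "('f, 'r, 'm) struct"
  assumes "infinite (UNIV :: 'v set)" "M \<in> structures" "total M X" "a \<in> carrier M" "c \<notin> fsyms \<phi>"
  defines "N \<equiv> reinterpret M {c} (\<lambda>_. a)"
  shows "N \<in> structures" "total N X"
    and "sat N X (subst1 \<phi> (Fn c []) x) = sat M (team_upd X x a) \<phi>"
proof -
  show N: "N \<in> structures" "total N X"
    using assms(2-4) by (auto simp: N_def intro!: reinterpret_structure)
  have "free_for (Fn c []) x \<phi>"
    unfolding free_for_def by (rule substitutable_const) auto
  then have "sat N X (subst1 \<phi> (Fn c []) x) = sat N (team_upd X x a) \<phi>"
    by (rule sat_subst1_constant[OF assms(1) N]) (simp add: N_def fun_int_reinterpret)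
  then show "sat N X (subst1 \<phi> (Fn c []) x) = sat M (team_upd X x a) \<phi>"
    using assms(5) by (simp add: N_def sat_reinterpret)
qed

text \<open>The reinterpretation behind both witness rules: the fresh constant symbols denote the values of
  \<open>xs\<close> at one member \<open>s0\<close> of the team, the one at which an inclusion or an atom fails.\<close>

lemma sat_fresh_consts:
  fixes M :: "('f, 'r, 'm) struct" and xs :: "'v list"
  assumes inf: "infinite (UNIV :: 'v set)" and "M \<in> structures" "total M X" "s0 \<in> X"
    and cs: "distinct cs" "length cs = length xs"
  obtains N where "N \<in> structures" "total N X"
    "\<forall>(\<phi> :: ('f, 'r, 'v) fm) Y. set cs \<inter> fsyms \<phi> = {} \<longrightarrow> sat N Y \<phi> = sat M Y \<phi>"
    "\<forall>s :: 'v \<Rightarrow> 'm. map (eval N s) (cs_tms cs) = map s0 xs"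
    "\<forall>zs. length zs = length cs \<longrightarrow>
      sat N X (incl (zip (cs_tms cs) (vs_tms zs)) :: ('f, 'r, 'v) fm) = (\<exists>s\<in>X. map s0 xs = map s zs)"
proof
  define k where "k c = s0 (the (map_of (zip cs xs) c))" for c
  let ?N = "reinterpret M (set cs) k"
  show N: "?N \<in> structures" "total ?N X"
    using assms(2-4) by (auto simp: k_def total_def intro!: reinterpret_structure)
  show "\<forall>(\<phi> :: ('f, 'r, 'v) fm) Y. set cs \<inter> fsyms \<phi> = {} \<longrightarrow> sat ?N Y \<phi> = sat M Y \<phi>"
    by (auto simp: sat_reinterpret)
  show k: "\<forall>s :: 'v \<Rightarrow> 'm. map (eval ?N s) (cs_tms cs) = map s0 xs"
    using cs by (auto intro!: nth_equalityI simp: fun_int_reinterpret k_def map_of_zip_nth)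
  show "\<forall>zs. length zs = length cs \<longrightarrow>
      sat ?N X (incl (zip (cs_tms cs) (vs_tms zs)) :: ('f, 'r, 'v) fm) = (\<exists>s\<in>X. map s0 xs = map s zs)"
  proof (intro allI impI)
    fix zs :: "'v list"
    assume l: "length zs = length cs"
    have "\<forall>(t, u)\<in>set (zip (cs_tms cs) (vs_tms zs)). simple t \<and> simple u"
      by (auto simp: simple_def elim!: in_set_zipE)
    from sat_incl[OF inf N(1) this, of X]
    show "sat ?N X (incl (zip (cs_tms cs) (vs_tms zs)) :: ('f, 'r, 'v) fm) = (\<exists>s\<in>X. map s0 xs = map s zs)"
      using l k assms(4) by (auto simp: comp_def)
  qed
qed

text \<open>An inclusion of \<open>xs\<close> in \<open>ys\<close> says that the team of the values of \<open>xs\<close> is a subteam of that of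
  \<open>ys\<close>.  So \<open>IncCompress\<close> is sound for every formula that is inherited by subteams.\<close>

lemma neg_inc_free_downward:
  "neg_inc_free \<phi> \<Longrightarrow> sat M Y \<phi> \<Longrightarrow> X \<subseteq> Y \<Longrightarrow> sat M X \<phi>"
proof (induction \<phi> arbitrary: X Y)
  case (Ex1 x \<phi>)
  then obtain a where "a \<in> carrier M" "sat M (team_upd Y x a) \<phi>" by auto
  moreover have "team_upd X x a \<subseteq> team_upd Y x a" using Ex1.prems by (auto simp: team_upd_def)
  ultimately show ?case using Ex1.IH Ex1.prems(1) by auto
next
  case (All1 x \<phi>)
  have "team_upd X x a \<subseteq> team_upd Y x a" for a using All1.prems by (auto simp: team_upd_def)
  then show ?case using All1.IH All1.prems by (metis neg_inc_free.simps(8) sat.simps(8))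
next
  case (And \<phi> \<psi>)
  show ?case using And.IH[of Y X] And.prems by auto
next
  case (Or1 \<phi> \<psi>)
  show ?case using Or1.IH[of Y X] Or1.prems by auto
qed auto

text \<open>With \<open>R\<close> interpreted as the set of values of \<open>vs\<close>, replacing \<open>R\<close> by inclusion in \<open>vs\<close> does
  not change the truth value, because the quantifiers in whose scope \<open>R\<close> occurs leave \<open>vs\<close> alone.\<close>

lemma sat_rel_to_inc:
  assumes N: "N = M\<lparr>rel_int := (rel_int M)(R := (\<lambda>as. as \<in> A))\<rparr>"
  shows "rel_replaceable R vs \<phi> \<Longrightarrow> (R \<in> rsyms \<phi> \<Longrightarrow> (\<lambda>s. map s vs) ` X = A) \<Longrightarrow>
    sat N X \<phi> = sat M X (rel_to_inc R vs \<phi>)"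
proof (induction \<phi> arbitrary: X)
  case (Eq t u)
  have "eval N s t = eval M s t" for s and t :: "('a, 'd) tm" by (rule eval_cong) (auto simp: N)
  then show ?case by simp
next
  case (Rel S ts)
  have hvar: "eval N s t = eval M s t" for s and t :: "('a, 'd) tm" by (rule eval_cong) (auto simp: N)
  show ?case
  proof (cases "S = R")
    case True
    then have ts: "length ts = length vs" "\<forall>t\<in>set ts. is_Var t" using Rel.prems(1) by auto
    define xs where "xs = map the_Var ts"
    have 1: "map (eval N s) ts = map s xs" for s
      using ts(2) by (auto simp: is_Var_def xs_def)
    have 2: "map fst (zip xs vs) = xs" "map snd (zip xs vs) = vs" using ts(1) by (auto simp: xs_def)
    have 3: "rel_int N R as \<longleftrightarrow> as \<in> (\<lambda>s. map s vs) ` X" for as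
      using True Rel.prems(2) by (simp add: N)
    have "sat N X (Rel R ts) \<longleftrightarrow> (\<forall>s\<in>X. \<exists>s'\<in>X. map s xs = map s' vs)"
      by (simp only: sat.simps 1 3 image_iff)
    then show ?thesis using True by (simp only: rel_to_inc.simps simp_thms if_True sat.simps xs_def[symmetric] 2)
  next
    case False
    then show ?thesis by (simp add: N hvar[unfolded N] cong: map_cong)
  qed
next
  case (Ex1 x \<phi>)
  have "sat N (team_upd X x a) \<phi> = sat M (team_upd X x a) (rel_to_inc R vs \<phi>)" for a
  proof (rule Ex1.IH)
    assume "R \<in> rsyms \<phi>"
    then have "x \<notin> set vs" "(\<lambda>s. map s vs) ` X = A" using Ex1.prems by auto
    then show "(\<lambda>s. map s vs) ` team_upd X x a = A" by (simp add: team_upd_def image_image)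
  qed (use Ex1.prems in auto)
  then show ?case by (simp add: N)
next
  case (All1 x \<phi>)
  have "sat N (team_upd X x a) \<phi> = sat M (team_upd X x a) (rel_to_inc R vs \<phi>)" for a
  proof (rule All1.IH)
    assume "R \<in> rsyms \<phi>"
    then have "x \<notin> set vs" "(\<lambda>s. map s vs) ` X = A" using All1.prems by auto
    then show "(\<lambda>s. map s vs) ` team_upd X x a = A" by (simp add: team_upd_def image_image)
  qed (use All1.prems in auto)
  then show ?case by (simp add: N)
next
  case (Dneg \<phi>)
  have "sat N X \<phi> = sat M X (rel_to_inc R vs \<phi>)" using Dneg.prems by (intro Dneg.IH) auto
  then show ?case by simp
next
  case (And \<phi> \<psi>)
  have "sat N X \<phi> = sat M X (rel_to_inc R vs \<phi>)" using And.prems by (intro And.IH(1)) auto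
  moreover have "sat N X \<psi> = sat M X (rel_to_inc R vs \<psi>)" using And.prems by (intro And.IH(2)) auto
  ultimately show ?case by simp
next
  case (Or1 \<phi> \<psi>)
  have "sat N X \<phi> = sat M X (rel_to_inc R vs \<phi>)" using Or1.prems by (intro Or1.IH(1)) auto
  moreover have "sat N X \<psi> = sat M X (rel_to_inc R vs \<psi>)" using Or1.prems by (intro Or1.IH(2)) auto
  ultimately show ?case by simp
qed auto


text \<open>The constancy atoms say that the values in question do not vary over the team, so the corresponding
  quantifier rules instantiate with that one value.  For fresh symbols the structure is reinterpreted:
  constants as above, and in \<open>RelInc\<close> the relation symbol as the set of values of \<open>vs\<close>.\<close>

lemma soundness:
  fixes \<Gamma> :: "('f, 'r, 'v) fm set" and M :: "('f, 'r, 'm) struct"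
  assumes inf: "infinite (UNIV :: 'v set)"
  shows "\<Gamma> \<turnstile> \<phi> \<Longrightarrow> M \<in> structures \<Longrightarrow> total M X \<Longrightarrow> \<forall>\<psi>\<in>\<Gamma>. sat M X \<psi> \<Longrightarrow> sat M X \<phi>"
proof (induction arbitrary: M X rule: deriv.induct)
  case (Weaken \<Gamma> \<phi> \<Delta>)
  then show ?case by blast
next
  case (EqE \<Gamma> t u \<phi> x)
  have "eval M s t = eval M s u" if "s \<in> X" for s
    using EqE.IH(1)[OF EqE.prems] that by simp
  then have "(\<lambda>s. s(x := eval M s t)) ` X = (\<lambda>s. s(x := eval M s u)) ` X"
    by (intro image_cong) auto
  then show ?case
    using EqE.IH(2)[OF EqE.prems] EqE.hyps EqE.prems by (simp add: sat_subst1[OF inf])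
next
  case (OrE \<Gamma> \<phi> \<psi> \<chi>)
  then show ?case by (metis insert_iff sat.simps(6))
next
  case (ExI \<Gamma> \<phi> t x)
  obtain a where a: "a \<in> carrier M" "\<forall>s\<in>X. eval M s t = a"
    using ExI.IH(2)[OF ExI.prems] sat_cst[OF inf ExI.prems(1,2)] by auto
  then have "sat M (team_upd X x a) \<phi>"
    using ExI.IH(1)[OF ExI.prems] sat_subst1_constant[OF inf ExI.prems(1,2) ExI.hyps(2)] by blast
  then show ?case using a by auto
next
  case (ExE_var \<Gamma> x \<phi> v \<psi>)
  obtain a where a: "a \<in> carrier M" "sat M (team_upd X x a) \<phi>"
    using ExE_var.IH(1)[OF ExE_var.prems] by auto
  have v: "v \<notin> fv \<phi>" "v \<notin> fv \<psi>" "\<And>\<chi>. \<chi> \<in> \<Gamma> \<Longrightarrow> v \<notin> fv \<chi>"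
    using ExE_var.hyps(4) by (auto simp: fvs_def)
  have "sat M (team_upd X v a) \<psi>"
    using ExE_var.IH(2)[OF ExE_var.prems(1) total_upd[OF ExE_var.prems(2) a(1)]]
      sat_fresh_var[OF inf ExE_var.prems(1,2) a(1) v(1) ExE_var.hyps(3)] a(2) ExE_var.prems(3) v(3)
    by (simp add: sat_upd_fresh)
  then show ?case using v(2) by (simp add: sat_upd_fresh)
next
  case (ExE_const \<Gamma> x \<phi> c \<psi>)
  obtain a where a: "a \<in> carrier M" "sat M (team_upd X x a) \<phi>"
    using ExE_const.IH(1)[OF ExE_const.prems] by auto
  have c: "c \<notin> fsyms \<phi>" "c \<notin> fsyms \<psi>" "\<And>\<chi>. \<chi> \<in> \<Gamma> \<Longrightarrow> c \<notin> fsyms \<chi>"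
    using ExE_const.hyps(3) by (auto simp: all_fsyms_def)
  note N = sat_fresh_const[OF inf ExE_const.prems(1,2) a(1) c(1)]
  have "sat (reinterpret M {c} (\<lambda>_. a)) X \<psi>"
    using ExE_const.IH(2)[OF N(1,2)] N(3) a(2) ExE_const.prems(3) c(3) by (simp add: sat_reinterpret)
  then show ?case using c(2) by (simp add: sat_reinterpret)
next
  case (AllI_var v \<Gamma> \<phi> x)
  have v: "v \<notin> fv \<phi>" "\<And>\<chi>. \<chi> \<in> \<Gamma> \<Longrightarrow> v \<notin> fv \<chi>"
    using AllI_var.hyps(3) by (auto simp: fvs_def)
  have "sat M (team_upd X x a) \<phi>" if a: "a \<in> carrier M" for a
    using AllI_var.IH[OF AllI_var.prems(1) total_upd[OF AllI_var.prems(2) a]]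
      sat_fresh_var[OF inf AllI_var.prems(1,2) a v(1) AllI_var.hyps(2)] AllI_var.prems(3) v(2)
    by (simp add: sat_upd_fresh)
  then show ?case by simp
next
  case (AllI_const \<Gamma> \<phi> c x)
  have c: "c \<notin> fsyms \<phi>" "\<And>\<chi>. \<chi> \<in> \<Gamma> \<Longrightarrow> c \<notin> fsyms \<chi>"
    using AllI_const.hyps(2) by (auto simp: all_fsyms_def)
  have "sat M (team_upd X x a) \<phi>" if a: "a \<in> carrier M" for a
    using AllI_const.IH[OF sat_fresh_const(1,2)[OF inf AllI_const.prems(1,2) a c(1)]]
      sat_fresh_const(3)[OF inf AllI_const.prems(1,2) a c(1)] AllI_const.prems(3) c(2)
    by (simp add: sat_reinterpret)
  then show ?case by simp
next
  case (AllE \<Gamma> x \<phi> t)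
  obtain a where a: "a \<in> carrier M" "\<forall>s\<in>X. eval M s t = a"
    using AllE.IH(2)[OF AllE.prems] sat_cst[OF inf AllE.prems(1,2)] by auto
  then have "sat M (team_upd X x a) \<phi>" using AllE.IH(1)[OF AllE.prems] by simp
  then show ?case using a sat_subst1_constant[OF inf AllE.prems(1,2) AllE.hyps(3)] by blast
next
  case (NegI \<phi> \<Gamma>)
  then show ?case using sat_bot by (metis insert_iff sat.simps(4))
next
  case (NegE \<Gamma> \<phi> \<psi>)
  then show ?case using sat_empty by (metis sat.simps(4))
next
  case (RAA \<phi> \<Gamma>)
  then show ?case using sat_bot sat_empty by (metis insert_iff sat.simps(4))
next
  case (CstConst \<Gamma> cs)
  then have "fun_int M c [] \<in> carrier M" for c by (simp add: structures_def)
  then show ?case unfolding sat_cst[OF inf CstConst.prems(1,2)] by auto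
next
  case (CstFun \<Gamma> ts f)
  obtain g where g: "\<And>t. t \<in> set ts \<Longrightarrow> g t \<in> carrier M \<and> (\<forall>s\<in>X. eval M s t = g t)"
    using CstFun.IH[OF CstFun.prems] unfolding sat_cst[OF inf CstFun.prems(1,2)] by metis
  then have "eval M s (Fn f ts) = fun_int M f (map g ts)" if "s \<in> X" for s
    using that by (simp cong: map_cong)
  moreover have "set (map g ts) \<subseteq> carrier M" using g by auto
  then have "fun_int M f (map g ts) \<in> carrier M"
    using CstFun.prems(1) unfolding structures_def by blast
  ultimately show ?case unfolding sat_cst[OF inf CstFun.prems(1,2)] by auto
next
  case (IncTrans \<Gamma> xs ys zs)
  then show ?case by simp (metis (no_types, lifting))
next
  case (IncProj \<Gamma> ps ns)
  have "\<exists>s'\<in>X. map s (map fst (map ((!) ps) ns)) = map s' (map snd (map ((!) ps) ns))"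
    if s: "s \<in> X" for s
  proof -
    obtain s' where s': "s' \<in> X" "map s (map fst ps) = map s' (map snd ps)"
      using IncProj.IH[OF IncProj.prems] s unfolding sat.simps by blast
    have "s (fst (ps ! i)) = s' (snd (ps ! i))" if "i < length ps" for i
      using arg_cong[OF s'(2), of "\<lambda>l. l ! i"] that by simp
    then show ?thesis using s'(1) IncProj.hyps(2) by (intro bexI[of _ s']) auto
  qed
  then show ?case by (simp del: map_map)
next
  case (IncCompress \<Gamma> xs ys zs \<alpha>)
  note M = IncCompress.prems(1) and X = IncCompress.prems(2)
  define T where "T us = (\<lambda>s x. eval M s (simul zs (vs_tms us) x)) ` X" for us
  have T: "sat M X (subst (simul zs (vs_tms us)) \<alpha>) =
      sat M ((\<lambda>s x. if x \<in> set zs then s x else undefined) ` T us) \<alpha>"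
    if "substitutable (simul zs (vs_tms us)) \<alpha>" for us
  proof -
    have "sat M ((\<lambda>s x. if x \<in> set zs then s x else undefined) ` T us) \<alpha> = sat M ((\<lambda>s. s) ` T us) \<alpha>"
      using IncCompress.hyps by (intro sat_agree) auto
    then show ?thesis by (simp add: sat_subst_total[OF inf M X that] T_def)
  qed
  have at: "eval M s (simul zs (vs_tms us) (zs ! i)) = s (us ! i)"
    if "length us = length zs" "i < length zs" for us s i
    using that IncCompress.hyps by (simp add: simul_def map_of_zip_nth)
  have "(\<lambda>s x. if x \<in> set zs then s x else undefined) ` T xs \<subseteq>
      (\<lambda>s x. if x \<in> set zs then s x else undefined) ` T ys"
  proof
    fix r
    assume "r \<in> (\<lambda>s x. if x \<in> set zs then s x else undefined) ` T xs"
    then obtain s where s: "s \<in> X"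
      "r = (\<lambda>x. if x \<in> set zs then eval M s (simul zs (vs_tms xs) x) else undefined)"
      by (auto simp: T_def)
    obtain s' where s': "s' \<in> X" "map s xs = map s' ys"
      using IncCompress.IH(1)[OF IncCompress.prems] s(1) IncCompress.hyps by auto
    have "eval M s (simul zs (vs_tms xs) x) = eval M s' (simul zs (vs_tms ys) x)" if "x \<in> set zs" for x
    proof -
      obtain i where i: "i < length zs" "x = zs ! i" using \<open>x \<in> set zs\<close> by (auto simp: in_set_conv_nth)
      then show ?thesis
        using at IncCompress.hyps arg_cong[OF s'(2), of "\<lambda>l. l ! i"] by simp
    qed
    then have "r = (\<lambda>x. if x \<in> set zs then eval M s' (simul zs (vs_tms ys) x) else undefined)"
      using s(2) by auto
    then show "r \<in> (\<lambda>s x. if x \<in> set zs then s x else undefined) ` T ys"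
      using s'(1) by (auto simp: T_def)
  qed
  then show ?case
    using IncCompress.IH(2)[OF IncCompress.prems] IncCompress.hyps
    by (simp add: T) (blast intro: neg_inc_free_downward)
next
  case (IncCst \<Gamma> xs ps)
  have 1: "\<forall>x\<in>set xs. \<exists>a\<in>carrier M. \<forall>s\<in>X. s x = a"
    using IncCst.IH(1)[OF IncCst.prems] by (simp add: sat_cst[OF inf IncCst.prems(1,2)])
  have eq: "map s xs = map s' xs" if "s \<in> X" "s' \<in> X" for s s'
    using 1 that by (metis (no_types, lifting) map_eq_conv)
  have "map s (map fst (zip xs xs @ ps)) = map s' (map snd (zip xs xs @ ps)) \<longleftrightarrow>
      map s (map fst ps) = map s' (map snd ps)" if "s \<in> X" "s' \<in> X" for s s'
    using eq[OF that] by (simp add: append_eq_append_conv del: map_map map_eq_conv)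
  then show ?case using IncCst.IH(2)[OF IncCst.prems] unfolding sat.simps by metis
next
  case (IncExt \<Gamma> xs ys zs ws)
  note M = IncExt.prems(1) and X = IncExt.prems(2)
  show ?case
  proof (cases "X = {}")
    case True
    then show ?thesis by (simp add: sat_empty[OF M])
  next
    case False
    then obtain s0 where s0: "s0 \<in> X" by blast
    have 1: "\<forall>x\<in>set xs. \<exists>a\<in>carrier M. \<forall>s\<in>X. s x = a"
      using IncExt.IH(1)[OF IncExt.prems] by (simp add: sat_cst[OF inf M X])
    have xs: "map s xs = map s0 xs" if "s \<in> X" for s
      using 1 that s0 by (metis (no_types, lifting) map_eq_conv)
    obtain s1 where s1: "s1 \<in> X" "map s0 xs = map s1 ys"
      using IncExt.IH(2)[OF IncExt.prems] s0 IncExt.hyps by auto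
    \<comment> \<open>The member \<open>s1\<close> matches the constant value of \<open>xs\<close>; its values at \<open>ws\<close> are the witnesses.\<close>
    define b where "b z = s1 (the (map_of (zip zs ws) z))" for z
    define U where "U s x = (if x \<in> set zs then b x else s x)" for s x
    have bz: "map b zs = map s1 ws"
      using IncExt.hyps by (intro nth_equalityI) (auto simp: b_def map_of_zip_nth)
    have U: "map (U s) zs = map b zs" "map (U s) xs = map s xs" "map (U s) ys = map s ys"
      "map (U s) ws = map s ws" for s
      using IncExt.hyps by (auto simp: U_def)
    have "\<forall>z\<in>set zs. b z \<in> carrier M" using X s1(1) by (auto simp: b_def total_def)
    moreover have "sat M (U ` X) (Inc (zip zs ws @ zip xs ys))"
    proof -
      have "map (U s) (zs @ xs) = map (U s1) (ws @ ys)" if "s \<in> X" for s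
        unfolding map_append U using bz xs[OF that] s1 by simp
      then show ?thesis using s1(1) IncExt.hyps by (auto simp del: map_eq_conv)
    qed
    ultimately show ?thesis unfolding sat_exs U_def[abs_def] by blast
  qed
next
  case (IncWit \<Gamma> xs ys cs \<phi>)
  note M = IncWit.prems(1) and X = IncWit.prems(2)
  show ?case
  proof (cases "X = {}")
    case True
    then show ?thesis by (simp add: sat_empty[OF M])
  next
    case False
    then obtain s0 where s0: "s0 \<in> X" "\<forall>s'\<in>X. map s0 xs \<noteq> map s' ys"
      using IncWit.IH(1)[OF IncWit.prems] IncWit.hyps by auto
    obtain N where N: "N \<in> structures" "total N X"
      and same: "\<forall>(\<psi> :: ('f, 'r, 'v) fm) Y. set cs \<inter> fsyms \<psi> = {} \<longrightarrow> sat N Y \<psi> = sat M Y \<psi>"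
      and "\<forall>s :: 'v \<Rightarrow> 'm. map (eval N s) (cs_tms cs) = map s0 xs"
      and incl: "\<forall>zs. length zs = length cs \<longrightarrow>
        sat N X (incl (zip (cs_tms cs) (vs_tms zs)) :: ('f, 'r, 'v) fm) = (\<exists>s\<in>X. map s0 xs = map s zs)"
      by (rule sat_fresh_consts[OF inf M X s0(1) IncWit.hyps(5,4)])
    have c: "set cs \<inter> fsyms \<phi> = {}" "\<And>\<chi>. \<chi> \<in> \<Gamma> \<Longrightarrow> set cs \<inter> fsyms \<chi> = {}"
      using IncWit.hyps by (auto simp: all_fsyms_def)
    have "sat N X (incl (zip (cs_tms cs) (vs_tms xs)))"
      "\<not> sat N X (incl (zip (cs_tms cs) (vs_tms ys)))"
      using s0 IncWit.hyps(3,4) by (subst incl[rule_format]; auto)+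
    then have "sat N X \<phi>" using IncWit.IH(2)[OF N] IncWit.prems(3) by (simp add: same c)
    then show ?thesis by (simp add: same c)
  qed
next
  case (AtomWit \<Gamma> l cs xs \<phi>)
  note M = AtomWit.prems(1) and X = AtomWit.prems(2)
  show ?case
  proof (cases "X = {}")
    case True
    then show ?thesis by (simp add: sat_empty[OF M])
  next
    case False
    have "\<not> sat M X l" using AtomWit.IH(1)[OF AtomWit.prems] False by simp
    then obtain s0 where s0: "s0 \<in> X" "\<not> sat M {s0} l"
      using \<open>is_atom l\<close> by (cases l) auto
    obtain N where N: "N \<in> structures" "total N X"
      and same: "\<forall>(\<psi> :: ('f, 'r, 'v) fm) Y. set cs \<inter> fsyms \<psi> = {} \<longrightarrow> sat N Y \<psi> = sat M Y \<psi>"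
      and k: "\<forall>s :: 'v \<Rightarrow> 'm. map (eval N s) (cs_tms cs) = map s0 xs"
      and incl: "\<forall>zs. length zs = length cs \<longrightarrow>
        sat N X (incl (zip (cs_tms cs) (vs_tms zs)) :: ('f, 'r, 'v) fm) = (\<exists>s\<in>X. map s0 xs = map s zs)"
      by (rule sat_fresh_consts[OF inf M X s0(1) AtomWit.hyps(7,6)])
    have c: "set cs \<inter> fsyms l = {}" "set cs \<inter> fsyms \<phi> = {}" "\<And>\<chi>. \<chi> \<in> \<Gamma> \<Longrightarrow> set cs \<inter> fsyms \<chi> = {}"
      using AtomWit.hyps by (auto simp: all_fsyms_def)
    have "sat N X (incl (zip (cs_tms cs) (vs_tms xs)))" using AtomWit.hyps(6) s0(1) by (subst incl[rule_format]) auto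
    moreover have "\<not> sat N X (subst (simul xs (cs_tms cs)) l)"
    proof -
      have "substitutable (simul xs (cs_tms cs)) l" using \<open>is_atom l\<close> by (cases l) auto
      from sat_subst_total[OF inf N this]
      have "sat N X (subst (simul xs (cs_tms cs)) l) =
          sat N ((\<lambda>s x. eval N s (simul xs (cs_tms cs) x)) ` X) l" .
      also have "\<dots> = sat N ((\<lambda>_. s0) ` X) l"
      proof (rule sat_agree)
        fix s x
        assume "x \<in> fv l"
        then obtain i where i: "i < length xs" "x = xs ! i"
          using \<open>fv l \<subseteq> set xs\<close> by (metis in_set_conv_nth subsetD)
        then have "simul xs (cs_tms cs) x = cs_tms cs ! i"
          using AtomWit.hyps by (simp add: simul_def map_of_zip_nth)
        then show "eval N s (simul xs (cs_tms cs) x) = s0 x"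
          using arg_cong[OF k[rule_format, of s], of "\<lambda>l. l ! i"] i AtomWit.hyps by simp
      qed
      also have "(\<lambda>_. s0) ` X = {s0}" using s0(1) by auto
      finally show ?thesis using s0(2) c by (simp add: same)
    qed
    ultimately have "sat N X \<phi>"
      using AtomWit.IH(2)[OF N] AtomWit.prems(3) by (simp add: same c)
    then show ?thesis by (simp add: same c)
  qed
next
  case (RelInc zs R \<phi> \<Gamma> vs)
  note M = RelInc.prems(1) and X = RelInc.prems(2)
  \<comment> \<open>\<open>R\<close> becomes the set of values of \<open>vs\<close> in the team, which is nonempty if the team is.\<close>
  define N where "N = M\<lparr>rel_int := (rel_int M)(R := (\<lambda>as. as \<in> (\<lambda>s. map s vs) ` X))\<rparr>"
  have N: "N \<in> structures" "total N X"
    using M X by (auto simp: N_def structures_def total_def)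
  have "X = {}"
  proof (rule ccontr)
    assume "X \<noteq> {}"
    then obtain s0 where s0: "s0 \<in> X" by blast
    have "sat N X (exs zs (Rel R (vs_tms zs)))"
    proof -
      define b where "b z = s0 (the (map_of (zip zs vs) z))" for z
      have "map b zs = map s0 vs"
        using RelInc.hyps by (intro nth_equalityI) (auto simp: b_def map_of_zip_nth)
      moreover have "\<forall>z\<in>set zs. b z \<in> carrier N"
        using X s0 by (auto simp: N_def b_def total_def)
      moreover have "map (\<lambda>x. if x \<in> set zs then b x else s x) zs = map b zs" for s by simp
      ultimately show ?thesis
        unfolding sat_exs using s0
        by (intro exI[of _ b]) (auto simp: N_def comp_def simp del: map_eq_conv)
    qed
    moreover have "sat N X \<phi>"
      using sat_rel_to_inc[OF N_def RelInc.hyps(5)] RelInc.prems(3) by simp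
    moreover have "sat N X \<psi>" if "\<psi> \<in> \<Gamma>" for \<psi>
    proof -
      have "sat M ((\<lambda>s. s) ` X) \<psi> = sat N ((\<lambda>s. s) ` X) \<psi>"
        using RelInc.hyps(3) that by (intro sat_cong) (auto simp: N_def all_rsyms_def)
      then show ?thesis using RelInc.prems(3) that by simp
    qed
    ultimately have "sat N X bot_fm" using RelInc.IH[OF N] by simp
    with sat_bot[OF N(1), of X] have "X = {}" by (rule iffD1)
    with \<open>X \<noteq> {}\<close> show False by (rule notE)
  qed
  then show ?case using sat_empty[OF M] by simp
next
  case (IncRefl \<Gamma> xs)
  then show ?case by auto
qed auto

text \<open>Assignments on \<open>V\<close> become total with a fixed element as value outside \<open>V\<close>.\<close>

lemma soundness_entails:
  fixes \<Gamma> :: "('f, 'r, 'v) fm set"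
  assumes inf: "infinite (UNIV :: 'v set)" and "\<Gamma> \<turnstile> \<phi>"
  shows "entails (structures :: ('f, 'r, 'm) struct set) \<Gamma> \<phi>"
  unfolding entails_def
proof (intro ballI allI impI)
  fix M :: "('f, 'r, 'm) struct" and V and X :: "('v \<Rightarrow> 'm) set"
  assume M: "M \<in> structures" and X: "team M V X" and V: "fvs (insert \<phi> \<Gamma>) \<subseteq> V"
    and sat: "\<forall>\<psi>\<in>\<Gamma>. sat M X \<psi>"
  obtain a where a: "a \<in> carrier M" using structure_nonempty[OF M] by blast
  define Y where "Y = (\<lambda>s x. if x \<in> V then s x else a) ` X"
  have Y: "total M Y" using X a by (auto simp: Y_def total_def team_def PiE_iff subset_iff)
  have "sat M X \<psi> = sat M Y \<psi>" if "\<psi> \<in> insert \<phi> \<Gamma>" for \<psi>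
  proof -
    have "fv \<psi> \<subseteq> V" using V that by (auto simp: fvs_def)
    then have "sat M ((\<lambda>s. s) ` X) \<psi> = sat M Y \<psi>"
      unfolding Y_def by (intro sat_agree) auto
    then show ?thesis by simp
  qed
  then show "sat M X \<phi>" using soundness[OF inf assms(2) M Y] sat by simp
qed

section \<open>Derived rules\<close>

declare subst.simps(3) [simp del]

text \<open>Disjunction elimination for two equal disjuncts.\<close>

lemma cut: "\<Gamma> \<turnstile> \<phi> \<Longrightarrow> insert \<phi> \<Gamma> \<turnstile> \<psi> \<Longrightarrow> \<Gamma> \<turnstile> \<psi>"
  using OrE[OF OrI1[of \<Gamma> \<phi> \<phi>], of \<psi>] by blast

lemma weaken_insert: "\<Gamma> \<turnstile> \<phi> \<Longrightarrow> insert \<psi> \<Gamma> \<turnstile> \<phi>"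
  by (rule Weaken) auto

text \<open>Cut for a finite set of assumptions.  Working in finite contexts and weakening at the end keeps
  fresh variables and fresh constant symbols available.\<close>

lemma cut_set:
  assumes "finite A" "A \<turnstile> \<psi>" "\<And>\<alpha>. \<alpha> \<in> A \<Longrightarrow> \<Gamma> \<turnstile> \<alpha>"
  shows "\<Gamma> \<turnstile> \<psi>"
proof -
  have "A \<union> \<Gamma> \<turnstile> \<psi> \<Longrightarrow> \<Gamma> \<turnstile> \<psi>" using assms(1,3)
  proof (induction A)
    case (insert \<alpha> A)
    have "A \<union> \<Gamma> \<turnstile> \<alpha>" using insert.prems(2) by (auto intro: Weaken[of \<Gamma>])
    then have "A \<union> \<Gamma> \<turnstile> \<psi>" using cut insert.prems(1) by simp
    then show ?case using insert.IH insert.prems(2) by auto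
  qed simp
  then show ?thesis using assms(2) by (auto intro: Weaken)
qed

lemma cut1: "\<Gamma> \<turnstile> \<alpha> \<Longrightarrow> {\<alpha>} \<turnstile> \<psi> \<Longrightarrow> \<Gamma> \<turnstile> \<psi>"
  by (rule cut_set[of "{\<alpha>}"]) auto

text \<open>The law of excluded middle, from \<open>RAA\<close>.\<close>

lemma case_split:
  assumes "insert \<phi> \<Gamma> \<turnstile> \<psi>" "insert (Dneg \<phi>) \<Gamma> \<turnstile> \<psi>"
  shows "\<Gamma> \<turnstile> \<psi>"
proof (rule RAA)
  let ?D = "insert (Dneg \<psi>) \<Gamma>"
  have n: "insert \<chi> ?D \<turnstile> Dneg \<psi>" for \<chi> by (rule Assm) simp
  have "insert \<phi> ?D \<turnstile> \<psi>" using assms(1) by (rule Weaken) auto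
  then have "?D \<turnstile> Dneg \<phi>" using n by (intro NegI) (rule NegE)
  moreover have "insert (Dneg \<phi>) ?D \<turnstile> bot_fm"
  proof (rule NegE)
    show "insert (Dneg \<phi>) ?D \<turnstile> \<psi>" using assms(2) by (rule Weaken) auto
  qed (rule n)
  ultimately show "?D \<turnstile> bot_fm" by (rule cut)
qed

lemma Dneg_conjs_Nil: "\<Gamma> \<turnstile> conjs []"
  by (simp, rule NegI, rule Assm) simp

lemma conjs_intro: "(\<And>\<phi>. \<phi> \<in> set \<phi>s \<Longrightarrow> \<Gamma> \<turnstile> \<phi>) \<Longrightarrow> \<Gamma> \<turnstile> conjs \<phi>s"
  by (induction \<phi>s rule: conjs.induct) (auto intro: AndI NegI Assm)

lemma conjs_elim: "\<Gamma> \<turnstile> conjs \<phi>s \<Longrightarrow> \<phi> \<in> set \<phi>s \<Longrightarrow> \<Gamma> \<turnstile> \<phi>"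
  by (induction \<phi>s rule: conjs.induct) (auto dest: AndE1 AndE2)

lemma subst_tm_idle: "(\<And>x. x \<in> vars_tm t \<Longrightarrow> \<sigma> x = Var x) \<Longrightarrow> subst_tm \<sigma> t = t"
  using subst_tm_cong[of t \<sigma> Var] by simp

lemma subst_tm_fresh: "x \<notin> vars_tm t \<Longrightarrow> subst_tm (Var(x := u)) t = t"
  by (rule subst_tm_idle) auto

text \<open>The formulas below a block of existential quantifiers are quantifier-free, and the
  substitutions put variables into their inclusion atoms.\<close>

primrec qfree :: "('w \<Rightarrow> ('f, 'w) tm) \<Rightarrow> ('f, 'r, 'w) fm \<Rightarrow> bool" where
  "qfree \<sigma> (Eq t u) \<longleftrightarrow> True"
| "qfree \<sigma> (Rel R ts) \<longleftrightarrow> True"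
| "qfree \<sigma> (Inc ps) \<longleftrightarrow> (\<forall>(x, y)\<in>set ps. is_Var (\<sigma> x) \<and> is_Var (\<sigma> y))"
| "qfree \<sigma> (Dneg \<phi>) \<longleftrightarrow> qfree \<sigma> \<phi>"
| "qfree \<sigma> (And \<phi> \<psi>) \<longleftrightarrow> qfree \<sigma> \<phi> \<and> qfree \<sigma> \<psi>"
| "qfree \<sigma> (Or1 \<phi> \<psi>) \<longleftrightarrow> qfree \<sigma> \<phi> \<and> qfree \<sigma> \<psi>"
| "qfree \<sigma> (Ex1 x \<phi>) \<longleftrightarrow> False"
| "qfree \<sigma> (All1 x \<phi>) \<longleftrightarrow> False"

lemma qfree_Inc:
  assumes "\<forall>(x, y)\<in>set ps. is_Var (\<sigma> x) \<and> is_Var (\<sigma> y)"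
  shows "subst \<sigma> (Inc ps) = Inc (map (\<lambda>(x, y). (the_Var (\<sigma> x), the_Var (\<sigma> y))) ps)"
proof -
  have "subst \<sigma> (Inc ps) = subst (ren (\<lambda>x. the_Var (\<sigma> x))) (Inc ps)"
  proof (rule subst_cong)
    fix x
    assume "x \<in> fv (Inc ps)"
    then have "is_Var (\<sigma> x)" using assms by auto
    then show "\<sigma> x = ren (\<lambda>x. the_Var (\<sigma> x)) x" by (simp add: ren_def)
  qed
  then show ?thesis by (simp only: subst_ren_Inc)
qed

lemma qfree_comp: "qfree \<sigma> \<phi> \<Longrightarrow> subst \<tau> (subst \<sigma> \<phi>) = subst (\<lambda>x. subst_tm \<tau> (\<sigma> x)) \<phi>"
proof (induction \<phi>)
  case (Inc ps)
  then have 1: "\<forall>(x, y)\<in>set ps. is_Var (\<sigma> x) \<and> is_Var (\<sigma> y)" by simp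
  have "map (\<lambda>(x, y). (\<tau> x, \<tau> y)) (map (\<lambda>(x, y). (the_Var (\<sigma> x), the_Var (\<sigma> y))) ps)
      = map (\<lambda>(x, y). (subst_tm \<tau> (\<sigma> x), subst_tm \<tau> (\<sigma> y))) ps"
    using 1 by (auto simp: is_Var_def)
  then show ?case unfolding qfree_Inc[OF 1] by (simp only: subst.simps)
qed (auto simp: subst_tm_comp)

lemma qfree_substitutable: "qfree \<sigma> \<phi> \<Longrightarrow> substitutable \<sigma> \<phi>"
  by (induction \<phi>) (auto simp: simple_def is_Var_def)

lemma qfree_mono: "qfree \<sigma> \<phi> \<Longrightarrow> (\<And>x. is_Var (\<sigma> x) \<Longrightarrow> is_Var (\<tau> x)) \<Longrightarrow> qfree \<tau> \<phi>"
  by (induction \<phi>) auto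

lemma qfree_subst:
  "qfree \<sigma> \<phi> \<Longrightarrow> qfree (\<lambda>x. subst_tm \<tau> (\<sigma> x)) \<phi> \<Longrightarrow> qfree \<tau> (subst \<sigma> \<phi>)"
proof (induction \<phi>)
  case (Inc ps)
  then have 1: "\<forall>(x, y)\<in>set ps. is_Var (\<sigma> x) \<and> is_Var (\<sigma> y)" by simp
  show ?case unfolding qfree_Inc[OF 1] using Inc.prems(2) 1 by (fastforce simp: is_Var_def)
qed auto

lemma exs_Cons [simp]: "exs (z # zs) \<phi> = Ex1 z (exs zs \<phi>)"
  by (simp add: exs_def)

lemma exs_Nil [simp]: "exs [] \<phi> = \<phi>"
  by (simp add: exs_def)

lemma subst_exs:
  "(\<And>z. z \<in> set zs \<Longrightarrow> \<sigma> z = Var z) \<Longrightarrow> subst \<sigma> (exs zs \<phi>) = exs zs (subst \<sigma> \<phi>)"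
  by (induction zs) (auto simp: fun_upd_idem)

lemma substitutable_exs:
  "(\<And>z. z \<in> set zs \<Longrightarrow> \<sigma> z = Var z) \<Longrightarrow> (\<And>x z. x \<notin> set zs \<Longrightarrow> z \<in> set zs \<Longrightarrow> z \<notin> vars_tm (\<sigma> x)) \<Longrightarrow>
    substitutable \<sigma> \<phi> \<Longrightarrow> substitutable \<sigma> (exs zs \<phi>)"
proof (induction zs)
  case (Cons z zs)
  have "substitutable \<sigma> (exs zs \<phi>)"
  proof (rule Cons.IH)
    fix x y
    assume "x \<notin> set zs" "y \<in> set zs"
    then show "y \<notin> vars_tm (\<sigma> x)"
      using Cons.prems(1)[of x] Cons.prems(2)[of x y] by (cases "x = z") auto
  qed (use Cons.prems in auto)
  moreover have "z \<notin> vars_tm (\<sigma> y)" if "y \<noteq> z" for y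
    using Cons.prems(1)[of y] Cons.prems(2)[of y z] that by (cases "y \<in> set zs") auto
  ultimately show ?case using Cons.prems(1)[of z] by (auto simp: fun_upd_idem)
qed simp

lemma qfree_conjs: "(\<And>\<phi>. \<phi> \<in> set \<phi>s \<Longrightarrow> qfree \<sigma> \<phi>) \<Longrightarrow> \<phi>s \<noteq> [] \<Longrightarrow> qfree \<sigma> (conjs \<phi>s)"
  by (induction \<phi>s rule: conjs.induct) auto

lemma subst_conjs: "\<phi>s \<noteq> [] \<Longrightarrow> subst \<sigma> (conjs \<phi>s) = conjs (map (subst \<sigma>) \<phi>s)"
  by (induction \<phi>s rule: conjs.induct) auto

lemma subst_eqs:
  "length xs = length ts \<Longrightarrow> map (subst \<sigma>) (eqs xs ts) = map2 (\<lambda>x t. Eq (\<sigma> x) (subst_tm \<sigma> t)) xs ts"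
  by (auto simp: eqs_def)

definition replace :: "'w list \<Rightarrow> 'w list \<Rightarrow> 'w \<Rightarrow> 'w" where
  "replace us ws x = (case map_of (zip us ws) x of None \<Rightarrow> x | Some w \<Rightarrow> w)"

lemma replace_other [simp]: "x \<notin> set us \<Longrightarrow> replace us ws x = x"
  by (auto simp: replace_def split: option.split dest: map_of_SomeD set_zip_leftD)

lemma replace_nth:
  "distinct us \<Longrightarrow> length ws = length us \<Longrightarrow> i < length us \<Longrightarrow> replace us ws (us ! i) = ws ! i"
  by (simp add: replace_def map_of_zip_nth)

lemma map_replace [simp]: "distinct us \<Longrightarrow> length ws = length us \<Longrightarrow> map (replace us ws) us = ws"
  by (rule nth_equalityI) (simp_all add: replace_nth)

lemma map_replace_other [simp]: "set us \<inter> set xs = {} \<Longrightarrow> map (replace us ws) xs = xs"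
  by (intro map_idI replace_other) auto

lemma ren_replace:
  fixes us ws :: "'w list"
  shows "simul us (vs_tms ws) = (ren (replace us ws) :: 'w \<Rightarrow> ('f, 'w) tm)"
proof
  fix x
  have "map_of (zip us (vs_tms ws :: ('f, 'w) tm list)) x = map_option Var (map_of (zip us ws) x)"
    by (simp add: zip_map2 map_of_map comp_def)
  then show "simul us (vs_tms ws) x = (ren (replace us ws) x :: ('f, 'w) tm)"
    by (cases "map_of (zip us ws) x") (simp_all add: simul_def ren_def replace_def)
qed

lemma subst_Inc_zip: "subst (ren \<theta>) (Inc (zip xs ys)) = Inc (zip (map \<theta> xs) (map \<theta> ys))"
  unfolding subst_ren_Inc by (simp add: zip_map_map)

lemma qfree_incl: "qfree Var (conjs (eqs us ts @ [Inc ps]))"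
  by (rule qfree_conjs) (auto simp: eqs_def)

lemma subst_incl_body:
  assumes "distinct us" "length us = length ds" "length xs = length ds" "set us \<inter> set xs = {}"
  shows "subst (ren \<theta>) (conjs (eqs us (cs_tms ds) @ [Inc (zip us xs)])) =
    (conjs (eqs (map \<theta> us) (cs_tms ds) @ [Inc (zip (map \<theta> us) (map \<theta> xs))]) :: ('g, 'r, 'w) fm)"
proof -
  have "map (subst (ren \<theta>)) (eqs us (cs_tms ds)) = (eqs (map \<theta> us) (cs_tms ds) :: ('g, 'r, 'w) fm list)"
    using assms(2) by (auto simp: eqs_def ren_def zip_map1 elim!: in_set_zipE)
  then show ?thesis by (simp add: subst_conjs subst_Inc_zip del: subst_ren_Inc)
qed

context
  assumes infinite_vars: "infinite (UNIV :: 'v set)"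
begin

lemma Eq_subst:
  fixes t u :: "('f, 'v) tm" and \<phi> :: "('f, 'r, 'v) fm"
  assumes "\<Gamma> \<turnstile> Eq t u" "\<Gamma> \<turnstile> subst1 \<phi> t x" "is_atom \<phi>"
  shows "\<Gamma> \<turnstile> subst1 \<phi> u x"
  using assms(1,2) by (rule EqE) (use assms(3) in \<open>cases \<phi>; simp add: free_for_def\<close>)+

lemma Eq_sym:
  fixes t u :: "('f, 'v) tm" and \<Gamma> :: "('f, 'r, 'v) fm set"
  assumes "\<Gamma> \<turnstile> Eq t u"
  shows "\<Gamma> \<turnstile> Eq u t"
proof -
  obtain z where z: "z \<notin> vars_tm t" using ex_fresh[OF infinite_vars, of "vars_tm t"] by auto
  have "\<Gamma> \<turnstile> subst1 (Eq (Var z) t) t z" by (simp add: subst1_def subst_tm_fresh[OF z] EqI)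
  from Eq_subst[OF assms this] show ?thesis by (simp add: subst1_def subst_tm_fresh[OF z])
qed

lemma Eq_trans:
  fixes t u w :: "('f, 'v) tm" and \<Gamma> :: "('f, 'r, 'v) fm set"
  assumes "\<Gamma> \<turnstile> Eq t u" "\<Gamma> \<turnstile> Eq u w"
  shows "\<Gamma> \<turnstile> Eq t w"
proof -
  obtain z where z: "z \<notin> vars_tm t" using ex_fresh[OF infinite_vars, of "vars_tm t"] by auto
  have "\<Gamma> \<turnstile> subst1 (Eq t (Var z)) u z" by (simp add: subst1_def subst_tm_fresh[OF z] assms(1))
  from Eq_subst[OF assms(2) this] show ?thesis by (simp add: subst1_def subst_tm_fresh[OF z])
qed

text \<open>\<open>EqE\<close> replaces one argument at a time; a fresh variable marks its position.\<close>

lemma Rel_cong_aux: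
  fixes ts us as :: "('f, 'v) tm list" and \<Gamma> :: "('f, 'r, 'v) fm set"
  shows "list_all2 (\<lambda>t u. \<Gamma> \<turnstile> Eq t u) ts us \<Longrightarrow> \<Gamma> \<turnstile> Rel R (as @ ts) \<Longrightarrow> \<Gamma> \<turnstile> Rel R (as @ us)"
proof (induction ts us arbitrary: as rule: list_all2_induct)
  case (Cons t ts u us)
  obtain z where z: "z \<notin> (\<Union>t\<in>set (as @ ts). vars_tm t)"
    using ex_fresh[OF infinite_vars, of "\<Union>t\<in>set (as @ ts). vars_tm t"] by auto
  then have id: "map (subst_tm (Var(z := w))) as = as" "map (subst_tm (Var(z := w))) ts = ts" for w
    by (auto intro!: map_idI subst_tm_fresh)
  have "\<Gamma> \<turnstile> subst1 (Rel R (as @ Var z # ts)) t z" using Cons.prems by (simp add: subst1_def id)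
  from Eq_subst[OF Cons.hyps(1) this] have "\<Gamma> \<turnstile> Rel R ((as @ [u]) @ ts)"
    by (simp add: subst1_def id)
  then have "\<Gamma> \<turnstile> Rel R ((as @ [u]) @ us)" by (rule Cons.IH)
  then show ?case by simp
qed simp

lemma Rel_cong:
  fixes ts us :: "('f, 'v) tm list" and \<Gamma> :: "('f, 'r, 'v) fm set"
  shows "list_all2 (\<lambda>t u. \<Gamma> \<turnstile> Eq t u) ts us \<Longrightarrow> \<Gamma> \<turnstile> Rel R ts \<Longrightarrow> \<Gamma> \<turnstile> Rel R us"
  using Rel_cong_aux[of \<Gamma> ts us R "[]"] by simp

lemma Fn_cong_aux:
  fixes ts us as :: "('f, 'v) tm list" and \<Gamma> :: "('f, 'r, 'v) fm set"
  shows "list_all2 (\<lambda>t u. \<Gamma> \<turnstile> Eq t u) ts us \<Longrightarrow>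
    \<Gamma> \<turnstile> Eq w (Fn f (as @ ts)) \<Longrightarrow> \<Gamma> \<turnstile> Eq w (Fn f (as @ us))"
proof (induction ts us arbitrary: as rule: list_all2_induct)
  case (Cons t ts u us)
  obtain z where z: "z \<notin> (\<Union>t\<in>set (w # as @ ts). vars_tm t)"
    using ex_fresh[OF infinite_vars, of "\<Union>t\<in>set (w # as @ ts). vars_tm t"] by auto
  then have id: "map (subst_tm (Var(z := v))) as = as" "map (subst_tm (Var(z := v))) ts = ts"
    "subst_tm (Var(z := v)) w = w" for v
    by (auto intro!: map_idI subst_tm_fresh)
  have "\<Gamma> \<turnstile> subst1 (Eq w (Fn f (as @ Var z # ts))) t z" using Cons.prems by (simp add: subst1_def id)
  from Eq_subst[OF Cons.hyps(1) this] have "\<Gamma> \<turnstile> Eq w (Fn f ((as @ [u]) @ ts))"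
    by (simp add: subst1_def id)
  then have "\<Gamma> \<turnstile> Eq w (Fn f ((as @ [u]) @ us))" by (rule Cons.IH)
  then show ?case by simp
qed simp

lemma Fn_cong:
  fixes ts us :: "('f, 'v) tm list" and \<Gamma> :: "('f, 'r, 'v) fm set"
  shows "list_all2 (\<lambda>t u. \<Gamma> \<turnstile> Eq t u) ts us \<Longrightarrow> \<Gamma> \<turnstile> Eq (Fn f ts) (Fn f us)"
  using Fn_cong_aux[of \<Gamma> ts us "Fn f ts" f "[]"] by (simp add: EqI)

lemma subst_tm_Eq:
  fixes t :: "('f, 'v) tm" and \<Gamma> :: "('f, 'r, 'v) fm set"
  shows "(\<And>x. x \<in> vars_tm t \<Longrightarrow> \<Gamma> \<turnstile> Eq (\<sigma> x) (\<tau> x)) \<Longrightarrow> \<Gamma> \<turnstile> Eq (subst_tm \<sigma> t) (subst_tm \<tau> t)"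
proof (induction t)
  case (Fn f ts)
  have "\<Gamma> \<turnstile> Eq (subst_tm \<sigma> t) (subst_tm \<tau> t)" if "t \<in> set ts" for t
    by (rule Fn.IH[OF that]) (rule Fn.prems, use that in auto)
  then have "list_all2 (\<lambda>t u. \<Gamma> \<turnstile> Eq t u) (map (subst_tm \<sigma>) ts) (map (subst_tm \<tau>) ts)"
    by (simp add: list_all2_conv_all_nth)
  then show ?case using Fn_cong by simp
qed simp

lemma subst_atom_Eq:
  fixes l :: "('f, 'r, 'v) fm" and \<Gamma> :: "('f, 'r, 'v) fm set"
  assumes "is_atom l" "\<And>x. x \<in> fv l \<Longrightarrow> \<Gamma> \<turnstile> Eq (\<sigma> x) (\<tau> x)" "\<Gamma> \<turnstile> subst \<sigma> l"
  shows "\<Gamma> \<turnstile> subst \<tau> l"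
proof (cases l)
  case (Eq t u)
  have "\<Gamma> \<turnstile> Eq (subst_tm \<sigma> t) (subst_tm \<tau> t)" "\<Gamma> \<turnstile> Eq (subst_tm \<sigma> u) (subst_tm \<tau> u)"
    using assms(2) Eq by (auto intro!: subst_tm_Eq)
  then show ?thesis using assms(3) Eq by (auto intro: Eq_trans Eq_sym)
next
  case (Rel R ts)
  have "\<Gamma> \<turnstile> Eq (subst_tm \<sigma> t) (subst_tm \<tau> t)" if "t \<in> set ts" for t
    by (rule subst_tm_Eq, rule assms(2)) (use that Rel in auto)
  then have "list_all2 (\<lambda>t u. \<Gamma> \<turnstile> Eq t u) (map (subst_tm \<sigma>) ts) (map (subst_tm \<tau>) ts)"
    by (simp add: list_all2_conv_all_nth)
  then show ?thesis using assms(3) Rel by (auto intro: Rel_cong)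
qed (use assms(1) in auto)

lemma cst_single:
  fixes t :: "('f, 'v) tm"
  obtains z where "z \<notin> vars_tm t" "cst [t] = (Ex1 z (Eq (Var z) t) :: ('f, 'r, 'v) fm)"
proof -
  define xs where "xs = fresh 1 (vars_tm t)"
  have "length xs = 1" "set xs \<inter> vars_tm t = {}"
    using fresh_props[OF infinite_vars, of "vars_tm t" 1] by (auto simp: xs_def)
  then obtain z where "xs = [z]" "z \<notin> vars_tm t" by (auto simp: length_Suc_conv)
  then have "cst [t] = (Ex1 z (Eq (Var z) t) :: ('f, 'r, 'v) fm)"
    by (simp add: cst_def exs_def eqs_def xs_def Let_def)
  then show thesis using that \<open>z \<notin> vars_tm t\<close> by blast
qed

text \<open>A term equal to one with a constant value has a constant value: the latter is the witness.\<close>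

lemma cst_Eq:
  fixes t u :: "('f, 'v) tm" and \<Gamma> :: "('f, 'r, 'v) fm set"
  assumes "\<Gamma> \<turnstile> Eq t u" "\<Gamma> \<turnstile> cst [t]"
  shows "\<Gamma> \<turnstile> cst [u]"
proof -
  obtain z where z: "z \<notin> vars_tm u" "cst [u] = (Ex1 z (Eq (Var z) u) :: ('f, 'r, 'v) fm)"
    by (rule cst_single)
  have "\<Gamma> \<turnstile> subst1 (Eq (Var z) u) t z" using assms(1) z by (simp add: subst1_def subst_tm_fresh)
  then show ?thesis unfolding z(2) using assms(2) by (intro ExI[of _ _ t]) (auto simp: free_for_def)
qed

lemma Ex_eq_intro:
  fixes t :: "('f, 'v) tm" and \<Gamma> :: "('f, 'r, 'v) fm set"
  assumes "\<Gamma> \<turnstile> cst [t]" "z \<notin> vars_tm t"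
  shows "\<Gamma> \<turnstile> Ex1 z (Eq (Var z) t)"
proof -
  have "\<Gamma> \<turnstile> subst1 (Eq (Var z) t) t z" using assms by (simp add: subst1_def subst_tm_fresh EqI)
  then show ?thesis using assms(1) by (intro ExI[of _ _ t]) (auto simp: free_for_def)
qed

lemma Ex_elim:
  fixes \<phi> :: "('f, 'r, 'v) fm"
  assumes "\<Gamma> \<turnstile> Ex1 x \<phi>" "finite \<Gamma>" "finite C"
    and "\<And>v. v \<notin> C \<Longrightarrow> v \<notin> vars \<phi> \<Longrightarrow> v \<notin> fv \<psi> \<Longrightarrow> v \<notin> fvs \<Gamma> \<Longrightarrow>
      insert (subst1 \<phi> (Var v) x) (insert (cst [Var v]) \<Gamma>) \<turnstile> \<psi>"
  shows "\<Gamma> \<turnstile> \<psi>"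
proof -
  obtain v where v: "v \<notin> C \<union> vars \<phi> \<union> fv \<psi> \<union> fvs \<Gamma>"
    using ex_fresh[OF infinite_vars, of "C \<union> vars \<phi> \<union> fv \<psi> \<union> fvs \<Gamma>"] assms(2,3) finite_fvs by auto
  show ?thesis
  proof (rule ExE_var[OF assms(1), of v])
    show "insert (subst1 \<phi> (Var v) x) (insert (cst [Var v]) \<Gamma>) \<turnstile> \<psi>" using v assms(4) by blast
    show "free_for (Var v) x \<phi>" using v by (auto simp: vars_eq intro: free_for_ren)
    show "v \<notin> fvs (insert \<phi> (insert \<psi> \<Gamma>))" using v by (auto simp: fvs_insert vars_eq)
  qed
qed

text \<open>The choice of the bound variable in a constancy atom does not matter.\<close>

lemma cst_of_Ex_eq:
  fixes t :: "('f, 'v) tm"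
  assumes "z \<notin> vars_tm t"
  shows "{Ex1 z (Eq (Var z) t)} \<turnstile> (cst [t] :: ('f, 'r, 'v) fm)"
proof (rule Ex_elim)
  show "{Ex1 z (Eq (Var z) t)} \<turnstile> (Ex1 z (Eq (Var z) t) :: ('f, 'r, 'v) fm)" by (rule Assm) simp
  fix v
  let ?G = "insert (subst1 (Eq (Var z) t) (Var v) z)
    (insert (cst [Var v]) {Ex1 z (Eq (Var z) t)}) :: ('f, 'r, 'v) fm set"
  have "?G \<turnstile> subst1 (Eq (Var z) t) (Var v) z" "?G \<turnstile> cst [Var v]" by (auto intro: Assm)
  then show "?G \<turnstile> cst [t]"
    using assms by (rule_tac cst_Eq[of _ "Var v"]) (simp_all add: subst1_def subst_tm_fresh)
qed (simp_all, rule finite.emptyI)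

lemma Ex_eq_iff:
  fixes t :: "('f, 'v) tm" and \<Gamma> :: "('f, 'r, 'v) fm set"
  shows "z \<notin> vars_tm t \<Longrightarrow> \<Gamma> \<turnstile> Ex1 z (Eq (Var z) t) \<longleftrightarrow> \<Gamma> \<turnstile> cst [t]"
  using cst_of_Ex_eq Ex_eq_intro cut1 by blast

text \<open>The quantifiers are introduced from the outside in.  No value contains a quantified variable, so
  substituting the values one after the other amounts to the simultaneous substitution \<open>\<sigma>\<close>.\<close>

lemma exs_intro:
  fixes \<phi> :: "('f, 'r, 'v) fm"
  assumes "\<Gamma> \<turnstile> subst \<sigma> \<phi>" "qfree \<sigma> \<phi>" "distinct zs" "\<And>x. x \<notin> set zs \<Longrightarrow> \<sigma> x = Var x"
    and "\<And>z. z \<in> set zs \<Longrightarrow> vars_tm (\<sigma> z) \<inter> set zs = {} \<and> \<Gamma> \<turnstile> cst [\<sigma> z]"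
  shows "\<Gamma> \<turnstile> exs zs \<phi>"
  using assms
proof (induction zs arbitrary: \<phi> \<sigma>)
  case Nil
  then have "\<sigma> = Var" by auto
  then show ?case using Nil by simp
next
  case (Cons z zs)
  define t where "t = \<sigma> z"
  define \<tau> where "\<tau> = \<sigma>(z := Var z)"
  have t: "vars_tm t \<inter> set (z # zs) = {}" "\<Gamma> \<turnstile> cst [t]" using Cons.prems(5)[of z] by (auto simp: t_def)
  have \<tau>t: "subst_tm \<tau> t = t"
    using t(1) Cons.prems(4) by (intro subst_tm_idle) (auto simp: \<tau>_def)
  have \<sigma>: "(\<lambda>x. subst_tm \<tau> ((Var(z := t)) x)) = \<sigma>"
    using \<tau>t by (auto simp: \<tau>_def t_def)
  have q: "qfree (Var(z := t)) \<phi>"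
    by (rule qfree_mono[OF Cons.prems(2)]) (auto simp: t_def)
  have "\<Gamma> \<turnstile> exs zs (subst1 \<phi> t z)"
  proof (rule Cons.IH)
    show "\<Gamma> \<turnstile> subst \<tau> (subst1 \<phi> t z)"
      unfolding subst1_def qfree_comp[OF q] \<sigma> by (rule Cons.prems(1))
    show "qfree \<tau> (subst1 \<phi> t z)"
      unfolding subst1_def by (rule qfree_subst[OF q]) (simp only: \<sigma> Cons.prems(2))
    show "distinct zs" using Cons.prems(3) by simp
    show "\<tau> x = Var x" if "x \<notin> set zs" for x using that Cons.prems(4) by (auto simp: \<tau>_def)
    show "vars_tm (\<tau> y) \<inter> set zs = {} \<and> \<Gamma> \<turnstile> cst [\<tau> y]" if "y \<in> set zs" for y
      using that Cons.prems(5)[of y] Cons.prems(3) by (auto simp: \<tau>_def)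
  qed
  moreover have "subst1 (exs zs \<phi>) t z = exs zs (subst1 \<phi> t z)"
    unfolding subst1_def using Cons.prems(3) by (intro subst_exs) auto
  moreover have "free_for t z (exs zs \<phi>)"
    unfolding free_for_def
  proof (rule substitutable_exs)
    show "substitutable (Var(z := t)) \<phi>" by (rule qfree_substitutable[OF q])
  qed (use Cons.prems(3) t(1) in auto)
  ultimately show ?case using t(2) ExI[of \<Gamma> "exs zs \<phi>" t z] by simp
qed

text \<open>The context and \<open>C\<close> are finite, so fresh variables can be taken as witnesses for all the
  quantifiers.\<close>

lemma exs_elim:
  fixes \<phi> \<psi> :: "('f, 'r, 'v) fm"
  assumes "\<Gamma> \<turnstile> exs zs \<phi>" "qfree Var \<phi>" "finite \<Gamma>" "finite C" "distinct zs"
    and "\<And>\<theta>. (\<And>x. x \<notin> set zs \<Longrightarrow> \<theta> x = x) \<Longrightarrow> \<theta> ` set zs \<inter> C = {} \<Longrightarrow>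
      insert (subst (ren \<theta>) \<phi>) ((\<lambda>z. cst [Var (\<theta> z)]) ` set zs \<union> \<Gamma>) \<turnstile> \<psi>"
  shows "\<Gamma> \<turnstile> \<psi>"
  using assms
proof (induction zs arbitrary: \<phi> \<Gamma> C)
  case Nil
  have "insert \<phi> \<Gamma> \<turnstile> \<psi>" using Nil.prems(6)[of "\<lambda>x. x"] by simp
  then show ?case using Nil.prems(1) cut by simp
next
  case (Cons z zs)
  have "\<Gamma> \<turnstile> Ex1 z (exs zs \<phi>)" using Cons.prems(1) by simp
  then show ?case
  proof (rule Ex_elim)
    show "finite \<Gamma>" by fact
    show "finite (C \<union> set (z # zs))" using Cons.prems by simp
    fix v
    assume v: "v \<notin> C \<union> set (z # zs)" "v \<notin> fvs \<Gamma>"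
    have q: "qfree (Var(z := Var v)) \<phi>" by (rule qfree_mono[OF Cons.prems(2)]) auto
    have eq: "subst1 (exs zs \<phi>) (Var v) z = exs zs (subst1 \<phi> (Var v) z)"
      unfolding subst1_def using Cons.prems(5) by (intro subst_exs) auto
    let ?G = "insert (subst1 (exs zs \<phi>) (Var v) z) (insert (cst [Var v]) \<Gamma>)"
    show "?G \<turnstile> \<psi>"
    proof (rule Cons.IH)
      show "?G \<turnstile> exs zs (subst1 \<phi> (Var v) z)" unfolding eq by (rule Assm) simp
      show "qfree Var (subst1 \<phi> (Var v) z)"
        unfolding subst1_def by (rule qfree_subst[OF q]) (use q in \<open>simp del: fun_upd_apply\<close>)
      show "finite ?G" "finite C" "distinct zs" using Cons.prems by auto
      fix \<theta>
      assume \<theta>: "\<And>x. x \<notin> set zs \<Longrightarrow> \<theta> x = x" "\<theta> ` set zs \<inter> C = {}"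
      let ?\<theta> = "\<theta>(z := v)"
      have 1: "subst (ren \<theta>) (subst1 \<phi> (Var v) z) = subst (ren ?\<theta>) \<phi>"
      proof -
        have "subst (ren \<theta>) (subst1 \<phi> (Var v) z) = subst (\<lambda>x. subst_tm (ren \<theta>) ((Var(z := Var v)) x)) \<phi>"
          unfolding subst1_def by (rule qfree_comp[OF q])
        also have "(\<lambda>x. subst_tm (ren \<theta>) ((Var(z := Var v)) x)) = ren ?\<theta>"
          using \<theta>(1)[of v] v by (auto simp: ren_def)
        finally show ?thesis .
      qed
      have 2: "insert (subst (ren ?\<theta>) \<phi>) ((\<lambda>x. cst [Var (?\<theta> x)]) ` set (z # zs) \<union> \<Gamma>) \<turnstile> \<psi>"
        using \<theta> v Cons.prems(5) by (intro Cons.prems(6)) auto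
      have 3: "(\<lambda>x. cst [Var (?\<theta> x)]) ` set (z # zs) =
          insert (cst [Var v]) ((\<lambda>x. cst [Var (\<theta> x)]) ` set zs)"
        using Cons.prems(5) by auto
      show "insert (subst (ren \<theta>) (subst1 \<phi> (Var v) z))
          ((\<lambda>z. cst [Var (\<theta> z)]) ` set zs \<union> ?G) \<turnstile> \<psi>"
        using 2 unfolding 1 3 by (rule Weaken) auto
    qed
  qed
qed

text \<open>Constancy of a list follows from constancy of its entries, which are the witnesses.\<close>

lemma cst_list:
  fixes ts :: "('f, 'v) tm list" and \<Gamma> :: "('f, 'r, 'v) fm set"
  assumes "\<And>t. t \<in> set ts \<Longrightarrow> \<Gamma> \<turnstile> cst [t]"
  shows "\<Gamma> \<turnstile> cst ts"
proof (cases "ts = []")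
  case True
  then show ?thesis using Dneg_conjs_Nil by (simp add: cst_def eqs_def)
next
  case False
  define A where "A = (\<Union>t\<in>set ts. vars_tm t)"
  define xs where "xs = fresh (length ts) A"
  have xs: "length xs = length ts" "distinct xs" "set xs \<inter> A = {}"
    using fresh_props[OF infinite_vars, of A] unfolding xs_def A_def by auto
  define \<sigma> where "\<sigma> x = (if x \<in> set xs then the (map_of (zip xs ts) x) else Var x)" for x
  have \<sigma>: "\<sigma> (xs ! i) = ts ! i" if "i < length ts" for i
    using that xs by (simp add: \<sigma>_def map_of_zip_nth)
  have \<sigma>t: "subst_tm \<sigma> t = t" if "t \<in> set ts" for t
    using that xs(3) by (intro subst_tm_idle) (auto simp: \<sigma>_def A_def)
  have ne: "eqs xs ts \<noteq> []" using False xs(1) by (cases xs; cases ts) (auto simp: eqs_def)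
  have "\<Gamma> \<turnstile> exs xs (conjs (eqs xs ts))"
  proof (rule exs_intro)
    show "\<Gamma> \<turnstile> subst \<sigma> (conjs (eqs xs ts))"
      unfolding subst_conjs[OF ne] subst_eqs[OF xs(1)]
    proof (rule conjs_intro)
      fix \<phi> :: "('f, 'r, 'v) fm"
      assume "\<phi> \<in> set (map2 (\<lambda>x t. Eq (\<sigma> x) (subst_tm \<sigma> t)) xs ts)"
      then obtain i where "i < length ts" "\<phi> = Eq (\<sigma> (xs ! i)) (subst_tm \<sigma> (ts ! i))"
        using xs(1) by (auto simp: set_zip)
      then show "\<Gamma> \<turnstile> \<phi>" by (simp add: \<sigma> \<sigma>t EqI)
    qed
    show "qfree \<sigma> (conjs (eqs xs ts))"
      by (rule qfree_conjs[OF _ ne]) (auto simp: eqs_def)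
    show "distinct xs" by fact
    show "\<sigma> x = Var x" if "x \<notin> set xs" for x using that by (simp add: \<sigma>_def)
    show "vars_tm (\<sigma> z) \<inter> set xs = {} \<and> \<Gamma> \<turnstile> cst [\<sigma> z]" if z: "z \<in> set xs" for z
    proof -
      obtain i where i: "i < length xs" "z = xs ! i" using z by (auto simp: in_set_conv_nth)
      then have "\<sigma> z \<in> set ts" using xs(1) by (simp add: \<sigma>)
      then show ?thesis using assms xs(3) by (auto simp: A_def)
    qed
  qed
  then show ?thesis by (simp add: cst_def xs_def A_def Let_def)
qed

lemma cst_term:
  fixes t :: "('f, 'v) tm" and \<Gamma> :: "('f, 'r, 'v) fm set"
  shows "(\<And>x. x \<in> vars_tm t \<Longrightarrow> \<Gamma> \<turnstile> cst [Var x]) \<Longrightarrow> \<Gamma> \<turnstile> cst [t]"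
proof (induction t)
  case (Fn f ts)
  show ?case
  proof (rule CstFun[OF cst_list])
    fix t
    assume t: "t \<in> set ts"
    show "\<Gamma> \<turnstile> cst [t]" by (rule Fn.IH[OF t]) (use t Fn.prems in \<open>simp, blast\<close>)
  qed
qed simp

text \<open>The constants are distinct, so the abbreviation binds one variable for each of them, in order.\<close>

lemma incl_constants:
  fixes ys :: "'v list" and cs :: "'f list"
  assumes "distinct cs" "length ys = length cs"
  obtains us where "distinct us" "length us = length cs" "set us \<inter> set ys = {}"
    "incl (zip (cs_tms cs) (vs_tms ys)) =
      (exs us (conjs (eqs us (cs_tms cs) @ [Inc (zip us ys)])) :: ('f, 'r, 'v) fm)"
proof -
  let ?ps = "zip (cs_tms cs) (vs_tms ys) :: (('f, 'v) tm \<times> ('f, 'v) tm) list"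
  let ?A = "\<Union>(t, u)\<in>set ?ps. vars_tm t \<union> vars_tm u"
  have 1: "remdups (filter (\<lambda>t. \<not> is_Var t) (map fst ?ps @ map snd ?ps)) = cs_tms cs"
  proof -
    have "filter (\<lambda>t. \<not> is_Var t) (cs_tms cs) = (cs_tms cs :: ('f, 'v) tm list)"
      "filter (\<lambda>t. \<not> is_Var t) (vs_tms ys) = ([] :: ('f, 'v) tm list)"
      by (auto simp: filter_id_conv filter_empty_conv)
    moreover have "distinct (cs_tms cs :: ('f, 'v) tm list)"
      using assms(1) by (auto simp: distinct_map inj_on_def)
    ultimately show ?thesis using assms(2) by (simp add: distinct_remdups_id)
  qed
  define us where "us = fresh (length cs) ?A"
  have "finite ?A" by auto
  then have us: "length us = length cs" "distinct us" "set us \<inter> ?A = {}"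
    using fresh_props[OF infinite_vars, of ?A "length cs"] unfolding us_def by auto
  have "set ys \<subseteq> ?A"
  proof
    fix y
    assume "y \<in> set ys"
    then obtain i where "i < length ys" "y = ys ! i" by (auto simp: in_set_conv_nth)
    then have "(Fn (cs ! i) [], Var y) \<in> set ?ps" using assms(2) by (auto simp: set_zip intro!: exI[of _ i])
    then show "y \<in> ?A" by force
  qed
  then have us': "set us \<inter> set ys = {}" using us by auto
  let ?\<rho> = "\<lambda>t. if is_Var t then the_Var t else the (map_of (zip (cs_tms cs) us) t)"
  have "map (\<lambda>(t, u). (?\<rho> t, ?\<rho> u)) ?ps = zip us ys"
  proof (rule nth_equalityI)
    fix i
    assume i: "i < length (map (\<lambda>(t, u). (?\<rho> t, ?\<rho> u)) ?ps)"
    have "distinct (cs_tms cs :: ('f, 'v) tm list)"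
      using assms(1) by (auto simp: distinct_map inj_on_def)
    then have "map_of (zip (cs_tms cs) us) ((cs_tms cs :: ('f, 'v) tm list) ! i) = Some (us ! i)"
      using i us by (intro map_of_zip_nth) auto
    then show "map (\<lambda>(t, u). (?\<rho> t, ?\<rho> u)) ?ps ! i = zip us ys ! i"
      using i us assms(2) by auto
  qed (use us assms(2) in auto)
  then have "incl ?ps = (exs us (conjs (eqs us (cs_tms cs) @ [Inc (zip us ys)])) :: ('f, 'r, 'v) fm)"
    unfolding incl_def Let_def 1 length_map us_def by simp
  then show thesis using that us us' by blast
qed


lemma exs_intro_vars:
  fixes \<phi> :: "('f, 'r, 'v) fm"
  assumes "\<Gamma> \<turnstile> subst (ren (replace us ws)) \<phi>" "qfree Var \<phi>" "distinct us" "length ws = length us"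
    and "set ws \<inter> set us = {}" "\<And>w. w \<in> set ws \<Longrightarrow> \<Gamma> \<turnstile> cst [Var w]"
  shows "\<Gamma> \<turnstile> exs us \<phi>"
  using assms(1)
proof (rule exs_intro)
  show "qfree (ren (replace us ws)) \<phi>"
    by (rule qfree_mono[OF assms(2)]) (auto simp: ren_def)
  show "ren (replace us ws) x = Var x" if "x \<notin> set us" for x using that by (simp add: ren_def)
  show "vars_tm (ren (replace us ws) u) \<inter> set us = {} \<and> \<Gamma> \<turnstile> cst [ren (replace us ws) u]"
    if "u \<in> set us" for u
  proof -
    have "replace us ws u \<in> set (map (replace us ws) us)" using that by auto
    then have "replace us ws u \<in> set ws" using assms(3,4) by simp
    then show ?thesis using assms(5,6) by (auto simp: ren_def)
  qed
qed fact

text \<open>An assumption that constants \<open>ds\<close> are included in \<open>xs\<close> is used through fresh variables \<open>ws\<close> that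
  equal the constants; the atom for \<open>ws\<close> has only variables as arguments.\<close>

lemma incl_elim:
  fixes \<Gamma> :: "('f, 'r, 'v) fm set"
  assumes "\<Gamma> \<turnstile> incl (zip (cs_tms ds) (vs_tms xs))" "finite \<Gamma>" "finite C"
    and ds: "distinct ds" "length xs = length ds"
    and step: "\<And>ws \<Delta>. length ws = length ds \<Longrightarrow> set ws \<inter> C = {} \<Longrightarrow> \<Gamma> \<subseteq> \<Delta> \<Longrightarrow> \<Delta> \<turnstile> Inc (zip ws xs) \<Longrightarrow>
      (\<And>w. w \<in> set ws \<Longrightarrow> \<Delta> \<turnstile> cst [Var w]) \<Longrightarrow>
      (\<And>i. i < length ds \<Longrightarrow> \<Delta> \<turnstile> Eq (Var (ws ! i)) (Fn (ds ! i) [])) \<Longrightarrow> \<Delta> \<turnstile> \<psi>"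
  shows "\<Gamma> \<turnstile> \<psi>"
proof -
  obtain us where us: "distinct us" "length us = length ds" "set us \<inter> set xs = {}"
    "incl (zip (cs_tms ds) (vs_tms xs)) =
      (exs us (conjs (eqs us (cs_tms ds) @ [Inc (zip us xs)])) :: ('f, 'r, 'v) fm)"
    using incl_constants[OF ds] by blast
  show ?thesis
  proof (rule exs_elim[OF _ qfree_incl assms(2,3) us(1)])
    show "\<Gamma> \<turnstile> exs us (conjs (eqs us (cs_tms ds) @ [Inc (zip us xs)]))"
      using assms(1) us(4) by simp
    fix \<theta>
    assume \<theta>: "\<And>x. x \<notin> set us \<Longrightarrow> \<theta> x = x" "\<theta> ` set us \<inter> C = {}"
    let ?B = "subst (ren \<theta>) (conjs (eqs us (cs_tms ds) @ [Inc (zip us xs)])) :: ('f, 'r, 'v) fm"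
    let ?D = "insert ?B ((\<lambda>z. cst [Var (\<theta> z)]) ` set us \<union> \<Gamma>)"
    have xs: "map \<theta> xs = xs" using \<theta>(1) us(3) by (intro map_idI) auto
    have "?D \<turnstile> ?B" by (rule Assm) simp
    then have B: "?D \<turnstile> conjs (eqs (map \<theta> us) (cs_tms ds) @ [Inc (zip (map \<theta> us) xs)])"
      unfolding subst_incl_body[OF us(1,2) ds(2) us(3)] xs .
    show "?D \<turnstile> \<psi>"
    proof (rule step[of "map \<theta> us"])
      show "?D \<turnstile> Inc (zip (map \<theta> us) xs)" by (rule conjs_elim[OF B]) simp
      show "?D \<turnstile> cst [Var w]" if "w \<in> set (map \<theta> us)" for w
        by (rule Assm) (use that in auto)
      show "?D \<turnstile> Eq (Var (map \<theta> us ! i)) (Fn (ds ! i) [])" if "i < length ds" for i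
      proof (rule conjs_elim[OF B])
        show "Eq (Var (map \<theta> us ! i)) (Fn (ds ! i) []) \<in>
            set (eqs (map \<theta> us) (cs_tms ds) @ [Inc (zip (map \<theta> us) xs)])"
          using that us(2) by (auto simp: eqs_def set_zip intro!: exI[of _ i])
      qed
    qed (use us(2) \<theta>(2) in auto)
  qed
qed

text \<open>Conversely, variables equal to the constants suffice, if they avoid the variables bound in the
  abbreviation, which form the set \<open>C\<close>.\<close>

lemma incl_intro:
  fixes xs :: "'v list" and ds :: "'f list"
  assumes ds: "distinct ds" "length xs = length ds"
  obtains C where "finite C"
    "\<And>(\<Delta> :: ('f, 'r, 'v) fm set) ws. length ws = length ds \<Longrightarrow> set ws \<inter> C = {} \<Longrightarrow> \<Delta> \<turnstile> Inc (zip ws xs) \<Longrightarrow>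
      (\<And>w. w \<in> set ws \<Longrightarrow> \<Delta> \<turnstile> cst [Var w]) \<Longrightarrow>
      (\<And>i. i < length ds \<Longrightarrow> \<Delta> \<turnstile> Eq (Var (ws ! i)) (Fn (ds ! i) [])) \<Longrightarrow>
      \<Delta> \<turnstile> incl (zip (cs_tms ds) (vs_tms xs))"
proof -
  obtain us where us: "distinct us" "length us = length ds" "set us \<inter> set xs = {}"
    "incl (zip (cs_tms ds) (vs_tms xs)) =
      (exs us (conjs (eqs us (cs_tms ds) @ [Inc (zip us xs)])) :: ('f, 'r, 'v) fm)"
    using incl_constants[OF ds] by blast
  show thesis
  proof (rule that[of "set us"])
    fix \<Delta> :: "('f, 'r, 'v) fm set" and ws
    assume ws: "length ws = length ds" "set ws \<inter> set us = {}" and inc: "\<Delta> \<turnstile> Inc (zip ws xs)"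
      and cst: "\<And>w. w \<in> set ws \<Longrightarrow> \<Delta> \<turnstile> cst [Var w]"
      and eq: "\<And>i. i < length ds \<Longrightarrow> \<Delta> \<turnstile> Eq (Var (ws ! i)) (Fn (ds ! i) [])"
    have map: "map (replace us ws) us = ws" "map (replace us ws) xs = xs" using us ws by auto
    show "\<Delta> \<turnstile> incl (zip (cs_tms ds) (vs_tms xs))"
      unfolding us(4)
    proof (rule exs_intro_vars[OF _ qfree_incl])
      show "\<Delta> \<turnstile> subst (ren (replace us ws)) (conjs (eqs us (cs_tms ds) @ [Inc (zip us xs)]))"
        unfolding subst_incl_body[OF us(1,2) ds(2) us(3)] map
      proof (rule conjs_intro)
        fix \<phi> :: "('f, 'r, 'v) fm"
        assume "\<phi> \<in> set (eqs ws (cs_tms ds) @ [Inc (zip ws xs)])"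
        then show "\<Delta> \<turnstile> \<phi>" using inc eq ws(1) by (auto simp: eqs_def set_zip)
      qed
    qed (use us ws cst in auto)
  qed simp
qed

lemma Inc_replace_Eq_aux:
  fixes \<Gamma> :: "('f, 'r, 'v) fm set"
  assumes "length ys = length cs"
  shows "list_all2 (\<lambda>c d. \<Gamma> \<turnstile> Eq (Var c) (Var d)) cs ds \<Longrightarrow> length ys = length cs \<Longrightarrow>
    \<Gamma> \<turnstile> Inc (ps @ zip cs ys) \<Longrightarrow> \<Gamma> \<turnstile> Inc (ps @ zip ds ys)"
proof (induction cs ds arbitrary: ps ys rule: list_all2_induct)
  case (Cons c cs d ds)
  obtain y ys' where ys: "ys = y # ys'" using Cons.prems(1) by (cases ys) auto
  let ?\<phi> = "\<lambda>z. Inc (ps @ (z, y) # zip cs ys') :: ('f, 'r, 'v) fm"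
  obtain z where z: "z \<notin> fv (Inc (ps @ (y, y) # zip cs ys') :: ('f, 'r, 'v) fm)"
    using ex_fresh[OF infinite_vars] by (metis finite_fv)
  have s: "subst1 (?\<phi> z) (Var w) z = ?\<phi> w" for w
    unfolding subst1_Var subst_ren_Inc using z by (force simp: image_iff intro!: map_idI)
  have "\<Gamma> \<turnstile> subst1 (?\<phi> z) (Var d) z"
  proof (rule EqE[OF Cons.hyps(1)])
    show "\<Gamma> \<turnstile> subst1 (?\<phi> z) (Var c) z" unfolding s using Cons.prems(2) ys by simp
  qed (auto intro: free_for_ren)
  then have "\<Gamma> \<turnstile> Inc ((ps @ [(d, y)]) @ zip cs ys')" unfolding s by simp
  then have "\<Gamma> \<turnstile> Inc ((ps @ [(d, y)]) @ zip ds ys')"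
    by (rule Cons.IH[rotated]) (use Cons.prems(1) ys in simp)
  then show ?case using ys by simp
qed simp

lemma Inc_replace_Eq:
  fixes \<Gamma> :: "('f, 'r, 'v) fm set"
  shows "list_all2 (\<lambda>c d. \<Gamma> \<turnstile> Eq (Var c) (Var d)) cs ds \<Longrightarrow> length ys = length cs \<Longrightarrow>
    \<Gamma> \<turnstile> Inc (zip cs ys) \<Longrightarrow> \<Gamma> \<turnstile> Inc (zip ds ys)"
  using Inc_replace_Eq_aux[of ys cs \<Gamma> ds "[]"] by simp

text \<open>\<open>IncCompress\<close> for an atom whose free variables are themselves the right-hand side of the
  inclusion.\<close>

lemma atom_compress:
  fixes \<Gamma> :: "('f, 'r, 'v) fm set"
  assumes "\<Gamma> \<turnstile> Inc (zip ws xs)" "\<Gamma> \<turnstile> l" "is_atom l" "fv l \<subseteq> set xs" "distinct xs" "length ws = length xs"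
  shows "\<Gamma> \<turnstile> subst (ren (replace xs ws)) l"
proof -
  have id: "simul xs (vs_tms xs) = (Var :: 'v \<Rightarrow> ('f, 'v) tm)"
    using assms(5) by (subst ren_replace) (auto simp: ren_def fun_eq_iff replace_def map_of_eq_None_iff
        dest!: map_of_SomeD split: option.split simp: in_set_zip distinct_conv_nth)
  have "\<Gamma> \<turnstile> subst (simul xs (vs_tms ws)) l"
    using assms(1)
  proof (rule IncCompress)
    show "\<Gamma> \<turnstile> subst (simul xs (vs_tms xs)) l" using assms(2) by (simp add: id)
    show "neg_inc_free l" "substitutable (simul xs (vs_tms ws)) l" "substitutable (simul xs (vs_tms xs)) l"
      using assms(3) by (cases l; simp)+
  qed (use assms in auto)
  then show ?thesis using assms(6) by (simp add: ren_replace)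
qed

text \<open>If the pair \<open>c d\<close> is included in \<open>x x\<close>, then \<open>x = x\<close> compresses to \<open>c = d\<close>.\<close>

lemma Inc_diagonal_Eq:
  fixes \<Gamma> :: "('f, 'r, 'v) fm set"
  assumes "\<Gamma> \<turnstile> Inc [(c, x), (d, x)]"
  shows "\<Gamma> \<turnstile> Eq (Var c) (Var d)"
proof -
  obtain a :: 'v where "a \<notin> {undefined}" using ex_fresh[OF infinite_vars, of "{undefined}"] by auto
  then obtain b where "a \<noteq> b" by blast
  then have s: "simul [a, b] (vs_tms [u, w]) a = (Var u :: ('f, 'v) tm)"
    "simul [a, b] (vs_tms [u, w]) b = (Var w :: ('f, 'v) tm)" for u w
    by (auto simp: simul_def)
  have "\<Gamma> \<turnstile> subst (simul [a, b] (vs_tms [c, d])) (Eq (Var a) (Var b))"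
  proof (rule IncCompress)
    show "\<Gamma> \<turnstile> Inc (zip [c, d] [x, x])" using assms by simp
    show "\<Gamma> \<turnstile> subst (simul [a, b] (vs_tms [x, x])) (Eq (Var a) (Var b))" 
      by (simp only: subst.simps subst_tm.simps s EqI)
  qed (use \<open>a \<noteq> b\<close> in auto)
  then show ?thesis by (simp only: subst.simps subst_tm.simps s)
qed

text \<open>Change of bound variables: a fresh variable with a constant value instantiates both formulas.\<close>

lemma Ex_rename:
  fixes A B :: "('f, 'r, 'v) fm"
  assumes "{subst1 A (Var v) a} \<turnstile> subst1 B (Var v) b" "v \<notin> vars A" "v \<notin> vars B"
  shows "{Ex1 a A} \<turnstile> Ex1 b B"
proof (rule ExE_var)
  show "{Ex1 a A} \<turnstile> Ex1 a A" by (rule Assm) simp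
  show "free_for (Var v) a A" using assms by (auto simp: vars_eq intro: free_for_ren)
  show "v \<notin> fvs (insert A (insert (Ex1 b B) {Ex1 a A}))" using assms by (auto simp: fvs_def vars_eq)
  let ?D = "insert (subst1 A (Var v) a) (insert (cst [Var v]) {Ex1 a A})"
  show "?D \<turnstile> Ex1 b B"
  proof (rule ExI)
    show "?D \<turnstile> subst1 B (Var v) b" using assms(1) by (rule Weaken) simp
    show "free_for (Var v) b B" using assms by (auto simp: vars_eq intro: free_for_ren)
    show "?D \<turnstile> cst [Var v]" by (rule Assm) simp
  qed
qed

lemma All_rename:
  fixes A B :: "('f, 'r, 'v) fm"
  assumes "{subst1 A (Var v) a} \<turnstile> subst1 B (Var v) b" "v \<notin> vars A" "v \<notin> vars B"
  shows "{All1 a A} \<turnstile> All1 b B"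
proof (rule AllI_var)
  show "free_for (Var v) b B" using assms by (auto simp: vars_eq intro: free_for_ren)
  show "v \<notin> fvs (insert B {All1 a A})" using assms by (auto simp: fvs_def vars_eq)
  let ?D = "insert (cst [Var v]) {All1 a A}"
  have "?D \<turnstile> subst1 A (Var v) a"
  proof (rule AllE)
    show "?D \<turnstile> All1 a A" "?D \<turnstile> cst [Var v]" by (auto intro: Assm)
    show "free_for (Var v) a A" using assms by (auto simp: vars_eq intro: free_for_ren)
  qed
  then show "?D \<turnstile> subst1 B (Var v) b" using assms(1) by (rule cut1)
qed

text \<open>If no \<open>x\<close> refutes \<open>\<phi>\<close>, then a fresh \<open>v\<close> with a constant value satisfies it, by \<open>RAA\<close>.\<close>

lemma not_All:
  fixes \<phi> :: "('f, 'r, 'v) fm"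
  shows "{Dneg (All1 x \<phi>)} \<turnstile> Ex1 x (Dneg \<phi>)"
proof (rule RAA)
  let ?G = "insert (Dneg (Ex1 x (Dneg \<phi>))) {Dneg (All1 x \<phi>)}"
  obtain v where v: "v \<notin> vars \<phi>" using ex_fresh[OF infinite_vars, of "vars \<phi>"] by auto
  have ff: "free_for (Var v) x \<phi>" "free_for (Var v) x (Dneg \<phi>)"
    using v by (auto simp: vars_eq intro: free_for_ren)
  have "?G \<turnstile> All1 x \<phi>"
  proof (rule AllI_var[OF _ ff(1)])
    show "v \<notin> fvs (insert \<phi> ?G)" using v by (auto simp: fvs_def vars_eq)
    show "insert (cst [Var v]) ?G \<turnstile> subst1 \<phi> (Var v) x"
    proof (rule RAA)
      let ?D = "insert (Dneg (subst1 \<phi> (Var v) x)) (insert (cst [Var v]) ?G)"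
      have "?D \<turnstile> Ex1 x (Dneg \<phi>)"
      proof (rule ExI[OF _ ff(2)])
        show "?D \<turnstile> subst1 (Dneg \<phi>) (Var v) x" by (rule Assm) (simp add: subst1_def)
        show "?D \<turnstile> cst [Var v]" by (rule Assm) simp
      qed
      moreover have "?D \<turnstile> Dneg (Ex1 x (Dneg \<phi>))" by (rule Assm) simp
      ultimately show "?D \<turnstile> bot_fm" by (rule NegE)
    qed
  qed
  moreover have "?G \<turnstile> Dneg (All1 x \<phi>)" by (rule Assm) simp
  ultimately show "?G \<turnstile> bot_fm" by (rule NegE)
qed

lemma fv_bot [simp]: "fv bot_fm = {}"
  by (simp add: bot_fm_def Let_def)

text \<open>If \<open>Ex1 x \<phi>\<close> holds, a witness of it can be called \<open>v\<close>; otherwise the disjunction holds for any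
  value of \<open>v\<close>.\<close>

lemma Henkin_step:
  fixes \<phi> :: "('f, 'r, 'v) fm"
  assumes "insert (Ex1 z (Eq (Var z) (Var v))) (insert (Or1 (Dneg (Ex1 x \<phi>)) (subst1 \<phi> (Var v) x)) \<Gamma>) \<turnstile> bot_fm"
    and v: "v \<notin> fvs \<Gamma>" "v \<notin> vars \<phi>" "z \<noteq> v"
  shows "\<Gamma> \<turnstile> bot_fm"
proof (rule case_split)
  let ?E = "Ex1 x \<phi>"
  have bot: "\<Delta> \<turnstile> bot_fm"
    if "\<Delta> \<turnstile> cst [Var v]" "\<Delta> \<turnstile> Or1 (Dneg ?E) (subst1 \<phi> (Var v) x)" "\<Gamma> \<subseteq> \<Delta>" for \<Delta>
  proof -
    have "insert (Ex1 z (Eq (Var z) (Var v))) (insert (Or1 (Dneg ?E) (subst1 \<phi> (Var v) x)) \<Delta>) \<turnstile> bot_fm"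
      using assms(1) by (rule Weaken) (use that(3) in auto)
    moreover have "insert (Or1 (Dneg ?E) (subst1 \<phi> (Var v) x)) \<Delta> \<turnstile> Ex1 z (Eq (Var z) (Var v))"
      using v(3) that(1) by (auto intro!: weaken_insert simp: Ex_eq_iff)
    ultimately show ?thesis using cut that(2) by blast
  qed
  have ff: "free_for (Var v) x \<phi>" using v(2) by (auto simp: vars_eq intro: free_for_ren)
  show "insert ?E \<Gamma> \<turnstile> bot_fm"
  proof (rule ExE_var[OF _ _ ff])
    show "insert ?E \<Gamma> \<turnstile> ?E" by (rule Assm) simp
    show "v \<notin> fvs (insert \<phi> (insert bot_fm (insert ?E \<Gamma>)))" using v by (auto simp: fvs_def vars_eq)
    let ?D = "insert (subst1 \<phi> (Var v) x) (insert (cst [Var v]) (insert ?E \<Gamma>))"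
    show "?D \<turnstile> bot_fm" by (rule bot) (auto intro: Assm OrI2)
  qed
  show "insert (Dneg ?E) \<Gamma> \<turnstile> bot_fm"
  proof (rule ExE_var)
    \<comment> \<open>Some value must exist for \<open>v\<close>; the value of an arbitrary constant symbol will do.\<close>
    let ?c = "Fn undefined [] :: ('f, 'v) tm"
    show "insert (Dneg ?E) \<Gamma> \<turnstile> Ex1 z (Eq (Var z) (Var z))"
    proof (rule ExI)
      show "insert (Dneg ?E) \<Gamma> \<turnstile> subst1 (Eq (Var z) (Var z)) ?c z" by (simp add: subst1_def EqI)
      show "insert (Dneg ?E) \<Gamma> \<turnstile> cst [?c]" using CstConst[of _ "[undefined]"] by simp
    qed (simp add: free_for_def)
    show "v \<notin> fvs (insert (Eq (Var z) (Var z)) (insert bot_fm (insert (Dneg ?E) \<Gamma>)))"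
      using v by (auto simp: fvs_def vars_eq)
    let ?D = "insert (subst1 (Eq (Var z) (Var z)) (Var v) z) (insert (cst [Var v]) (insert (Dneg ?E) \<Gamma>))"
    show "?D \<turnstile> bot_fm" by (rule bot) (auto intro: Assm OrI1)
  qed (simp add: free_for_def)
qed

context
  assumes infinite_fsyms: "infinite (UNIV :: 'f set)"
begin

lemma ex_fresh_fsyms:
  assumes "finite (A :: 'f set)"
  obtains ds where "length ds = n" "distinct ds" "set ds \<inter> A = {}"
  using fresh_props[OF infinite_fsyms assms, of n] by blast

text \<open>The two rules that introduce constant symbols witnessing a failed inclusion or atom yield
  existential formulas, in which variables take the place of the constant symbols.\<close>

lemma not_Inc_witness:
  fixes xs ys us :: "'v list"
  assumes len: "length ys = length xs" "length us = length xs"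
    and us: "distinct us" "set us \<inter> (set xs \<union> set ys) = {}"
  shows "{Dneg (Inc (zip xs ys))} \<turnstile>
    (exs us (And (Inc (zip us xs)) (Dneg (Inc (zip us ys)))) :: ('f, 'r, 'v) fm)" (is "?G \<turnstile> ?\<psi>")
proof -
  have "finite (all_fsyms (insert ?\<psi> ?G))" by (simp add: finite_all_fsyms)
  then obtain ds where ds: "length ds = length xs" "distinct ds" "set ds \<inter> all_fsyms (insert ?\<psi> ?G) = {}"
    by (rule ex_fresh_fsyms)
  let ?i = "\<lambda>zs. incl (zip (cs_tms ds) (vs_tms zs)) :: ('f, 'r, 'v) fm"
  show ?thesis
  proof (rule IncWit[of _ xs ys ds])
    show "?G \<turnstile> Dneg (Inc (zip xs ys))" by (rule Assm) simp
    obtain C where C: "finite C" "\<And>(\<Delta> :: ('f, 'r, 'v) fm set) ws. length ws = length ds \<Longrightarrow> set ws \<inter> C = {} \<Longrightarrow>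
      \<Delta> \<turnstile> Inc (zip ws ys) \<Longrightarrow> (\<And>w. w \<in> set ws \<Longrightarrow> \<Delta> \<turnstile> cst [Var w]) \<Longrightarrow>
      (\<And>i. i < length ds \<Longrightarrow> \<Delta> \<turnstile> Eq (Var (ws ! i)) (Fn (ds ! i) [])) \<Longrightarrow> \<Delta> \<turnstile> ?i ys"
      using incl_intro[of ds ys] ds len by metis
    let ?G' = "insert (?i xs) (insert (Dneg (?i ys)) ?G)"
    show "?G' \<turnstile> ?\<psi>"
    proof (rule incl_elim)
      show "?G' \<turnstile> ?i xs" by (rule Assm) simp
      show "finite ?G'" "finite (C \<union> set us)" "distinct ds" "length xs = length ds"
        using C ds by auto
      fix ws \<Delta>
      assume ws: "length ws = length ds" "set ws \<inter> (C \<union> set us) = {}" and sub: "?G' \<subseteq> \<Delta>"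
        and inc: "\<Delta> \<turnstile> Inc (zip ws xs)" and cst: "\<And>w. w \<in> set ws \<Longrightarrow> \<Delta> \<turnstile> cst [Var w]"
        and eq: "\<And>i. i < length ds \<Longrightarrow> \<Delta> \<turnstile> Eq (Var (ws ! i)) (Fn (ds ! i) [])"
      have "\<Delta> \<turnstile> Dneg (Inc (zip ws ys))"
      proof (rule NegI)
        let ?D = "insert (Inc (zip ws ys)) \<Delta>"
        have "?D \<turnstile> ?i ys"
          using ws by (intro C(2)) (auto intro: Assm weaken_insert cst eq)
        moreover have "?D \<turnstile> Dneg (?i ys)" using sub by (intro Assm) auto
        ultimately show "?D \<turnstile> bot_fm" by (rule NegE)
      qed
      moreover have "map (replace us ws) us = ws" "map (replace us ws) xs = xs" "map (replace us ws) ys = ys"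
        using us ws len ds by (auto simp: Int_Un_distrib)
      ultimately have "\<Delta> \<turnstile> subst (ren (replace us ws)) (And (Inc (zip us xs)) (Dneg (Inc (zip us ys))))"
        using inc by (auto simp: subst_Inc_zip simp del: subst_ren_Inc intro: AndI)
      then show "\<Delta> \<turnstile> ?\<psi>"
        by (rule exs_intro_vars) (use us ws len ds cst in auto)
    qed
  qed (use ds len in auto)
qed

lemma not_atom_witness:
  fixes xs us :: "'v list" and l :: "('f, 'r, 'v) fm"
  assumes l: "is_atom l" "fv l \<subseteq> set xs" "distinct xs"
    and us: "length us = length xs" "distinct us" "set us \<inter> set xs = {}"
  shows "{Dneg l} \<turnstile> exs us (And (Inc (zip us xs)) (Dneg (subst (ren (replace xs us)) l)))" (is "?G \<turnstile> ?\<psi>")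
proof -
  have "finite (all_fsyms (insert l (insert ?\<psi> ?G)))" by (simp add: finite_all_fsyms)
  then obtain ds where ds: "length ds = length xs" "distinct ds"
    "set ds \<inter> all_fsyms (insert l (insert ?\<psi> ?G)) = {}"
    by (rule ex_fresh_fsyms)
  let ?l = "subst (simul xs (cs_tms ds)) l"
  have q: "qfree \<sigma> (subst \<tau> l)" for \<sigma> \<tau> using l(1) by (cases l) auto
  have safe: "safe \<theta> l" for \<theta> using l(1) by (cases l) (auto simp: safe_def)
  show ?thesis
  proof (rule AtomWit[of _ l ds xs])
    show "?G \<turnstile> Dneg l" by (rule Assm) simp
    let ?G' = "insert (incl (zip (cs_tms ds) (vs_tms xs))) (insert (Dneg ?l) ?G)"
    show "?G' \<turnstile> ?\<psi>"
    proof (rule incl_elim)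
      show "?G' \<turnstile> incl (zip (cs_tms ds) (vs_tms xs))" by (rule Assm) simp
      show "finite ?G'" "finite (set us)" "distinct ds" "length xs = length ds"
        using ds by auto
      fix ws \<Delta>
      assume ws: "length ws = length ds" "set ws \<inter> set us = {}" and sub: "?G' \<subseteq> \<Delta>"
        and inc: "\<Delta> \<turnstile> Inc (zip ws xs)" and cst: "\<And>w. w \<in> set ws \<Longrightarrow> \<Delta> \<turnstile> cst [Var w]"
        and eq: "\<And>i. i < length ds \<Longrightarrow> \<Delta> \<turnstile> Eq (Var (ws ! i)) (Fn (ds ! i) [])"
      have "\<Delta> \<turnstile> Dneg (subst (ren (replace xs ws)) l)"
      proof (rule NegI)
        let ?D = "insert (subst (ren (replace xs ws)) l) \<Delta>"
        have "?D \<turnstile> ?l"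
        proof (rule subst_atom_Eq[OF l(1)])
          show "?D \<turnstile> subst (ren (replace xs ws)) l" by (rule Assm) simp
          fix x
          assume "x \<in> fv l"
          then obtain i where i: "i < length xs" "x = xs ! i" using l(2) by (metis in_set_conv_nth subsetD)
          then have 1: "simul xs (cs_tms ds) x = Fn (ds ! i) []"
            using l(3) ds by (simp add: simul_def map_of_zip_nth)
          have 2: "ren (replace xs ws) x = Var (ws ! i)"
            using i l(3) ws ds by (simp add: ren_def replace_nth)
          show "?D \<turnstile> Eq (ren (replace xs ws) x) (simul xs (cs_tms ds) x)"
            unfolding 1 2 using eq[of i] i ds by (simp add: weaken_insert)
        qed
        moreover have "?D \<turnstile> Dneg ?l" using sub by (intro Assm) auto
        ultimately show "?D \<turnstile> bot_fm" by (rule NegE)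
      qed
      moreover have "map (replace us ws) us = ws" "map (replace us ws) xs = xs"
        using us ws ds by auto
      moreover have "subst (ren (replace us ws)) (subst (ren (replace xs us)) l) = subst (ren (replace xs ws)) l"
        unfolding subst_ren_comp[OF safe]
      proof (rule subst_cong)
        fix x
        assume "x \<in> fv l"
        then obtain i where i: "i < length xs" "x = xs ! i" using l(2) by (metis in_set_conv_nth subsetD)
        then show "ren (\<lambda>y. replace us ws (replace xs us y)) x = ren (replace xs ws) x"
          using l(3) us ws ds by (simp add: ren_def replace_nth)
      qed
      ultimately have "\<Delta> \<turnstile> subst (ren (replace us ws)) (And (Inc (zip us xs)) (Dneg (subst (ren (replace xs us)) l)))"
        using inc by (auto simp: subst_Inc_zip simp del: subst_ren_Inc intro: AndI)
      then show "\<Delta> \<turnstile> ?\<psi>"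
        by (rule exs_intro_vars) (use us ws ds cst q in auto)
    qed
  qed (use ds l in auto)
qed

end

end

section \<open>Henkin variables and normal forms of bound variables\<close>

text \<open>\<open>Fr i\<close> is the \<open>i\<close>-th free variable of the given formulas, \<open>Bd n\<close> a variable bound below \<open>n\<close> other
  quantifiers, and \<open>Nm x \<phi>\<close>, a \<^emph>\<open>Henkin variable\<close>, a witness for \<open>Ex1 x \<phi>\<close>.  The formula is part of the
  name, so a Henkin variable is a finite object built from the vocabulary and the natural numbers.
  This bounds the size of the model by that of the vocabulary, even if there are more variables than
  symbols.\<close>

datatype ('f, 'r) hvar =
    Fr nat
  | Bd nat
  | is_Nm: Nm "('f, 'r) hvar" "('f, 'r, ('f, 'r) hvar) fm"

type_synonym ('f, 'r) efm = "('f, 'r, ('f, 'r) hvar) fm"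

text \<open>Bound variables are renamed to \<open>Bd n\<close>, where \<open>n\<close> counts the enclosing quantifiers, so that
  \<open>\<alpha>\<close>-equivalent formulas share their Henkin variables.\<close>

primrec alpha_nf :: "('f, 'r, 'v) fm \<Rightarrow> ('v \<Rightarrow> ('f, 'r) hvar) \<Rightarrow> nat \<Rightarrow> ('f, 'r) efm" where
  "alpha_nf (Eq t u) \<rho> n = Eq (map_tm (\<lambda>x. x) \<rho> t) (map_tm (\<lambda>x. x) \<rho> u)"
| "alpha_nf (Rel R ts) \<rho> n = Rel R (map (map_tm (\<lambda>x. x) \<rho>) ts)"
| "alpha_nf (Inc ps) \<rho> n = Inc (map (\<lambda>(x, y). (\<rho> x, \<rho> y)) ps)"
| "alpha_nf (Dneg \<phi>) \<rho> n = Dneg (alpha_nf \<phi> \<rho> n)"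
| "alpha_nf (And \<phi> \<psi>) \<rho> n = And (alpha_nf \<phi> \<rho> n) (alpha_nf \<psi> \<rho> n)"
| "alpha_nf (Or1 \<phi> \<psi>) \<rho> n = Or1 (alpha_nf \<phi> \<rho> n) (alpha_nf \<psi> \<rho> n)"
| "alpha_nf (Ex1 x \<phi>) \<rho> n = Ex1 (Bd n) (alpha_nf \<phi> (\<rho>(x := Bd n)) (Suc n))"
| "alpha_nf (All1 x \<phi>) \<rho> n = All1 (Bd n) (alpha_nf \<phi> (\<rho>(x := Bd n)) (Suc n))"

lemma fv_alpha_nf: "fv (alpha_nf \<phi> \<rho> n) \<subseteq> \<rho> ` fv \<phi>"
proof (induction \<phi> arbitrary: \<rho> n)
  case (Inc ps)
  then show ?case by (force simp: image_iff)
next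
  case (Ex1 x \<phi>)
  have "fv (alpha_nf \<phi> (\<rho>(x := Bd n)) (Suc n)) \<subseteq> (\<rho>(x := Bd n)) ` fv \<phi>" by (rule Ex1.IH)
  then show ?case by auto
next
  case (All1 x \<phi>)
  have "fv (alpha_nf \<phi> (\<rho>(x := Bd n)) (Suc n)) \<subseteq> (\<rho>(x := Bd n)) ` fv \<phi>" by (rule All1.IH)
  then show ?case by auto
next
  case (And \<phi> \<psi>)
  then show ?case by (simp add: image_Un) blast
next
  case (Or1 \<phi> \<psi>)
  then show ?case by (simp add: image_Un) blast
qed (auto simp: tm.set_map)

lemma bv_alpha_nf: "bv (alpha_nf \<phi> \<rho> n) \<subseteq> Bd ` {n..}"
proof (induction \<phi> arbitrary: \<rho> n)
  case (Ex1 x \<phi>)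
  have "bv (alpha_nf \<phi> (\<rho>(x := Bd n)) (Suc n)) \<subseteq> Bd ` {Suc n..}" by (rule Ex1.IH)
  then show ?case by (auto simp: image_iff)
next
  case (All1 x \<phi>)
  have "bv (alpha_nf \<phi> (\<rho>(x := Bd n)) (Suc n)) \<subseteq> Bd ` {Suc n..}" by (rule All1.IH)
  then show ?case by (auto simp: image_iff)
qed auto

lemma eval_map_tm: "eval M s (map_tm (\<lambda>x. x) \<rho> t) = eval M (\<lambda>x. s (\<rho> x)) t"
  by (induction t) (auto simp: comp_def cong: map_cong)

lemma sat_alpha_nf:
  "(\<And>y m. n \<le> m \<Longrightarrow> \<rho> y \<noteq> Bd m) \<Longrightarrow>
    sat M (f ` I) (alpha_nf \<phi> \<rho> n) = sat M ((\<lambda>i y. f i (\<rho> y)) ` I) \<phi>"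
proof (induction \<phi> arbitrary: \<rho> n f)
  case (Eq t u)
  show ?case by (simp add: eval_map_tm)
next
  case (Rel R ts)
  show ?case by (simp add: eval_map_tm comp_def)
next
  case (Inc ps)
  show ?case by (simp add: case_prod_unfold comp_def)
next
  case (Ex1 x \<phi>)
  have upd: "(\<lambda>i y. ((f i)(Bd n := a)) ((\<rho>(x := Bd n)) y)) = (\<lambda>i. (\<lambda>y. f i (\<rho> y))(x := a))" for a
    using Ex1.prems by (auto simp: fun_eq_iff)
  have "sat M ((\<lambda>i. (f i)(Bd n := a)) ` I) (alpha_nf \<phi> (\<rho>(x := Bd n)) (Suc n)) =
      sat M ((\<lambda>i. (\<lambda>y. f i (\<rho> y))(x := a)) ` I) \<phi>" for a
    unfolding upd[symmetric] by (rule Ex1.IH) (use Ex1.prems in auto)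
  then show ?case by (simp add: team_upd_image)
next
  case (All1 x \<phi>)
  have upd: "(\<lambda>i y. ((f i)(Bd n := a)) ((\<rho>(x := Bd n)) y)) = (\<lambda>i. (\<lambda>y. f i (\<rho> y))(x := a))" for a
    using All1.prems by (auto simp: fun_eq_iff)
  have "sat M ((\<lambda>i. (f i)(Bd n := a)) ` I) (alpha_nf \<phi> (\<rho>(x := Bd n)) (Suc n)) =
      sat M ((\<lambda>i. (\<lambda>y. f i (\<rho> y))(x := a)) ` I) \<phi>" for a
    unfolding upd[symmetric] by (rule All1.IH) (use All1.prems in auto)
  then show ?case by (simp add: team_upd_image)
next
  case (Dneg \<phi>)
  show ?case using Dneg.IH[OF Dneg.prems] by simp
next
  case (And \<phi> \<psi>)
  show ?case using And.IH(1)[OF And.prems] And.IH(2)[OF And.prems] by simp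
next
  case (Or1 \<phi> \<psi>)
  show ?case using Or1.IH(1)[OF Or1.prems] Or1.IH(2)[OF Or1.prems] by simp
qed

abbreviation (input) deq :: "('f, 'r, 'v) fm \<Rightarrow> ('f, 'r, 'v) fm \<Rightarrow> bool" where
  "deq \<phi> \<psi> \<equiv> {\<phi>} \<turnstile> \<psi> \<and> {\<psi>} \<turnstile> \<phi>"

lemma deq_And: "deq \<phi> \<phi>' \<Longrightarrow> deq \<psi> \<psi>' \<Longrightarrow> deq (And \<phi> \<psi>) (And \<phi>' \<psi>')"
  by (meson AndE1 AndE2 AndI Assm cut1 singletonI)

lemma Or_mono:
  assumes "{\<phi>} \<turnstile> \<phi>'" "{\<psi>} \<turnstile> \<psi>'"
  shows "{Or1 \<phi> \<psi>} \<turnstile> Or1 \<phi>' \<psi>'"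
proof (rule OrE)
  show "{Or1 \<phi> \<psi>} \<turnstile> Or1 \<phi> \<psi>" by (rule Assm) simp
  show "{\<phi>, Or1 \<phi> \<psi>} \<turnstile> Or1 \<phi>' \<psi>'" by (rule OrI1, rule Weaken[OF assms(1)]) simp
  show "{\<psi>, Or1 \<phi> \<psi>} \<turnstile> Or1 \<phi>' \<psi>'" by (rule OrI2, rule Weaken[OF assms(2)]) simp
qed

lemma Dneg_antimono:
  assumes "{\<phi>} \<turnstile> \<phi>'"
  shows "{Dneg \<phi>'} \<turnstile> Dneg \<phi>"
proof (rule NegI, rule NegE)
  show "insert \<phi> {Dneg \<phi>'} \<turnstile> \<phi>'" by (rule Weaken[OF assms]) simp
  show "insert \<phi> {Dneg \<phi>'} \<turnstile> Dneg \<phi>'" by (rule Assm) simp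
qed

text \<open>The step for both quantifiers.  A fresh \<open>v\<close> takes the place of the bound variable on either side,
  and the induction hypothesis applies to the renamings that send it to \<open>v\<close>.\<close>

lemma deq_binders:
  fixes \<phi> :: "('f, 'r, 'v) fm" and N :: "('f, 'r) efm"
  assumes inf: "infinite (UNIV :: 'v set)"
    and IH: "\<And>\<tau> \<theta>. inj_on \<tau> (vars N) \<Longrightarrow> (\<And>y. y \<in> fv \<phi> \<Longrightarrow> \<theta> y = \<tau> ((\<rho>(x := Bd n)) y)) \<Longrightarrow>
      safe \<theta> \<phi> \<Longrightarrow> deq (mv \<tau> N) (subst (ren \<theta>) \<phi>)"
    and N: "Bd n \<notin> bv N" and inj: "inj_on \<tau> (insert (Bd n) (vars N))"
    and \<theta>: "\<And>y. y \<in> fv \<phi> - {x} \<Longrightarrow> \<theta> y = \<tau> (\<rho> y) \<and> \<rho> y \<noteq> Bd n" and safe: "safe \<theta> (Ex1 x \<phi>)"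
  shows "deq (Ex1 (\<tau> (Bd n)) (mv \<tau> N)) (Ex1 x (subst (ren (\<theta>(x := x))) \<phi>))"
    and "deq (All1 (\<tau> (Bd n)) (mv \<tau> N)) (All1 x (subst (ren (\<theta>(x := x))) \<phi>))"
proof -
  define B where "B = subst (ren (\<theta>(x := x))) \<phi>"
  have "finite (vars (mv \<tau> N) \<union> vars B \<union> vars \<phi>)" by (simp del: vars_mv)
  from ex_fresh[OF inf this] obtain v where v: "v \<notin> vars (mv \<tau> N) \<union> vars B \<union> vars \<phi>" .
  have A1: "subst1 (mv \<tau> N) (Var v) (\<tau> (Bd n)) = mv (\<tau>(Bd n := v)) N"
    unfolding subst1_Var
  proof (rule mv_change)
    show "inj_on \<tau> (vars N)" using inj by (rule inj_on_subset) auto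
    show "((\<lambda>x. x)(\<tau> (Bd n) := v)) (\<tau> y) = (\<tau>(Bd n := v)) y" if "y \<in> fv N" for y
      using that inj fv_subset_vars[of N] by (auto simp: inj_on_def)
    show "\<tau> y = (\<tau>(Bd n := v)) y" if "y \<in> bv N" for y using that N by auto
  qed
  have B1: "subst1 B (Var v) x = subst (ren (\<theta>(x := v))) \<phi>"
    unfolding subst1_Var B_def subst_ren_comp[OF safe_Ex[OF safe]] using safe_Ex_neq[OF safe]
    by (intro subst_cong) (auto simp: ren_def)
  have "deq (mv (\<tau>(Bd n := v)) N) (subst (ren (\<theta>(x := v))) \<phi>)"
  proof (rule IH)
    show "inj_on (\<tau>(Bd n := v)) (vars N)" using inj v by (auto simp: inj_on_def)
    show "(\<theta>(x := v)) y = (\<tau>(Bd n := v)) ((\<rho>(x := Bd n)) y)" if "y \<in> fv \<phi>" for y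
      using that \<theta>[of y] by auto
    show "safe (\<theta>(x := v)) \<phi>" using safe v by (auto simp: safe_def vars_eq)
  qed
  then show "deq (Ex1 (\<tau> (Bd n)) (mv \<tau> N)) (Ex1 x (subst (ren (\<theta>(x := x))) \<phi>))"
    "deq (All1 (\<tau> (Bd n)) (mv \<tau> N)) (All1 x (subst (ren (\<theta>(x := x))) \<phi>))"
    using v Ex_rename[OF inf, of "mv \<tau> N" v "\<tau> (Bd n)" B x] Ex_rename[OF inf, of B v x "mv \<tau> N" "\<tau> (Bd n)"]
      All_rename[OF inf, of "mv \<tau> N" v "\<tau> (Bd n)" B x] All_rename[OF inf, of B v x "mv \<tau> N" "\<tau> (Bd n)"]
    unfolding A1 B1 B_def[symmetric] by blast+
qed

text \<open>The normal form, moved back to the original variables along \<open>\<tau>\<close>, is interderivable with the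
  formula; the hypothesis on \<open>\<rho>\<close> says that the numbers of the bound variables are new.\<close>

lemma alpha_nf_deq:
  fixes \<phi> :: "('f, 'r, 'v) fm"
  assumes inf: "infinite (UNIV :: 'v set)"
  shows "inj_on \<tau> (vars (alpha_nf \<phi> \<rho> n)) \<Longrightarrow> (\<And>y. y \<in> fv \<phi> \<Longrightarrow> \<theta> y = \<tau> (\<rho> y)) \<Longrightarrow> safe \<theta> \<phi> \<Longrightarrow>
    (\<And>y m. y \<in> fv \<phi> \<Longrightarrow> n \<le> m \<Longrightarrow> \<rho> y \<noteq> Bd m) \<Longrightarrow>
    deq (mv \<tau> (alpha_nf \<phi> \<rho> n)) (subst (ren \<theta>) \<phi>)"
proof (induction \<phi> arbitrary: \<rho> n \<tau> \<theta>)
  case (Eq t u)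
  have "mv \<tau> (alpha_nf (Eq t u) \<rho> n) = subst (ren \<theta>) (Eq t u)"
    using Eq.prems(2) by (auto simp: subst_tm_ren tm.map_comp intro!: tm.map_cong)
  then show ?case by (simp add: Assm)
next
  case (Rel R ts)
  have "mv \<tau> (alpha_nf (Rel R ts) \<rho> n) = subst (ren \<theta>) (Rel R ts)"
    using Rel.prems(2) by (auto simp: subst_tm_ren tm.map_comp intro!: tm.map_cong) (metis UN_I)
  then show ?case by (simp add: Assm)
next
  case (Inc ps)
  have "mv \<tau> (alpha_nf (Inc ps) \<rho> n) = subst (ren \<theta>) (Inc ps)"
    using Inc.prems(2) unfolding subst_ren_Inc by (force simp: image_iff)
  then show ?case by (simp add: Assm)
next
  case (Dneg \<phi>)
  have "deq (mv \<tau> (alpha_nf \<phi> \<rho> n)) (subst (ren \<theta>) \<phi>)"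
    using Dneg.prems by (intro Dneg.IH) (auto dest: safe_Dneg)
  then show ?case by (simp add: Dneg_antimono)
next
  case (And \<phi> \<psi>)
  have "deq (mv \<tau> (alpha_nf \<phi> \<rho> n)) (subst (ren \<theta>) \<phi>)"
    by (rule And.IH(1)) (use And.prems safe_And[OF And.prems(3)] in \<open>auto simp: inj_on_Un\<close>)
  moreover have "deq (mv \<tau> (alpha_nf \<psi> \<rho> n)) (subst (ren \<theta>) \<psi>)"
    by (rule And.IH(2)) (use And.prems safe_And[OF And.prems(3)] in \<open>auto simp: inj_on_Un\<close>)
  ultimately show ?case using deq_And by simp
next
  case (Or1 \<phi> \<psi>)
  have "deq (mv \<tau> (alpha_nf \<phi> \<rho> n)) (subst (ren \<theta>) \<phi>)"
    by (rule Or1.IH(1)) (use Or1.prems safe_Or[OF Or1.prems(3)] in \<open>auto simp: inj_on_Un\<close>)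
  moreover have "deq (mv \<tau> (alpha_nf \<psi> \<rho> n)) (subst (ren \<theta>) \<psi>)"
    by (rule Or1.IH(2)) (use Or1.prems safe_Or[OF Or1.prems(3)] in \<open>auto simp: inj_on_Un\<close>)
  ultimately show ?case by (simp add: Or_mono)
next
  case (Ex1 x \<phi>)
  have "deq (Ex1 (\<tau> (Bd n)) (mv \<tau> (alpha_nf \<phi> (\<rho>(x := Bd n)) (Suc n)))) (Ex1 x (subst (ren (\<theta>(x := x))) \<phi>))"
  proof (rule deq_binders(1)[OF inf, where \<rho> = \<rho>])
    show "deq (mv \<tau>' (alpha_nf \<phi> (\<rho>(x := Bd n)) (Suc n))) (subst (ren \<theta>') \<phi>)"
      if "inj_on \<tau>' (vars (alpha_nf \<phi> (\<rho>(x := Bd n)) (Suc n)))" "\<And>y. y \<in> fv \<phi> \<Longrightarrow> \<theta>' y = \<tau>' ((\<rho>(x := Bd n)) y)"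
        "safe \<theta>' \<phi>" for \<tau>' \<theta>'
      using that by (rule Ex1.IH) (use Ex1.prems(4) Suc_leD in auto)
    show "Bd n \<notin> bv (alpha_nf \<phi> (\<rho>(x := Bd n)) (Suc n))" using bv_alpha_nf[of \<phi> "\<rho>(x := Bd n)" "Suc n"] by auto
    show "safe \<theta> (Ex1 x \<phi>)" by (rule Ex1.prems(3))
  qed (use Ex1.prems in auto)
  then show ?case by simp
next
  case (All1 x \<phi>)
  have "deq (All1 (\<tau> (Bd n)) (mv \<tau> (alpha_nf \<phi> (\<rho>(x := Bd n)) (Suc n)))) (All1 x (subst (ren (\<theta>(x := x))) \<phi>))"
  proof (rule deq_binders(2)[OF inf, where \<rho> = \<rho>])
    show "deq (mv \<tau>' (alpha_nf \<phi> (\<rho>(x := Bd n)) (Suc n))) (subst (ren \<theta>') \<phi>)"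
      if "inj_on \<tau>' (vars (alpha_nf \<phi> (\<rho>(x := Bd n)) (Suc n)))" "\<And>y. y \<in> fv \<phi> \<Longrightarrow> \<theta>' y = \<tau>' ((\<rho>(x := Bd n)) y)"
        "safe \<theta>' \<phi>" for \<tau>' \<theta>'
      using that by (rule All1.IH) (use All1.prems(4) Suc_leD in auto)
    show "Bd n \<notin> bv (alpha_nf \<phi> (\<rho>(x := Bd n)) (Suc n))" using bv_alpha_nf[of \<phi> "\<rho>(x := Bd n)" "Suc n"] by auto
    show "safe \<theta> (Ex1 x \<phi>)" using All1.prems(3) by (simp add: safe_def)
  qed (use All1.prems in auto)
  then show ?case by simp
qed


section \<open>Maximal consistent sets with Henkin witnesses\<close>

abbreviation vset :: "('f, 'r, 'w) fm set \<Rightarrow> 'w set" where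
  "vset S \<equiv> \<Union> (vars ` S)"

text \<open>Derivability is only needed over the original variables.  There may be too few of them to rename
  a whole set of formulas, but a finite set can be renamed injectively, and a set over the
  extended variables counts as consistent if each of its finite subsets has a consistent copy.\<close>

definition realizes :: "(('f, 'r) hvar \<Rightarrow> 'v) \<Rightarrow> ('f, 'r) efm set \<Rightarrow> bool" where
  "realizes h S \<longleftrightarrow> inj_on h (vset S) \<and> \<not> mv h ` S \<turnstile> bot_fm"

definition finitely_realizable :: "'v itself \<Rightarrow> ('f, 'r) efm set \<Rightarrow> bool" where
  "finitely_realizable TV S \<longleftrightarrow> (\<forall>S0. finite S0 \<longrightarrow> S0 \<subseteq> S \<longrightarrow> (\<exists>h :: ('f, 'r) hvar \<Rightarrow> 'v. realizes h S0))"

lemma extend_inj: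
  assumes "finite A" "finite B" "inj_on h A" "infinite (UNIV :: 'v set)"
  shows "\<exists>h' :: 'w \<Rightarrow> 'v. inj_on h' (A \<union> B) \<and> (\<forall>x\<in>A. h' x = h x)"
  using assms(2)
proof (induction B)
  case empty
  then show ?case using assms(3) by auto
next
  case (insert b B)
  then obtain h' where h': "inj_on h' (A \<union> B)" "\<forall>x\<in>A. h' x = h x" by blast
  show ?case
  proof (cases "b \<in> A \<union> B")
    case True
    then show ?thesis using h' by (intro exI[of _ h']) (auto simp: insert_absorb)
  next
    case False
    obtain v where v: "v \<notin> h' ` (A \<union> B)"
      using ex_fresh[OF assms(4), of "h' ` (A \<union> B)"] assms(1) insert.hyps by auto
    have "inj_on (h'(b := v)) (A \<union> insert b B)"
      using h'(1) v False by (auto simp: inj_on_def)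
    moreover have "\<forall>x\<in>A. (h'(b := v)) x = h x" using h'(2) False by auto
    ultimately show ?thesis by blast
  qed
qed

lemma realizes_extend:
  fixes h :: "('f, 'r) hvar \<Rightarrow> 'v"
  assumes "realizes h S" "finite S" "finite B" "infinite (UNIV :: 'v set)"
  shows "\<exists>h' :: ('f, 'r) hvar \<Rightarrow> 'v. realizes h' S \<and> inj_on h' (vset S \<union> B)"
proof -
  obtain h' where h': "inj_on h' (vset S \<union> B)" "\<forall>x\<in>vset S. h' x = h x"
    using extend_inj[of "vset S" B h] assms by (auto simp: realizes_def)
  have "mv h' ` S = mv h ` S" using h'(2) by (intro image_cong mv_cong) auto
  moreover have "inj_on h' (vset S)" using h'(1) by (rule inj_on_subset) auto
  ultimately show ?thesis using h'(1) assms(1) by (auto simp: realizes_def)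
qed

text \<open>The rank shows that \<open>Nm x \<phi>\<close> is distinct from \<open>x\<close> and does not occur in \<open>\<phi>\<close>.\<close>

primrec rank :: "('f, 'r) hvar \<Rightarrow> nat" where
  "rank (Fr n) = 0"
| "rank (Bd n) = 0"
| "rank (Nm x \<phi>) = Suc (rank x + Max (insert 0 (vars (map_fm (\<lambda>x. x) (\<lambda>x. x) rank \<phi>))))"

lemma rank_less: "y \<in> insert x (vars \<phi>) \<Longrightarrow> rank y < rank (Nm x \<phi>)"
proof -
  assume "y \<in> insert x (vars \<phi>)"
  moreover have "rank y \<le> Max (insert 0 (rank ` vars \<phi>))" if "y \<in> vars \<phi>"
    using that by (intro Max_ge) auto
  ultimately show ?thesis by (auto simp: less_Suc_eq_le intro: trans_le_add2)
qed

definition named :: "('f, 'r) hvar \<Rightarrow> ('f, 'r) efm" where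
  "named c = Ex1 (Bd 0) (Eq (Var (Bd 0)) (Var c))"

text \<open>\<open>Nm x \<phi>\<close> has a constant value and satisfies \<open>\<phi>\<close> if anything does.\<close>

definition Henkin_axioms :: "('f, 'r) hvar \<times> ('f, 'r) efm \<Rightarrow> ('f, 'r) efm set" where
  "Henkin_axioms = (\<lambda>(x, \<phi>). {named (Nm x \<phi>),
     Or1 (Dneg (Ex1 x \<phi>)) (subst1 \<phi> (Var (Nm x \<phi>)) x)})"

lemma vars_named: "vars (named c) = {Bd 0, c}"
  by (auto simp: named_def)

lemma vars_subst1_subset: "vars (subst1 \<phi> (Var c) x) \<subseteq> insert c (vars \<phi>)"
  using fv_subst_ren_subset[of "(\<lambda>x. x)(x := c)" \<phi>] by (auto simp: vars_eq subst1_Var split: if_splits)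

lemma vset_Henkin_axioms: "vset (Henkin_axioms (x, \<phi>)) \<subseteq> {Bd 0, x, Nm x \<phi>} \<union> vars \<phi>"
  using vars_subst1_subset[of \<phi> "Nm x \<phi>" x] by (auto simp: Henkin_axioms_def vars_named)

lemma finite_Henkin_axioms: "finite (Henkin_axioms p)"
  by (cases p) (simp add: Henkin_axioms_def)

text \<open>Among finitely many Henkin axioms, those of a variable of maximal rank mention it alone: it occurs
  neither in \<open>T\<close> nor in the other axioms.  So its image is a fresh variable, and \<open>Henkin_step\<close>
  removes these axioms.\<close>

lemma realizes_Henkin:
  fixes T :: "('f, 'r) efm set"
  assumes inf: "infinite (UNIV :: 'v set)"
    and T: "finite T" "\<And>y. y \<in> vset T \<Longrightarrow> \<not> is_Nm y" and h: "\<exists>h :: ('f, 'r) hvar \<Rightarrow> 'v. realizes h T"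
  shows "finite A \<Longrightarrow> \<exists>h :: ('f, 'r) hvar \<Rightarrow> 'v. realizes h (T \<union> (\<Union>p\<in>A. Henkin_axioms p))"
proof (induction "card A" arbitrary: A)
  case 0
  then show ?case using h by simp
next
  case (Suc n)
  then have "A \<noteq> {}" by auto
  let ?r = "\<lambda>(x, \<phi>). rank (Nm x \<phi>)"
  obtain p where p: "p \<in> A" "\<And>q. q \<in> A \<Longrightarrow> ?r q \<le> ?r p"
  proof -
    have "Max (?r ` A) \<in> ?r ` A" using \<open>A \<noteq> {}\<close> Suc.prems by (intro Max_in) auto
    then obtain p where "p \<in> A" "?r p = Max (?r ` A)" by (metis (no_types, lifting) imageE)
    then show ?thesis using that Suc.prems by (metis (no_types, lifting) Max_ge finite_imageI imageI)
  qed
  obtain x \<phi> where px: "p = (x, \<phi>)" by (cases p)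
  define c where "c = Nm x \<phi>"
  define A' where "A' = A - {p}"
  define U where "U = T \<union> (\<Union>q\<in>A'. Henkin_axioms q)"
  have "card A' = n" using Suc.hyps(2) p(1) Suc.prems by (simp add: A'_def)
  then obtain h :: "('f, 'r) hvar \<Rightarrow> 'v" where h: "realizes h U"
    using Suc.hyps(1)[of A'] Suc.prems by (auto simp: U_def A'_def)
  have U: "finite U" using T(1) Suc.prems by (auto simp: U_def A'_def finite_Henkin_axioms)
  have cU: "c \<notin> vset U"
  proof
    assume "c \<in> vset U"
    moreover have "c \<notin> vset T" using T(2)[of c] by (auto simp: c_def)
    ultimately obtain q where q: "q \<in> A'" "c \<in> vset (Henkin_axioms q)" by (auto simp: U_def)
    obtain y \<psi> where yq: "q = (y, \<psi>)" by (cases q)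
    have "c \<noteq> Nm y \<psi>" using q(1) px yq by (auto simp: A'_def c_def)
    then have "c \<in> insert y (vars \<psi>)"
      using q(2) vset_Henkin_axioms[of y \<psi>] yq by (auto simp: c_def)
    then have "rank c < rank (Nm y \<psi>)" by (rule rank_less)
    moreover have "rank (Nm y \<psi>) \<le> rank c" using p(2)[of q] q(1) px yq by (auto simp: A'_def c_def)
    ultimately show False by simp
  qed
  let ?B = "{Bd 0, x, c} \<union> vars \<phi>"
  obtain k :: "('f, 'r) hvar \<Rightarrow> 'v" where k: "realizes k U" "inj_on k (vset U \<union> ?B)"
    using realizes_extend[OF h U, of ?B] inf by auto
  have cx: "c \<noteq> x" "c \<notin> vars \<phi>" "c \<noteq> Bd 0"
    using rank_less[of c x \<phi>] by (auto simp: c_def)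
  have inj: "inj_on k (insert x (vars \<phi>))" using k(2) by (rule inj_on_subset) auto
  have eq: "T \<union> (\<Union>q\<in>A. Henkin_axioms q) = U \<union> Henkin_axioms p"
    using p(1) by (auto simp: U_def A'_def)
  have "inj_on k (vset (U \<union> Henkin_axioms p))"
    by (rule inj_on_subset[OF k(2)]) (use vset_Henkin_axioms[of x \<phi>] px in \<open>auto simp: c_def\<close>)
  moreover have "\<not> mv k ` (U \<union> Henkin_axioms p) \<turnstile> bot_fm"
  proof
    assume "mv k ` (U \<union> Henkin_axioms p) \<turnstile> bot_fm"
    moreover have "mv k ` (U \<union> Henkin_axioms p) =
        insert (Ex1 (k (Bd 0)) (Eq (Var (k (Bd 0))) (Var (k c))))
          (insert (Or1 (Dneg (Ex1 (k x) (mv k \<phi>))) (subst1 (mv k \<phi>) (Var (k c)) (k x))) (mv k ` U))"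
      by (auto simp: px Henkin_axioms_def named_def c_def[symmetric] mv_subst1[OF inj])
    ultimately have "mv k ` U \<turnstile> bot_fm"
    proof (rule_tac Henkin_step[OF inf, of "k (Bd 0)" "k c" "k x" "mv k \<phi>"])
      show "k c \<notin> fvs (mv k ` U)"
      proof
        assume "k c \<in> fvs (mv k ` U)"
        then obtain y where "y \<in> vset U" "k c = k y" using fv_mv_subset by (fastforce simp: fvs_def)
        then show False using k(2) cU by (auto simp: inj_on_def)
      qed
      show "k c \<notin> vars (mv k \<phi>)" "k (Bd 0) \<noteq> k c" using k(2) cx by (auto simp: inj_on_def)
    qed simp
    then show False using k(1) by (simp add: realizes_def)
  qed
  ultimately have "realizes k (T \<union> (\<Union>q\<in>A. Henkin_axioms q))" unfolding eq realizes_def by blast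
  then show ?case by blast
qed

lemma finitely_realizable_Henkin:
  fixes T :: "('f, 'r) efm set"
  assumes inf: "infinite (UNIV :: 'v set)" and con: "finitely_realizable TYPE('v) T" and T: "\<And>y. y \<in> vset T \<Longrightarrow> \<not> is_Nm y"
  shows "finitely_realizable TYPE('v) (T \<union> (\<Union>p. Henkin_axioms p))"
  unfolding finitely_realizable_def
proof (intro allI impI)
  fix S
  assume S: "finite S" "S \<subseteq> T \<union> (\<Union>p. Henkin_axioms p)"
  have "\<exists>A. finite A \<and> S - T \<subseteq> (\<Union>p\<in>A. Henkin_axioms p)"
    using finite_subset_Union[of "S - T" "range Henkin_axioms"] S
    by (metis (no_types, lifting) Diff_subset_conv finite_Diff finite_subset_image sup_commute)
  then obtain A where A: "finite A" "S - T \<subseteq> (\<Union>p\<in>A. Henkin_axioms p)" by blast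
  have "\<exists>h :: ('f, 'r) hvar \<Rightarrow> 'v. realizes h (S \<inter> T)"
    using con S(1) by (simp add: finitely_realizable_def)
  then obtain h :: "('f, 'r) hvar \<Rightarrow> 'v" where h: "realizes h (S \<inter> T \<union> (\<Union>p\<in>A. Henkin_axioms p))"
    using realizes_Henkin[OF inf, of "S \<inter> T" A] S(1) T A(1) by blast
  have sub: "S \<subseteq> S \<inter> T \<union> (\<Union>p\<in>A. Henkin_axioms p)" using A(2) by auto
  have "inj_on h (vset S)" using h unfolding realizes_def by (rule_tac inj_on_subset[of h]) (use sub in auto)
  moreover have "\<not> mv h ` S \<turnstile> bot_fm"
  proof
    assume "mv h ` S \<turnstile> bot_fm"
    then have "mv h ` (S \<inter> T \<union> (\<Union>p\<in>A. Henkin_axioms p)) \<turnstile> bot_fm" by (rule Weaken) (use sub in auto)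
    then show False using h by (simp add: realizes_def)
  qed
  ultimately show "\<exists>h :: ('f, 'r) hvar \<Rightarrow> 'v. realizes h S" by (auto simp: realizes_def)
qed

text \<open>Closure is stated for every injective copy over the original variables, which is the form in which
  the derived rules apply.\<close>

locale Henkin_set =
  fixes S :: "('f, 'r) efm set" and TV :: "'v itself"
  assumes infinite_vars: "infinite (UNIV :: 'v set)" and infinite_fsyms: "infinite (UNIV :: 'f set)"
    and closed: "finite S0 \<Longrightarrow> S0 \<subseteq> S \<Longrightarrow>
      (\<And>h :: ('f, 'r) hvar \<Rightarrow> 'v. inj_on h (vset (insert \<psi> S0)) \<Longrightarrow> mv h ` S0 \<turnstile> mv h \<psi>) \<Longrightarrow> \<psi> \<in> S"
    and consistent: "\<psi> \<in> S \<Longrightarrow> Dneg \<psi> \<notin> S"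
    and complete: "\<psi> \<in> S \<or> Dneg \<psi> \<in> S"
    and Henkin: "Henkin_axioms p \<subseteq> S"

text \<open>Zorn's lemma; having consistent copies is a property of finite character.\<close>

lemma Henkin_set_exists:
  fixes T :: "('f, 'r) efm set"
  assumes inf: "infinite (UNIV :: 'v set)" "infinite (UNIV :: 'f set)"
    and con: "finitely_realizable TYPE('v) T" and T: "\<And>y. y \<in> vset T \<Longrightarrow> \<not> is_Nm y"
  obtains S where "T \<subseteq> S" "Henkin_set TYPE('v) S"
proof -
  let ?T = "T \<union> (\<Union>p. Henkin_axioms p)"
  let ?A = "{S. ?T \<subseteq> S \<and> finitely_realizable TYPE('v) S}"
  have "\<exists>S\<in>?A. \<forall>S'\<in>?A. S \<subseteq> S' \<longrightarrow> S' = S"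
  proof (rule subset_Zorn_nonempty)
    show "?A \<noteq> {}" using finitely_realizable_Henkin[OF inf(1) con T] by blast
    fix \<C>
    assume C: "\<C> \<noteq> {}" "subset.chain ?A \<C>"
    have "finitely_realizable TYPE('v) (\<Union>\<C>)"
      unfolding finitely_realizable_def
    proof (intro allI impI)
      fix S0
      assume "finite S0" "S0 \<subseteq> \<Union>\<C>"
      then obtain S where "S \<in> \<C>" "S0 \<subseteq> S"
        using C by (metis (no_types, lifting) finite_subset_Union_chain)
      then show "\<exists>h :: ('f, 'r) hvar \<Rightarrow> 'v. realizes h S0"
        using C(2) \<open>finite S0\<close> by (auto simp: subset.chain_def finitely_realizable_def)
    qed
    moreover obtain S where S: "S \<in> \<C>" using C(1) by blast
    moreover have "?T \<subseteq> S" using C(2) S unfolding subset.chain_def by blast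
    ultimately show "\<Union>\<C> \<in> ?A" by blast
  qed
  then obtain S where SA: "S \<in> ?A" and greatest: "\<forall>S'\<in>?A. S \<subseteq> S' \<longrightarrow> S' = S" by blast
  then have S: "?T \<subseteq> S" "finitely_realizable TYPE('v) S" by auto
  have max: "S' = S" if "finitely_realizable TYPE('v) S'" "S \<subseteq> S'" for S'
    using that S(1) greatest by blast
  have refuted: "\<exists>S2. finite S2 \<and> S2 \<subseteq> S \<and> (\<forall>h :: ('f, 'r) hvar \<Rightarrow> 'v. inj_on h (vset (insert \<psi> S2)) \<longrightarrow>
      insert (mv h \<psi>) (mv h ` S2) \<turnstile> bot_fm)" if \<psi>: "\<psi> \<notin> S" for \<psi>
  proof -
    have "\<not> finitely_realizable TYPE('v) (insert \<psi> S)" using max[of "insert \<psi> S"] \<psi> by auto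
    then obtain S1 where S1: "finite S1" "S1 \<subseteq> insert \<psi> S" "\<And>h :: ('f, 'r) hvar \<Rightarrow> 'v. \<not> realizes h S1"
      by (auto simp: finitely_realizable_def)
    have "insert (mv h \<psi>) (mv h ` (S1 - {\<psi>})) \<turnstile> bot_fm"
      if "inj_on h (vset (insert \<psi> (S1 - {\<psi>})))" for h :: "('f, 'r) hvar \<Rightarrow> 'v"
    proof -
      have "inj_on h (vset S1)" using that by (rule inj_on_subset) auto
      then have "mv h ` S1 \<turnstile> bot_fm" using S1(3)[of h] by (simp add: realizes_def)
      then show ?thesis by (rule Weaken) auto
    qed
    then show ?thesis using S1 by (intro exI[of _ "S1 - {\<psi>}"]) auto
  qed
  have closed: "\<psi> \<in> S" if S0: "finite S0" "S0 \<subseteq> S"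
    and d: "\<And>h :: ('f, 'r) hvar \<Rightarrow> 'v. inj_on h (vset (insert \<psi> S0)) \<Longrightarrow> mv h ` S0 \<turnstile> mv h \<psi>" for S0 \<psi>
  proof (rule ccontr)
    assume "\<psi> \<notin> S"
    from refuted[OF this] obtain S2 where S2: "finite S2" "S2 \<subseteq> S"
      "\<And>h :: ('f, 'r) hvar \<Rightarrow> 'v. inj_on h (vset (insert \<psi> S2)) \<Longrightarrow> insert (mv h \<psi>) (mv h ` S2) \<turnstile> bot_fm"
      by blast
    have fin: "finite (S0 \<union> S2)" using S0 S2 by simp
    have "\<exists>h :: ('f, 'r) hvar \<Rightarrow> 'v. realizes h (S0 \<union> S2)"
      using S(2) S0(2) S2(2) fin by (simp add: finitely_realizable_def)
    then obtain h :: "('f, 'r) hvar \<Rightarrow> 'v" where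
      h: "realizes h (S0 \<union> S2)" "inj_on h (vset (S0 \<union> S2) \<union> vars \<psi>)"
      using realizes_extend[OF _ fin, of _ "vars \<psi>"] inf(1) by auto
    have "mv h ` S0 \<turnstile> mv h \<psi>" by (rule d, rule inj_on_subset[OF h(2)]) auto
    then have "mv h ` (S0 \<union> S2) \<turnstile> mv h \<psi>" by (rule Weaken) auto
    moreover have "insert (mv h \<psi>) (mv h ` S2) \<turnstile> bot_fm"
      by (rule S2(3), rule inj_on_subset[OF h(2)]) auto
    then have "insert (mv h \<psi>) (mv h ` (S0 \<union> S2)) \<turnstile> bot_fm" by (rule Weaken) auto
    ultimately have "mv h ` (S0 \<union> S2) \<turnstile> bot_fm" by (rule cut)
    then show False using h(1) by (simp add: realizes_def)
  qed
  have "Henkin_set TYPE('v) S"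
  proof
    show "Dneg \<psi> \<notin> S" if "\<psi> \<in> S" for \<psi>
    proof
      assume "Dneg \<psi> \<in> S"
      then have "\<exists>h :: ('f, 'r) hvar \<Rightarrow> 'v. realizes h {\<psi>, Dneg \<psi>}"
        using S(2) \<open>\<psi> \<in> S\<close> by (simp add: finitely_realizable_def)
      then obtain h :: "('f, 'r) hvar \<Rightarrow> 'v" where "realizes h {\<psi>, Dneg \<psi>}" by blast
      moreover have "{mv h \<psi>, Dneg (mv h \<psi>)} \<turnstile> bot_fm"
        by (rule NegE[of _ "mv h \<psi>"]) (auto intro: Assm)
      ultimately show False by (simp add: realizes_def)
    qed
    show "\<psi> \<in> S \<or> Dneg \<psi> \<in> S" for \<psi>
    proof (rule disjCI)
      assume "Dneg \<psi> \<notin> S"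
      show "\<psi> \<in> S"
      proof (rule ccontr)
        assume "\<psi> \<notin> S"
        from refuted[OF this] obtain S2 where S2: "finite S2" "S2 \<subseteq> S"
          "\<And>h :: ('f, 'r) hvar \<Rightarrow> 'v. inj_on h (vset (insert \<psi> S2)) \<Longrightarrow> insert (mv h \<psi>) (mv h ` S2) \<turnstile> bot_fm"
          by blast
        have "Dneg \<psi> \<in> S"
        proof (rule closed[OF S2(1,2)])
          fix h :: "('f, 'r) hvar \<Rightarrow> 'v"
          assume "inj_on h (vset (insert (Dneg \<psi>) S2))"
          then show "mv h ` S2 \<turnstile> mv h (Dneg \<psi>)" using S2(3)[of h] by (simp add: NegI)
        qed
        then show False using \<open>Dneg \<psi> \<notin> S\<close> by simp
      qed
    qed
    show "Henkin_axioms p \<subseteq> S" for p using S(1) by auto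
  qed (fact inf closed)+
  then show thesis using that S(1) by blast
qed

section \<open>The canonical model\<close>

lemma mv_Inc_zip: "mv h (Inc (zip xs ys)) = Inc (zip (map h xs) (map h ys))"
  by (simp add: zip_map_map map_prod_def)

lemma mv_Eqs:
  assumes "(\<lambda>(t, u). Eq (f t) (f u)) ` set (zip ts us) \<subseteq> E" "length ts = length us" "i < length us"
  shows "mv h ` E \<turnstile> mv h (Eq (f (ts ! i)) (f (us ! i)))"
proof (rule Assm, rule imageI)
  have "(ts ! i, us ! i) \<in> set (zip ts us)"
    using assms(2,3) by (metis length_zip min.idem nth_mem nth_zip)
  then show "Eq (f (ts ! i)) (f (us ! i)) \<in> E" using assms(1) by force
qed

context Henkin_set
begin

lemma closed1:
  assumes "A \<in> S" "\<And>h :: ('f, 'r) hvar \<Rightarrow> 'v. inj_on h (vars \<psi> \<union> vars A) \<Longrightarrow> {mv h A} \<turnstile> mv h \<psi>"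
  shows "\<psi> \<in> S"
  using closed[of "{A}" \<psi>] assms by simp

lemma closed2:
  assumes "A \<in> S" "B \<in> S"
    "\<And>h :: ('f, 'r) hvar \<Rightarrow> 'v. inj_on h (vars \<psi> \<union> (vars A \<union> vars B)) \<Longrightarrow> {mv h A, mv h B} \<turnstile> mv h \<psi>"
  shows "\<psi> \<in> S"
  using closed[of "{A, B}" \<psi>] assms by simp

lemma Dneg_S: "Dneg \<phi> \<in> S \<longleftrightarrow> \<phi> \<notin> S"
  using consistent complete by blast

lemma And_S: "And \<phi> \<psi> \<in> S \<longleftrightarrow> \<phi> \<in> S \<and> \<psi> \<in> S"
proof (intro iffI conjI)
  assume A: "And \<phi> \<psi> \<in> S"
  show "\<phi> \<in> S" by (rule closed1[OF A]) (auto intro: AndE1 Assm)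
  show "\<psi> \<in> S" by (rule closed1[OF A]) (auto intro: AndE2 Assm)
next
  assume "\<phi> \<in> S \<and> \<psi> \<in> S"
  then have A: "\<phi> \<in> S" "\<psi> \<in> S" by auto
  show "And \<phi> \<psi> \<in> S" by (rule closed2[OF A]) (auto intro: AndI Assm)
qed

lemma Or1_S: "Or1 \<phi> \<psi> \<in> S \<longleftrightarrow> \<phi> \<in> S \<or> \<psi> \<in> S"
proof
  assume A: "Or1 \<phi> \<psi> \<in> S"
  show "\<phi> \<in> S \<or> \<psi> \<in> S"
  proof (rule disjCI)
    assume "\<psi> \<notin> S"
    then have B: "Dneg \<psi> \<in> S" by (simp add: Dneg_S)
    show "\<phi> \<in> S"
    proof (rule closed2[OF A B])
      fix h :: "('f, 'r) hvar \<Rightarrow> 'v"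
      let ?G = "{mv h (Or1 \<phi> \<psi>), mv h (Dneg \<psi>)}"
      show "?G \<turnstile> mv h \<phi>"
      proof (rule OrE)
        show "?G \<turnstile> Or1 (mv h \<phi>) (mv h \<psi>)" "insert (mv h \<phi>) ?G \<turnstile> mv h \<phi>" by (auto intro: Assm)
        show "insert (mv h \<psi>) ?G \<turnstile> mv h \<phi>" by (rule NegE[of _ "mv h \<psi>"]) (auto intro: Assm)
      qed
    qed
  qed
next
  assume "\<phi> \<in> S \<or> \<psi> \<in> S"
  then show "Or1 \<phi> \<psi> \<in> S"
  proof
    assume A: "\<phi> \<in> S"
    show ?thesis by (rule closed1[OF A]) (auto intro: OrI1 Assm)
  next
    assume A: "\<psi> \<in> S"
    show ?thesis by (rule closed1[OF A]) (auto intro: OrI2 Assm)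
  qed
qed

lemma named_S: "is_Nm c \<Longrightarrow> named c \<in> S"
  using Henkin by (cases c) (auto simp: Henkin_axioms_def)

lemma witness_S: "Ex1 x \<phi> \<in> S \<Longrightarrow> subst1 \<phi> (Var (Nm x \<phi>)) x \<in> S"
  using Henkin[of "(x, \<phi>)"] consistent by (auto simp: Henkin_axioms_def Or1_S)

lemma ex_witness_S: "Ex1 x \<phi> \<in> S \<Longrightarrow> \<exists>d. is_Nm d \<and> subst1 \<phi> (Var d) x \<in> S"
  using witness_S by (intro exI[of _ "Nm x \<phi>"]) auto

text \<open>A copy of the assumption \<open>named c\<close> is a constancy atom up to its bound variable.\<close>

lemma mv_named_cst:
  fixes h :: "('f, 'r) hvar \<Rightarrow> 'v"
  assumes "mv h (named c) \<in> \<Gamma>" "inj_on h B" "vars (named c) \<subseteq> B" "is_Nm c"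
  shows "\<Gamma> \<turnstile> cst [Var (h c)]"
proof -
  have "h (Bd 0) \<noteq> h c" using assms(2-4) by (cases c) (auto simp: vars_named inj_on_def)
  moreover have "\<Gamma> \<turnstile> Ex1 (h (Bd 0)) (Eq (Var (h (Bd 0))) (Var (h c)))"
    using assms(1) by (auto simp: named_def intro: Assm)
  ultimately show ?thesis by (simp add: Ex_eq_iff[OF infinite_vars])
qed

lemma Ex1_S:
  assumes "bv \<phi> \<subseteq> range Bd"
  shows "Ex1 x \<phi> \<in> S \<longleftrightarrow> (\<exists>d. is_Nm d \<and> subst1 \<phi> (Var d) x \<in> S)"
proof
  assume "Ex1 x \<phi> \<in> S"
  then show "\<exists>d. is_Nm d \<and> subst1 \<phi> (Var d) x \<in> S" by (rule ex_witness_S)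
next
  assume "\<exists>d. is_Nm d \<and> subst1 \<phi> (Var d) x \<in> S"
  then obtain d where d: "is_Nm d" "subst1 \<phi> (Var d) x \<in> S" by blast
  show "Ex1 x \<phi> \<in> S"
  proof (rule closed2[OF d(2) named_S[OF d(1)]])
    fix h :: "('f, 'r) hvar \<Rightarrow> 'v"
    assume inj: "inj_on h (vars (Ex1 x \<phi>) \<union> (vars (subst1 \<phi> (Var d) x) \<union> vars (named d)))"
    let ?G = "{mv h (subst1 \<phi> (Var d) x), mv h (named d)}"
    have eq: "mv h (subst1 \<phi> (Var d) x) = subst1 (mv h \<phi>) (Var (h d)) (h x)"
      by (rule mv_subst1, rule inj_on_subset[OF inj]) auto
    have "?G \<turnstile> Ex1 (h x) (mv h \<phi>)"
    proof (rule ExI)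
      show "?G \<turnstile> subst1 (mv h \<phi>) (Var (h d)) (h x)" unfolding eq by (rule Assm) simp
      have "d \<notin> bv \<phi>" using assms d(1) by auto
      moreover have "inj_on h (insert d (bv \<phi>))"
        by (rule inj_on_subset[OF inj]) (auto simp: vars_named vars_eq[of \<phi>])
      ultimately have "h d \<notin> bv (mv h \<phi>)" by (auto simp: inj_on_def)
      then show "free_for (Var (h d)) (h x) (mv h \<phi>)" by (rule free_for_ren)
      show "?G \<turnstile> cst [Var (h d)]" by (rule mv_named_cst[OF _ inj _ d(1)]) auto
    qed
    then show "?G \<turnstile> mv h (Ex1 x \<phi>)" by simp
  qed
qed

lemma All1_S:
  assumes "bv \<phi> \<subseteq> range Bd"
  shows "All1 x \<phi> \<in> S \<longleftrightarrow> (\<forall>d. is_Nm d \<longrightarrow> subst1 \<phi> (Var d) x \<in> S)"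
proof (intro iffI allI impI)
  fix d :: "('f, 'r) hvar"
  assume A: "All1 x \<phi> \<in> S" and d: "is_Nm d"
  show "subst1 \<phi> (Var d) x \<in> S"
  proof (rule closed2[OF A named_S[OF d]])
    fix h :: "('f, 'r) hvar \<Rightarrow> 'v"
    assume inj: "inj_on h (vars (subst1 \<phi> (Var d) x) \<union> (vars (All1 x \<phi>) \<union> vars (named d)))"
    let ?G = "{mv h (All1 x \<phi>), mv h (named d)}"
    have eq: "mv h (subst1 \<phi> (Var d) x) = subst1 (mv h \<phi>) (Var (h d)) (h x)"
      by (rule mv_subst1, rule inj_on_subset[OF inj]) auto
    show "?G \<turnstile> mv h (subst1 \<phi> (Var d) x)"
      unfolding eq
    proof (rule AllE)
      show "?G \<turnstile> All1 (h x) (mv h \<phi>)" by (rule Assm) simp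
      have "d \<notin> bv \<phi>" using assms d by auto
      moreover have "inj_on h (insert d (bv \<phi>))"
        by (rule inj_on_subset[OF inj]) (auto simp: vars_named vars_eq[of \<phi>])
      ultimately have "h d \<notin> bv (mv h \<phi>)" by (auto simp: inj_on_def)
      then show "free_for (Var (h d)) (h x) (mv h \<phi>)" by (rule free_for_ren)
      show "?G \<turnstile> cst [Var (h d)]" by (rule mv_named_cst[OF _ inj _ d]) auto
    qed
  qed
next
  assume all: "\<forall>d. is_Nm d \<longrightarrow> subst1 \<phi> (Var d) x \<in> S"
  show "All1 x \<phi> \<in> S"
  proof (rule ccontr)
    assume "All1 x \<phi> \<notin> S"
    then have A: "Dneg (All1 x \<phi>) \<in> S" by (simp add: Dneg_S)
    have "Ex1 x (Dneg \<phi>) \<in> S"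
      by (rule closed1[OF A]) (simp add: not_All[OF infinite_vars])
    then obtain d where "is_Nm d" "subst1 (Dneg \<phi>) (Var d) x \<in> S"
      using Ex1_S[of "Dneg \<phi>"] assms by auto
    then show False using all by (simp add: subst1_def Dneg_S)
  qed
qed

lemma Eq_refl_S: "Eq t t \<in> S"
  using closed[of "{}" "Eq t t"] by (simp add: EqI)

lemma Eq_sym_S:
  assumes "Eq t u \<in> S"
  shows "Eq u t \<in> S"
  by (rule closed1[OF assms]) (auto intro: Eq_sym[OF infinite_vars] Assm)

lemma Eq_trans_S:
  assumes "Eq t u \<in> S" "Eq u w \<in> S"
  shows "Eq t w \<in> S"
  by (rule closed2[OF assms]) (auto intro: Eq_trans[OF infinite_vars, where u = "map_tm (\<lambda>x. x) _ u"] Assm)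

lemma Fn_cong_S:
  assumes "list_all2 (\<lambda>t u. Eq t u \<in> S) ts us"
  shows "Eq (Fn f ts) (Fn f us) \<in> S"
proof (rule closed)
  let ?E = "(\<lambda>(t, u). Eq t u) ` set (zip ts us) :: ('f, 'r) efm set"
  show "finite ?E" by simp
  show "?E \<subseteq> S" using assms by (auto simp: list_all2_iff)
  fix h :: "('f, 'r) hvar \<Rightarrow> 'v"
  have "list_all2 (\<lambda>t u. mv h ` ?E \<turnstile> Eq t u) (map (map_tm (\<lambda>x. x) h) ts) (map (map_tm (\<lambda>x. x) h) us)"
    using list_all2_lengthD[OF assms] mv_Eqs[of "\<lambda>t. t" ts us ?E _ h]
    by (simp add: list_all2_conv_all_nth)
  then show "mv h ` ?E \<turnstile> mv h (Eq (Fn f ts) (Fn f us))"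
    by (simp add: Fn_cong[OF infinite_vars])
qed

lemma Rel_cong_S:
  assumes "list_all2 (\<lambda>t u. Eq t u \<in> S) ts us" "Rel R ts \<in> S"
  shows "Rel R us \<in> S"
proof (rule closed)
  let ?E = "insert (Rel R ts) ((\<lambda>(t, u). Eq t u) ` set (zip ts us)) :: ('f, 'r) efm set"
  show "finite ?E" by simp
  show "?E \<subseteq> S" using assms by (auto simp: list_all2_iff)
  fix h :: "('f, 'r) hvar \<Rightarrow> 'v"
  have "list_all2 (\<lambda>t u. mv h ` ?E \<turnstile> Eq t u) (map (map_tm (\<lambda>x. x) h) ts) (map (map_tm (\<lambda>x. x) h) us)"
    using list_all2_lengthD[OF assms(1)] mv_Eqs[of "\<lambda>t. t" ts us ?E _ h]
    by (simp add: list_all2_conv_all_nth subset_insertI)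
  moreover have "mv h ` ?E \<turnstile> Rel R (map (map_tm (\<lambda>x. x) h) ts)" by (rule Assm) simp
  ultimately have "mv h ` ?E \<turnstile> Rel R (map (map_tm (\<lambda>x. x) h) us)" by (rule Rel_cong[OF infinite_vars])
  then show "mv h ` ?E \<turnstile> mv h (Rel R us)" by simp
qed

text \<open>The term has a constant value, so the formula saying that this value exists has a Henkin witness.\<close>

lemma term_named:
  assumes "\<And>x. x \<in> vars_tm t \<Longrightarrow> is_Nm x"
  shows "\<exists>d. is_Nm d \<and> Eq (Var d) t \<in> S"
proof -
  have Bd: "Bd 0 \<notin> vars_tm t" using assms[of "Bd 0"] by auto
  have "Ex1 (Bd 0) (Eq (Var (Bd 0)) t) \<in> S"
  proof (rule closed)
    let ?E = "named ` vars_tm t"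
    show "finite ?E" "?E \<subseteq> S" using assms named_S by auto
    fix h :: "('f, 'r) hvar \<Rightarrow> 'v"
    assume inj: "inj_on h (vset (insert (Ex1 (Bd 0) (Eq (Var (Bd 0)) t)) ?E))"
    have "mv h ` ?E \<turnstile> cst [map_tm (\<lambda>x. x) h t]"
    proof (rule cst_term[OF infinite_vars])
      fix y
      assume "y \<in> vars_tm (map_tm (\<lambda>x. x) h t)"
      then obtain x where x: "x \<in> vars_tm t" "y = h x" by (auto simp: tm.set_map)
      show "mv h ` ?E \<turnstile> cst [Var y]"
        unfolding x(2) by (rule mv_named_cst[OF _ inj _ assms[OF x(1)]]) (use x(1) in auto)
    qed
    moreover have "h (Bd 0) \<notin> vars_tm (map_tm (\<lambda>x. x) h t)"
      using inj Bd by (auto simp: tm.set_map inj_on_def)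
    ultimately show "mv h ` ?E \<turnstile> mv h (Ex1 (Bd 0) (Eq (Var (Bd 0)) t))"
      by (simp add: Ex_eq_iff[OF infinite_vars])
  qed
  from ex_witness_S[OF this] show ?thesis using Bd by (simp add: subst1_def subst_tm_fresh)
qed

lemma Inc_refl_S: "Inc (zip xs xs) \<in> S"
  using closed[of "{}" "Inc (zip xs xs)"] by (simp add: mv_Inc_zip IncRefl del: fm.map)

lemma Inc_trans_S:
  assumes "Inc (zip xs ys) \<in> S" "Inc (zip ys zs) \<in> S" "length xs = length ys" "length ys = length zs"
  shows "Inc (zip xs zs) \<in> S"
proof (rule closed2[OF assms(1,2)])
  fix h :: "('f, 'r) hvar \<Rightarrow> 'v"
  show "{mv h (Inc (zip xs ys)), mv h (Inc (zip ys zs))} \<turnstile> mv h (Inc (zip xs zs))"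
    unfolding mv_Inc_zip by (rule IncTrans[of _ _ "map h ys"]) (use assms in \<open>auto intro: Assm\<close>)
qed

lemma Inc_subset_S:
  assumes "Inc ps \<in> S" "set qs \<subseteq> set ps"
  shows "Inc qs \<in> S"
proof (rule closed1[OF assms(1)])
  fix h :: "('f, 'r) hvar \<Rightarrow> 'v"
  have "\<forall>q\<in>set qs. \<exists>i<length ps. ps ! i = q" using assms(2) by (metis in_set_conv_nth subsetD)
  then obtain f where f: "\<And>q. q \<in> set qs \<Longrightarrow> f q < length ps \<and> ps ! f q = q" by metis
  let ?g = "map (map_prod h h)"
  have eq: "map ((!) (?g ps)) (map f qs) = ?g qs" using f by auto
  have "{Inc (?g ps)} \<turnstile> Inc (map ((!) (?g ps)) (map f qs))"
    by (rule IncProj) (use f in \<open>auto intro: Assm\<close>)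
  then show "{mv h (Inc ps)} \<turnstile> mv h (Inc qs)" unfolding eq by simp
qed

text \<open>\<open>IncCst\<close>: a variable with a constant value can be added to both sides.\<close>

lemma Inc_cst_S:
  assumes "is_Nm c" "Inc ps \<in> S"
  shows "Inc ((c, c) # ps) \<in> S"
proof (rule closed2[OF assms(2) named_S[OF assms(1)]])
  fix h :: "('f, 'r) hvar \<Rightarrow> 'v"
  assume inj: "inj_on h (vars (Inc ((c, c) # ps)) \<union> (vars (Inc ps) \<union> vars (named c)))"
  let ?G = "{mv h (Inc ps), mv h (named c)}"
  have "?G \<turnstile> cst [Var (h c)]" by (rule mv_named_cst[OF _ inj _ assms(1)]) auto
  then have "?G \<turnstile> cst (vs_tms [h c])" by simp
  moreover have "?G \<turnstile> Inc (map (map_prod h h) ps)" by (rule Assm) simp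
  ultimately have "?G \<turnstile> Inc (zip [h c] [h c] @ map (map_prod h h) ps)" by (rule IncCst)
  then show "?G \<turnstile> mv h (Inc ((c, c) # ps))" by simp
qed

text \<open>\<open>IncExt\<close> adds a column for \<open>w\<close>, and the new entry has a Henkin witness.\<close>

lemma Inc_ext_S:
  assumes "Inc (zip cs ys) \<in> S" "length cs = length ys" "\<And>c. c \<in> set cs \<Longrightarrow> is_Nm c"
    and "Bd 0 \<notin> insert w (set ys)"
  shows "\<exists>d. is_Nm d \<and> Inc ((d, w) # zip cs ys) \<in> S"
proof -
  let ?b = "Bd 0 :: ('f, 'r) hvar"
  have b: "?b \<notin> insert w (set ys \<union> set cs)" using assms(3)[of ?b] assms(4) by auto
  have "Ex1 ?b (Inc ((?b, w) # zip cs ys)) \<in> S"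
  proof (rule closed)
    let ?E = "insert (Inc (zip cs ys)) (named ` set cs)"
    show "finite ?E" "?E \<subseteq> S" using assms named_S by auto
    fix h :: "('f, 'r) hvar \<Rightarrow> 'v"
    assume inj: "inj_on h (vset (insert (Ex1 ?b (Inc ((?b, w) # zip cs ys))) ?E))"
    let ?G = "mv h ` ?E"
    have vs: "vset (insert (Ex1 ?b (Inc ((?b, w) # zip cs ys))) ?E) \<supseteq> insert ?b (insert w (set ys \<union> set cs))"
    proof -
      have "set cs = fst ` set (zip cs ys)" "set ys = snd ` set (zip cs ys)"
        using assms(2) by (metis map_fst_zip set_map, metis map_snd_zip set_map)
      then show ?thesis by (auto simp: vars_eq)
    qed
    have "?G \<turnstile> exs [h ?b] (Inc (zip [h ?b] [h w] @ zip (map h cs) (map h ys)))"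
    proof (rule IncExt)
      show "?G \<turnstile> cst (vs_tms (map h cs))"
      proof (rule cst_list[OF infinite_vars])
        fix t :: "('f, 'v) tm"
        assume "t \<in> set (vs_tms (map h cs))"
        then obtain c where c: "c \<in> set cs" "t = Var (h c)" by auto
        show "?G \<turnstile> cst [t]"
          unfolding c(2) by (rule mv_named_cst[OF _ inj _ assms(3)[OF c(1)]]) (use c(1) in auto)
      qed
      show "?G \<turnstile> Inc (zip (map h cs) (map h ys))" by (rule Assm) (simp add: mv_Inc_zip del: fm.map)
      show "set [h ?b] \<inter> (set (map h cs) \<union> set (map h ys) \<union> set [h w]) = {}"
        using inj_on_subset[OF inj vs] b by (auto simp: inj_on_def)
    qed (use assms(2) in auto)
    then show "?G \<turnstile> mv h (Ex1 ?b (Inc ((?b, w) # zip cs ys)))" by (simp add: zip_map_map map_prod_def)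
  qed
  from ex_witness_S[OF this] obtain d where
    d: "is_Nm d" "subst1 (Inc ((?b, w) # zip cs ys)) (Var d) ?b \<in> S" by blast
  have "subst1 (Inc ((?b, w) # zip cs ys)) (Var d) ?b = (Inc ((d, w) # zip cs ys) :: ('f, 'r) efm)"
    unfolding subst1_Var subst_ren_Inc using b
    by (auto intro!: map_idI dest: set_zip_leftD set_zip_rightD)
  then show ?thesis using d by auto
qed

lemma Inc_diagonal_S:
  assumes "Inc [(c, x), (d, x)] \<in> S"
  shows "Eq (Var c) (Var d) \<in> S"
  by (rule closed1[OF assms]) (auto intro: Inc_diagonal_Eq[OF infinite_vars] Assm)

lemma Inc_replace_S:
  assumes "list_all2 (\<lambda>c d. Eq (Var c) (Var d) \<in> S) cs ds" "length ys = length cs" "Inc (zip cs ys) \<in> S"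
  shows "Inc (zip ds ys) \<in> S"
proof (rule closed)
  let ?E = "insert (Inc (zip cs ys)) ((\<lambda>(c, d). Eq (Var c) (Var d)) ` set (zip cs ds)) :: ('f, 'r) efm set"
  show "finite ?E" by simp
  show "?E \<subseteq> S" using assms by (auto simp: list_all2_iff)
  fix h :: "('f, 'r) hvar \<Rightarrow> 'v"
  have "list_all2 (\<lambda>c d. mv h ` ?E \<turnstile> Eq (Var c) (Var d)) (map h cs) (map h ds)"
    using list_all2_lengthD[OF assms(1)] mv_Eqs[of Var cs ds ?E _ h]
    by (simp add: list_all2_conv_all_nth subset_insertI)
  moreover have "mv h ` ?E \<turnstile> Inc (zip (map h cs) (map h ys))"
    by (rule Assm) (simp add: mv_Inc_zip del: fm.map)
  ultimately have "mv h ` ?E \<turnstile> Inc (zip (map h ds) (map h ys))"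
    using assms(2) by (rule_tac Inc_replace_Eq[OF infinite_vars]) auto
  then show "mv h ` ?E \<turnstile> mv h (Inc (zip ds ys))" by (simp only: mv_Inc_zip)
qed

lemma mv_replace:
  fixes h :: "('f, 'r) hvar \<Rightarrow> 'v" and l :: "('f, 'r) efm"
  assumes "inj_on h (vars l \<union> set xs)" "fv l \<subseteq> set xs" "distinct xs" "length ws = length xs"
  shows "mv h (subst (ren (replace xs ws)) l) = subst (ren (replace (map h xs) (map h ws))) (mv h l)"
proof (rule mv_ren)
  show "inj_on h (vars l)" using assms(1) by (rule inj_on_subset) auto
  fix y
  assume "y \<in> fv l"
  then obtain i where i: "i < length xs" "y = xs ! i" using assms(2) by (metis in_set_conv_nth subsetD)
  have "distinct (map h xs)" using assms(1,3) by (auto simp: distinct_map intro: inj_on_subset)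
  then have "replace (map h xs) (map h ws) (map h xs ! i) = map h ws ! i"
    using i assms(4) by (intro replace_nth) auto
  then show "replace (map h xs) (map h ws) (h y) = h (replace xs ws y)"
    using i assms(3,4) by (simp add: replace_nth)
qed

lemma vars_Inc_zip: "length xs = length ys \<Longrightarrow> vars (Inc (zip xs ys)) = set xs \<union> set ys"
  unfolding vars_eq by (simp, metis list.set_map map_fst_zip map_snd_zip)

lemma atom_compress_S:
  assumes "Inc (zip ws xs) \<in> S" "l \<in> S" "is_atom l" "fv l \<subseteq> set xs" "distinct xs" "length ws = length xs"
  shows "subst (ren (replace xs ws)) l \<in> S"
proof (rule closed2[OF assms(1,2)])
  fix h :: "('f, 'r) hvar \<Rightarrow> 'v"
  assume inj: "inj_on h (vars (subst (ren (replace xs ws)) l) \<union> (vars (Inc (zip ws xs)) \<union> vars l))"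
  have inj': "inj_on h (vars l \<union> set xs)" "inj_on h (set xs)"
    by (rule inj_on_subset[OF inj]; use vars_Inc_zip[OF assms(6)] in auto)+
  have l: "fv (mv h l) = h ` fv l" by (rule fv_mv, rule inj_on_subset[OF inj]) auto
  show "{mv h (Inc (zip ws xs)), mv h l} \<turnstile> mv h (subst (ren (replace xs ws)) l)"
    unfolding mv_replace[OF inj'(1) assms(4-6)]
  proof (rule atom_compress[OF infinite_vars])
    show "{mv h (Inc (zip ws xs)), mv h l} \<turnstile> Inc (zip (map h ws) (map h xs))"
      by (rule Assm) (simp add: mv_Inc_zip del: fm.map)
    show "{mv h (Inc (zip ws xs)), mv h l} \<turnstile> mv h l" by (rule Assm) simp
    show "is_atom (mv h l)" using assms(3) by (cases l) auto
    show "fv (mv h l) \<subseteq> set (map h xs)" using l assms(4) by auto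
    show "distinct (map h xs)" using assms(5) inj'(2) by (simp add: distinct_map)
  qed (use assms in auto)
qed

text \<open>Henkin witnesses are substituted one after the other; none of them is among the quantified
  variables.\<close>

lemma exs_witness_S:
  assumes "exs us \<phi> \<in> S" "qfree Var \<phi>" "distinct us" "\<And>u. u \<in> set us \<Longrightarrow> \<not> is_Nm u"
  shows "\<exists>ds. length ds = length us \<and> (\<forall>d\<in>set ds. is_Nm d) \<and> subst (ren (replace us ds)) \<phi> \<in> S"
  using assms
proof (induction us arbitrary: \<phi>)
  case Nil
  have "replace [] ds = (\<lambda>x. x)" for ds :: "('f, 'r) hvar list" by (auto simp: replace_def)
  then show ?case using Nil by simp
next
  case (Cons u us)
  obtain d where d: "is_Nm d" "subst1 (exs us \<phi>) (Var d) u \<in> S"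
    using Cons.prems(1) ex_witness_S by auto
  have q: "qfree (Var(u := Var d)) \<phi>" by (rule qfree_mono[OF Cons.prems(2)]) auto
  have "subst1 (exs us \<phi>) (Var d) u = exs us (subst1 \<phi> (Var d) u)"
    unfolding subst1_def using Cons.prems(3) by (intro subst_exs) auto
  then obtain ds where ds: "length ds = length us" "\<forall>d\<in>set ds. is_Nm d"
    "subst (ren (replace us ds)) (subst1 \<phi> (Var d) u) \<in> S"
    using Cons.IH[of "subst1 \<phi> (Var d) u"] d(2) Cons.prems qfree_subst[OF q, of Var] q
    by (auto simp: subst1_def simp del: fun_upd_apply)
  have "d \<notin> set us" using Cons.prems(4)[of d] d(1) by auto
  then have "(\<lambda>x. subst_tm (ren (replace us ds)) ((Var(u := Var d)) x)) =
      (ren (replace (u # us) (d # ds)) :: _ \<Rightarrow> ('f, ('f, 'r) hvar) tm)"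
    by (auto simp: ren_def fun_eq_iff replace_def split: option.split
        dest!: map_of_SomeD dest: set_zip_leftD)
  then have "subst (ren (replace us ds)) (subst1 \<phi> (Var d) u) = subst (ren (replace (u # us) (d # ds))) \<phi>"
    unfolding subst1_def qfree_comp[OF q] by simp
  then show ?case using ds d(1) by (intro exI[of _ "d # ds"]) auto
qed

text \<open>Both kinds of witness formula are evaluated in the same way: \<open>B us\<close> fails for some values
  \<open>us\<close> of \<open>xs\<close>, and Henkin variables can be taken for \<open>us\<close>.\<close>

lemma refuting_names:
  fixes xs :: "('f, 'r) hvar list"
  defines "us \<equiv> map Bd [0..<length xs]"
  assumes A: "A \<notin> S" and xs: "\<And>x. x \<in> set xs \<Longrightarrow> x \<notin> range Bd" and B: "qfree Var B"
    and derives: "\<And>h :: ('f, 'r) hvar \<Rightarrow> 'v. inj_on h (set us \<union> set xs \<union> vars A) \<Longrightarrow>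
      {Dneg (mv h A)} \<turnstile> exs (map h us) (And (Inc (zip (map h us) (map h xs))) (Dneg (mv h B)))"
  shows "\<exists>cs. length cs = length xs \<and> (\<forall>c\<in>set cs. is_Nm c) \<and> Inc (zip cs xs) \<in> S \<and>
    subst (ren (replace us cs)) B \<notin> S"
proof -
  have us: "length us = length xs" "distinct us" by (auto simp: us_def distinct_map inj_on_def)
  have us_new: "set us \<inter> set xs = {}" using xs by (fastforce simp: us_def)
  let ?\<psi> = "And (Inc (zip us xs)) (Dneg B)"
  have D: "Dneg A \<in> S" using A by (simp add: Dneg_S)
  have "exs us ?\<psi> \<in> S"
  proof (rule closed1[OF D])
    fix h :: "('f, 'r) hvar \<Rightarrow> 'v"
    assume inj: "inj_on h (vars (exs us ?\<psi>) \<union> vars (Dneg A))"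
    have "vars \<chi> \<subseteq> vars (exs us \<chi>)" "set us \<subseteq> vars (exs us \<chi>)" for \<chi> :: "('f, 'r) efm"
      by (induction us) auto
    from this[of ?\<psi>] have inj: "inj_on h (set us \<union> set xs \<union> vars A)"
      using vars_Inc_zip[OF us(1)] by (intro inj_on_subset[OF inj]) auto
    show "{mv h (Dneg A)} \<turnstile> mv h (exs us ?\<psi>)"
      unfolding mv_exs fm.map(4,5) mv_Inc_zip by (rule derives[OF inj])
  qed
  moreover have "\<And>u. u \<in> set us \<Longrightarrow> \<not> is_Nm u" by (auto simp: us_def)
  ultimately have "\<exists>ds. length ds = length us \<and> (\<forall>d\<in>set ds. is_Nm d) \<and>
      subst (ren (replace us ds)) ?\<psi> \<in> S"
    using us(2) B by (rule_tac exs_witness_S) auto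
  then obtain cs where cs: "length cs = length us" "\<forall>c\<in>set cs. is_Nm c"
    "subst (ren (replace us cs)) ?\<psi> \<in> S" by blast
  moreover have "map (replace us cs) us = cs" "map (replace us cs) xs = xs"
    using us us_new cs(1) by auto
  ultimately show ?thesis
    using us by (intro exI[of _ cs]) (simp add: And_S Dneg_S subst_Inc_zip del: subst_ren_Inc)
qed

lemma not_Inc_S:
  fixes xs ys :: "('f, 'r) hvar list"
  assumes "Inc (zip xs ys) \<notin> S" "length xs = length ys" "\<And>x. x \<in> set xs \<union> set ys \<Longrightarrow> x \<notin> range Bd"
  shows "\<exists>cs. length cs = length xs \<and> (\<forall>c\<in>set cs. is_Nm c) \<and> Inc (zip cs xs) \<in> S \<and> Inc (zip cs ys) \<notin> S"
proof -
  define us where "us = (map Bd [0..<length xs] :: ('f, 'r) hvar list)"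
  have us: "length us = length xs" "distinct us" by (auto simp: us_def distinct_map inj_on_def)
  have us_new: "set us \<inter> (set xs \<union> set ys) = {}" using assms(3) by (fastforce simp: us_def)
  have "\<exists>cs. length cs = length xs \<and> (\<forall>c\<in>set cs. is_Nm c) \<and> Inc (zip cs xs) \<in> S \<and>
      subst (ren (replace (map Bd [0..<length xs]) cs)) (Inc (zip us ys)) \<notin> S"
  proof (rule refuting_names[OF assms(1)])
    fix h :: "('f, 'r) hvar \<Rightarrow> 'v"
    assume "inj_on h (set (map Bd [0..<length xs]) \<union> set xs \<union> vars (Inc (zip xs ys)))"
    then have inj: "inj_on h (set us \<union> (set xs \<union> set ys))"
      unfolding vars_Inc_zip[OF assms(2)] us_def by (rule inj_on_subset) auto
    show "{Dneg (mv h (Inc (zip xs ys)))} \<turnstile> exs (map h (map Bd [0..<length xs]))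
        (And (Inc (zip (map h (map Bd [0..<length xs])) (map h xs))) (Dneg (mv h (Inc (zip us ys)))) :: ('f, 'r, 'v) fm)"
      unfolding mv_Inc_zip us_def[symmetric]
    proof (rule not_Inc_witness[OF infinite_vars infinite_fsyms])
      show "distinct (map h us)" using us(2) inj by (auto simp: distinct_map intro: inj_on_subset)
      have "h ` (set us \<inter> (set xs \<union> set ys)) = h ` set us \<inter> h ` (set xs \<union> set ys)"
        by (rule inj_on_image_Int[OF inj]) auto
      then show "set (map h us) \<inter> (set (map h xs) \<union> set (map h ys)) = {}"
        using us_new by (simp add: image_Un)
    qed (use assms(2) us in auto)
  qed (use assms(3) in auto)
  then obtain cs where "length cs = length xs" "\<forall>c\<in>set cs. is_Nm c" "Inc (zip cs xs) \<in> S"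
    "subst (ren (replace us cs)) (Inc (zip us ys)) \<notin> S" unfolding us_def[symmetric] by blast
  moreover from this(1) have "map (replace us cs) us = cs" "map (replace us cs) ys = ys"
    using us us_new by (auto simp: Int_Un_distrib)
  ultimately show ?thesis by (auto simp: subst_Inc_zip simp del: subst_ren_Inc)
qed

lemma not_atom_S:
  fixes xs :: "('f, 'r) hvar list"
  assumes "l \<notin> S" "is_atom l" "fv l \<subseteq> set xs" "distinct xs" "\<And>x. x \<in> set xs \<Longrightarrow> x \<notin> range Bd"
  shows "\<exists>cs. length cs = length xs \<and> (\<forall>c\<in>set cs. is_Nm c) \<and> Inc (zip cs xs) \<in> S \<and>
    subst (ren (replace xs cs)) l \<notin> S"
proof -
  define us where "us = (map Bd [0..<length xs] :: ('f, 'r) hvar list)"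
  have us: "length us = length xs" "distinct us" by (auto simp: us_def distinct_map inj_on_def)
  have us_new: "set us \<inter> set xs = {}" using assms(5) by (fastforce simp: us_def)
  have "\<exists>cs. length cs = length xs \<and> (\<forall>c\<in>set cs. is_Nm c) \<and> Inc (zip cs xs) \<in> S \<and>
      subst (ren (replace (map Bd [0..<length xs]) cs)) (subst (ren (replace xs us)) l) \<notin> S"
  proof (rule refuting_names[OF assms(1,5)])
    show "qfree Var (subst (ren (replace xs us)) l)" using assms(2) by (cases l) auto
    fix h :: "('f, 'r) hvar \<Rightarrow> 'v"
    assume inj: "inj_on h (set (map Bd [0..<length xs]) \<union> set xs \<union> vars l)"
    have inj': "inj_on h (vars l \<union> set xs)" "inj_on h (set xs)" "inj_on h (set us)" "inj_on h (vars l)"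
      by (rule inj_on_subset[OF inj]; auto simp: us_def)+
    show "{Dneg (mv h l)} \<turnstile> exs (map h (map Bd [0..<length xs]))
        (And (Inc (zip (map h (map Bd [0..<length xs])) (map h xs)))
          (Dneg (mv h (subst (ren (replace xs us)) l))))"
      unfolding mv_replace[OF inj'(1) assms(3,4) us(1)] us_def[symmetric]
    proof (rule not_atom_witness[OF infinite_vars infinite_fsyms])
      show "is_atom (mv h l)" using assms(2) by (cases l) auto
      show "fv (mv h l) \<subseteq> set (map h xs)" using fv_mv[OF inj'(4)] assms(3) by auto
      show "distinct (map h xs)" "distinct (map h us)"
        using assms(4) us(2) inj' by (auto simp: distinct_map)
      have "h ` (set us \<inter> set xs) = h ` set us \<inter> h ` set xs"
        by (rule inj_on_image_Int[OF inj]) (auto simp: us_def)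
      then show "set (map h us) \<inter> set (map h xs) = {}" using us_new by simp
    qed (use us in auto)
  qed
  then obtain cs where cs: "length cs = length xs" "\<forall>c\<in>set cs. is_Nm c" "Inc (zip cs xs) \<in> S"
    "subst (ren (replace us cs)) (subst (ren (replace xs us)) l) \<notin> S" unfolding us_def[symmetric] by blast
  have safe: "safe \<theta> l" for \<theta> using assms(2) by (cases l) (auto simp: safe_def)
  have "subst (ren (replace us cs)) (subst (ren (replace xs us)) l) = subst (ren (replace xs cs)) l"
    unfolding subst_ren_comp[OF safe]
  proof (rule subst_cong)
    fix x
    assume "x \<in> fv l"
    then obtain i where i: "i < length xs" "x = xs ! i" using assms(3) by (metis in_set_conv_nth subsetD)
    then show "ren (\<lambda>y. replace us cs (replace xs us y)) x = ren (replace xs cs) x"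
      using assms(4) us cs(1) by (simp add: ren_def replace_nth)
  qed
  then show ?thesis using cs by auto
qed

end

text \<open>The elements are the classes of Henkin variables modulo provable equality.  Each class is
  represented by the image of one of its members under the injection \<open>g\<close> into the given type.\<close>

locale canonical_model = Henkin_set S TV
  for S :: "('f, 'r) efm set" and TV :: "'v itself" +
  fixes g :: "('f, 'r) hvar \<Rightarrow> 'm"
  assumes inj_g: "inj g"
begin

definition val :: "('f, 'r) hvar \<Rightarrow> 'm" where
  "val c = g (SOME d. is_Nm d \<and> Eq (Var c) (Var d) \<in> S)"

definition name_of :: "'m \<Rightarrow> ('f, 'r) hvar" where
  "name_of a = (SOME c. is_Nm c \<and> val c = a)"

definition canonical :: "('f, 'r, 'm) struct" where
  "canonical = \<lparr>carrier = val ` Collect is_Nm,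
     fun_int = (\<lambda>f as. val (SOME d. is_Nm d \<and> Eq (Var d) (Fn f (vs_tms (map name_of as))) \<in> S)),
     rel_int = (\<lambda>R as. Rel R (vs_tms (map name_of as)) \<in> S)\<rparr>"

lemma fun_int_canonical: "fun_int canonical f as = val (SOME d. is_Nm d \<and> Eq (Var d) (Fn f (vs_tms (map name_of as))) \<in> S)"
  by (simp add: canonical_def)

lemma rel_int_canonical: "rel_int canonical R as \<longleftrightarrow> Rel R (vs_tms (map name_of as)) \<in> S"
  by (simp add: canonical_def)

lemma val_eq:
  assumes "is_Nm c" "is_Nm d"
  shows "val c = val d \<longleftrightarrow> Eq (Var c) (Var d) \<in> S"
proof
  let ?P = "\<lambda>c d. is_Nm d \<and> Eq (Var c) (Var d) \<in> S"
  have P: "?P c (SOME d. ?P c d)" if "is_Nm c" for c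
    by (rule someI[of "?P c" c]) (simp add: that Eq_refl_S)
  show "Eq (Var c) (Var d) \<in> S" if "val c = val d"
  proof -
    have "(SOME d. ?P c d) = (SOME e. ?P d e)" using that inj_g by (simp add: val_def inj_eq)
    then show ?thesis using P[OF assms(1)] P[OF assms(2)] by (auto intro: Eq_trans_S[OF _ Eq_sym_S])
  qed
  show "val c = val d" if "Eq (Var c) (Var d) \<in> S"
  proof -
    have "?P c = ?P d" using that Eq_sym_S Eq_trans_S by blast
    then show ?thesis by (simp add: val_def)
  qed
qed

lemma name_of:
  assumes "a \<in> carrier canonical"
  shows "is_Nm (name_of a)" "val (name_of a) = a"
proof -
  obtain c where c: "is_Nm c \<and> val c = a" using assms by (auto simp: canonical_def)
  have "is_Nm (name_of a) \<and> val (name_of a) = a" unfolding name_of_def by (rule someI, rule c)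
  then show "is_Nm (name_of a)" "val (name_of a) = a" by auto
qed

lemma val_carrier: "is_Nm c \<Longrightarrow> val c \<in> carrier canonical"
  by (auto simp: canonical_def)

lemma name_of_val: "is_Nm c \<Longrightarrow> is_Nm (name_of (val c)) \<and> Eq (Var (name_of (val c))) (Var c) \<in> S"
  using name_of[OF val_carrier] val_eq by blast

lemma name_of_val_Eq: "is_Nm d \<Longrightarrow> Eq (Var d) t \<in> S \<Longrightarrow> Eq (Var (name_of (val d))) t \<in> S"
  using name_of_val Eq_trans_S by blast

lemma canonical_structure: "canonical \<in> structures"
proof -
  have "is_Nm (Nm x \<phi>)" for x :: "('f, 'r) hvar" and \<phi> by simp
  then have "carrier canonical \<noteq> {}" by (auto simp: canonical_def intro: exI[of _ "Nm _ _"])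
  moreover have "fun_int canonical f as \<in> carrier canonical" if "set as \<subseteq> carrier canonical" for f as
  proof -
    have "\<exists>d. is_Nm d \<and> Eq (Var d) (Fn f (vs_tms (map name_of as))) \<in> S"
      using that name_of(1) by (intro term_named) auto
    then have "is_Nm (SOME d. is_Nm d \<and> Eq (Var d) (Fn f (vs_tms (map name_of as))) \<in> S)"
      by (rule someI2_ex) simp
    then show ?thesis by (simp add: canonical_def)
  qed
  ultimately show ?thesis by (simp add: structures_def)
qed

lemma eval_canonical: "vars_tm t \<subseteq> Collect is_Nm \<Longrightarrow> is_Nm d \<Longrightarrow> Eq (Var d) t \<in> S \<Longrightarrow> eval canonical val t = val d"
proof (induction t arbitrary: d)
  case (Var c)
  then show ?case using val_eq[of d c] by simp
next
  case (Fn f ts)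
  have "\<forall>t\<in>set ts. \<exists>d. is_Nm d \<and> Eq (Var d) t \<in> S"
    using Fn.prems(1) by (intro ballI term_named) auto
  then obtain D where D: "\<And>t. t \<in> set ts \<Longrightarrow> is_Nm (D t) \<and> Eq (Var (D t)) t \<in> S" by metis
  then have hvar: "eval canonical val t = val (D t)" if "t \<in> set ts" for t
    using that Fn.prems(1) by (intro Fn.IH) auto
  define cs where "cs = map (\<lambda>t. name_of (val (D t))) ts"
  have "list_all2 (\<lambda>t u. Eq t u \<in> S) (vs_tms cs) ts"
    using D by (simp add: list_all2_conv_all_nth cs_def name_of_val_Eq)
  then have cong: "Eq (Fn f (vs_tms cs)) (Fn f ts) \<in> S" by (rule Fn_cong_S)
  define e where "e = (SOME d. is_Nm d \<and> Eq (Var d) (Fn f (vs_tms cs)) \<in> S)"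
  have "\<exists>d. is_Nm d \<and> Eq (Var d) (Fn f (vs_tms cs)) \<in> S"
    using D name_of_val by (intro term_named) (auto simp: cs_def)
  then have e: "is_Nm e \<and> Eq (Var e) (Fn f (vs_tms cs)) \<in> S" unfolding e_def by (rule someI_ex)
  have "map name_of (map (eval canonical val) ts) = cs" using hvar by (auto simp: cs_def)
  then have "eval canonical val (Fn f ts) = val e" by (simp only: eval.simps fun_int_canonical e_def)
  also have "\<dots> = val d"
    using e cong Fn.prems(2,3) val_eq Eq_sym_S Eq_trans_S by metis
  finally show ?case .
qed

lemma atom_canonical:
  assumes "is_atom l" "fv l \<subseteq> Collect is_Nm"
  shows "l \<in> S \<longleftrightarrow> sat canonical {val} l"
proof (cases l)
  case (Eq t u)
  obtain d e where d: "is_Nm d" "Eq (Var d) t \<in> S" and e: "is_Nm e" "Eq (Var e) u \<in> S"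
    using term_named[of t] term_named[of u] assms(2) Eq by auto
  have "eval canonical val t = val d" "eval canonical val u = val e"
    using assms(2) Eq d e by (auto intro!: eval_canonical)
  then have "sat canonical {val} l \<longleftrightarrow> Eq (Var d) (Var e) \<in> S" using Eq val_eq d e by simp
  then show ?thesis using Eq d(2) e(2) Eq_sym_S Eq_trans_S by metis
next
  case (Rel R ts)
  have "\<forall>t\<in>set ts. \<exists>d. is_Nm d \<and> Eq (Var d) t \<in> S"
    using assms(2) Rel by (intro ballI term_named) auto
  then obtain D where D: "\<And>t. t \<in> set ts \<Longrightarrow> is_Nm (D t) \<and> Eq (Var (D t)) t \<in> S" by metis
  then have hvar: "eval canonical val t = val (D t)" if "t \<in> set ts" for t
    using that assms(2) Rel by (intro eval_canonical) auto
  define cs where "cs = map (\<lambda>t. name_of (val (D t))) ts"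
  have 1: "list_all2 (\<lambda>t u. Eq t u \<in> S) (vs_tms cs) ts"
    using D by (simp add: list_all2_conv_all_nth cs_def name_of_val_Eq)
  then have 2: "list_all2 (\<lambda>t u. Eq t u \<in> S) ts (vs_tms cs)"
    using Eq_sym_S by (auto simp: list_all2_conv_all_nth)
  have "map name_of (map (eval canonical val) ts) = cs" using hvar by (auto simp: cs_def)
  then have "rel_int canonical R (map (eval canonical val) ts) \<longleftrightarrow> Rel R (vs_tms cs) \<in> S" by (simp only: rel_int_canonical)
  then have "sat canonical {val} l \<longleftrightarrow> Rel R (vs_tms cs) \<in> S" using Rel by simp
  then show ?thesis using Rel Rel_cong_S[OF 1] Rel_cong_S[OF 2] by blast
qed (use assms(1) in auto)

text \<open>The largest team whose finite parts are all allowed by the inclusion atoms in \<open>S\<close>; a sequence of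
  Henkin variables stands for the sequence of their values.\<close>

definition team_seqs :: "(nat \<Rightarrow> ('f, 'r) hvar) set" where
  "team_seqs = {c. (\<forall>i. is_Nm (c i)) \<and> (\<forall>n. Inc (map (\<lambda>i. (c i, Fr i)) [0..<n]) \<in> S)}"

definition act :: "(nat \<Rightarrow> ('f, 'r) hvar) \<Rightarrow> ('f, 'r) hvar \<Rightarrow> ('f, 'r) hvar" where
  "act c y = (case y of Fr i \<Rightarrow> c i | _ \<Rightarrow> y)"

lemma act_Nm [simp]: "is_Nm d \<Longrightarrow> act c d = d"
  by (cases d) (auto simp: act_def)

lemma act_is_Nm: "c \<in> team_seqs \<Longrightarrow> y \<notin> range Bd \<Longrightarrow> is_Nm (act c y)"
  by (cases y) (auto simp: act_def team_seqs_def)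

text \<open>The inclusion for an initial segment of the free variables is in the set by definition.
  Henkin variables are added with \<open>IncCst\<close>, and \<open>IncProj\<close> selects the columns in question.\<close>

lemma team_seqs_Inc:
  assumes c: "c \<in> team_seqs" and ys: "\<And>y. y \<in> set ys \<Longrightarrow> y \<notin> range Bd"
  shows "Inc (zip (map (act c) ys) ys) \<in> S"
proof -
  have "\<exists>n. \<forall>i. Fr i \<in> set ys \<longrightarrow> i < n"
  proof -
    have "finite (Fr -` set ys :: nat set)" by (rule finite_vimageI) (auto simp: inj_on_def)
    then show ?thesis by (metis finite_nat_set_iff_bounded vimage_eq)
  qed
  then obtain n where n: "\<And>i. Fr i \<in> set ys \<Longrightarrow> i < n" by blast
  let ?base = "map (\<lambda>i. (c i, Fr i)) [0..<n]"
  have "Inc (map (\<lambda>d. (d, d)) ds @ ?base) \<in> S" if "\<forall>d\<in>set ds. is_Nm d" for ds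
    using that c by (induction ds) (auto simp: team_seqs_def intro: Inc_cst_S)
  from this[of "filter is_Nm ys"] show ?thesis
  proof (rule Inc_subset_S)
    show "set (zip (map (act c) ys) ys) \<subseteq> set (map (\<lambda>d. (d, d)) (filter is_Nm ys) @ ?base)"
    proof
      fix p
      assume "p \<in> set (zip (map (act c) ys) ys)"
      moreover have "zip (map (act c) ys) ys = map (\<lambda>y. (act c y, y)) ys" by (induction ys) auto
      ultimately obtain y where y: "y \<in> set ys" "p = (act c y, y)" by auto
      show "p \<in> set (map (\<lambda>d. (d, d)) (filter is_Nm ys) @ ?base)"
      proof (cases y)
        case (Fr i)
        then show ?thesis using y n[of i] by (auto simp: act_def)
      qed (use y ys[of y] in \<open>auto simp: act_def\<close>)
    qed
  qed simp
qed

text \<open>The converse is the heart of the construction: each tuple of Henkin variables included in \<open>ys\<close> is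
  realized by a member of the team.  The inclusion is extended by one free variable after the other
  with \<open>IncExt\<close>, which exhausts them because they are countably many.  The variables \<open>ys\<close> then occur
  twice, and the equality of the two columns is the diagonal case of \<open>IncCompress\<close>.\<close>

lemma team_seqs_exists:
  assumes inc: "Inc (zip cs ys) \<in> S" "length cs = length ys" "\<And>c. c \<in> set cs \<Longrightarrow> is_Nm c"
    and ys: "\<And>y. y \<in> set ys \<Longrightarrow> y \<notin> range Bd"
  shows "\<exists>c\<in>team_seqs. map (\<lambda>y. val (act c y)) ys = map val cs"
proof -
  \<comment> \<open>The list grows at its head, so the free variables are listed in descending order.\<close>
  let ?P = "\<lambda>n L. length L = n \<and> (\<forall>d\<in>set L. is_Nm d) \<and>
    Inc (zip (L @ cs) (map Fr (rev [0..<n]) @ ys)) \<in> S"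
  have "\<exists>F. \<forall>n. ?P n (F n) \<and> (\<exists>d. F (Suc n) = d # F n)"
  proof (rule dependent_nat_choice)
    show "\<exists>L. ?P 0 L" using inc by simp
    fix L n
    assume P: "?P n L"
    have "\<exists>d. is_Nm d \<and> Inc ((d, Fr n) # zip (L @ cs) (map Fr (rev [0..<n]) @ ys)) \<in> S"
      using P inc ys by (intro Inc_ext_S) auto
    then obtain d where "is_Nm d" "Inc ((d, Fr n) # zip (L @ cs) (map Fr (rev [0..<n]) @ ys)) \<in> S" by blast
    then show "\<exists>L'. ?P (Suc n) L' \<and> (\<exists>d. L' = d # L)" using P by (intro exI[of _ "d # L"]) auto
  qed
  then obtain F where F: "\<And>n. ?P n (F n)" "\<And>n. \<exists>d. F (Suc n) = d # F n" by blast
  define c where "c i = hd (F (Suc i))" for i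
  have Fc: "F n = map c (rev [0..<n])" for n
  proof (induction n)
    case (Suc n)
    obtain d where "F (Suc n) = d # F n" using F(2) by blast
    then show ?case using Suc by (simp add: c_def)
  qed (use F(1)[of 0] in simp)
  have Inc: "Inc (map (\<lambda>i. (c i, Fr i)) (rev [0..<n]) @ zip cs ys) \<in> S" for n
  proof -
    have "zip (F n @ cs) (map Fr (rev [0..<n]) @ ys) = map (\<lambda>i. (c i, Fr i)) (rev [0..<n]) @ zip cs ys"
      unfolding Fc by (simp add: zip_map_map zip_same_conv_map)
    moreover have "Inc (zip (F n @ cs) (map Fr (rev [0..<n]) @ ys)) \<in> S" using F(1) by blast
    ultimately show ?thesis by (simp only:)
  qed
  have c_Nm: "is_Nm (c i)" for i
    using F(1)[of "Suc i"] unfolding Fc by simp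
  have c: "c \<in> team_seqs"
    unfolding team_seqs_def mem_Collect_eq
  proof (intro conjI allI)
    show "Inc (map (\<lambda>i. (c i, Fr i)) [0..<n]) \<in> S" for n by (rule Inc_subset_S[OF Inc[of n]]) auto
  qed (rule c_Nm)
  have "val (act c (ys ! j)) = val (cs ! j)" if j: "j < length ys" for j
  proof -
    let ?y = "ys ! j" and ?d = "cs ! j"
    have d: "is_Nm ?d" and dy: "(?d, ?y) \<in> set (zip cs ys)"
      using j inc(2,3) by (auto simp: in_set_zip)
    show ?thesis
    proof (cases ?y)
      case (Fr i)
      have "Inc [(c i, Fr i), (?d, Fr i)] \<in> S"
        by (rule Inc_subset_S[OF Inc[of "Suc i"]]) (use dy Fr in auto)
      then show ?thesis using Fr val_eq[OF c_Nm d] by (auto simp: act_def intro: Inc_diagonal_S)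
    next
      case (Bd i)
      then show ?thesis using ys[of ?y] j by (auto simp: in_set_conv_nth)
    next
      case (Nm x \<phi>)
      then have y: "is_Nm ?y" by simp
      have "Inc [(?y, ?y), (?d, ?y)] \<in> S"
        by (rule Inc_subset_S[OF Inc_cst_S[OF y inc(1)]]) (use dy in auto)
      then show ?thesis using y val_eq[OF y d] by (auto intro: Inc_diagonal_S)
    qed
  qed
  then have "map (\<lambda>y. val (act c y)) ys = map val cs"
    using inc(2) by (intro nth_equalityI) auto
  then show ?thesis using c by blast
qed

lemma team_seqs_nonempty: "team_seqs \<noteq> {}"
  using team_seqs_exists[of "[]" "[]"] Inc_refl_S[of "[]"] by auto

definition team_of :: "('w \<Rightarrow> ('f, 'r) hvar) \<Rightarrow> ('w \<Rightarrow> 'm) set" where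
  "team_of \<theta> = (\<lambda>c y. val (act c (\<theta> y))) ` team_seqs"

lemma sat_atom_image:
  "is_atom l \<Longrightarrow> sat N (f ` I) l \<longleftrightarrow> (\<forall>i\<in>I. sat N {f i} l)"
  by (cases l) auto

lemma sat_atom_ren:
  "is_atom l \<Longrightarrow> sat N {s} (subst (ren \<theta>) l) \<longleftrightarrow> sat N {\<lambda>y. s (\<theta> y)} l"
  by (cases l) (auto simp: eval_subst_tm ren_def comp_def)

text \<open>If the atom is in the set, so are its instances at the members of the team, by compression.
  Otherwise \<open>AtomWit\<close> yields a tuple that refutes it, and some member of the team takes these values.\<close>

lemma truth_atom:
  assumes l: "is_atom l" "\<theta> ` fv l \<inter> range Bd = {}"
  shows "subst (ren \<theta>) l \<in> S \<longleftrightarrow> sat canonical (team_of \<theta>) l"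
proof -
  define k where "k = subst (ren \<theta>) l"
  have k: "is_atom k" using l(1) by (cases l) (auto simp: k_def)
  have fvk: "fv k \<subseteq> \<theta> ` fv l" unfolding k_def by (rule fv_subst_ren_subset)
  have safe: "safe \<eta> k" for \<eta> using k by (cases k) (auto simp: safe_def)
  have sat: "sat canonical (team_of \<theta>) l \<longleftrightarrow> (\<forall>c\<in>team_seqs. sat canonical {val} (subst (ren (act c)) k))"
    unfolding team_of_def k_def sat_atom_image[OF l(1)] sat_atom_ren[OF k[unfolded k_def]]
      sat_atom_ren[OF l(1)] ..
  have in_S: "subst (ren (act c)) k \<in> S \<longleftrightarrow> sat canonical {val} (subst (ren (act c)) k)" if c: "c \<in> team_seqs" for c
  proof (rule atom_canonical)
    show "is_atom (subst (ren (act c)) k)" using k by (cases k) auto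
    show "fv (subst (ren (act c)) k) \<subseteq> Collect is_Nm"
      using fv_subst_ren_subset[of "act c" k] fvk l(2) act_is_Nm[OF c] by blast
  qed
  obtain xs where xs: "set xs = fv k" "distinct xs" using finite_distinct_list[of "fv k"] by auto
  have xs_Bd: "x \<notin> range Bd" if "x \<in> set xs" for x using that xs(1) fvk l(2) by blast
  have "k \<in> S \<longleftrightarrow> (\<forall>c\<in>team_seqs. subst (ren (act c)) k \<in> S)"
  proof (intro iffI ballI)
    fix c
    assume "k \<in> S" and c: "c \<in> team_seqs"
    have "subst (ren (replace xs (map (act c) xs))) k \<in> S"
      by (rule atom_compress_S[OF team_seqs_Inc[OF c xs_Bd] \<open>k \<in> S\<close> k]) (use xs in auto)
    also have "subst (ren (replace xs (map (act c) xs))) k = subst (ren (act c)) k"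
    proof (rule subst_cong)
      fix x
      assume "x \<in> fv k"
      then obtain i where "i < length xs" "x = xs ! i" using xs(1) by (metis in_set_conv_nth)
      then show "ren (replace xs (map (act c) xs)) x = ren (act c) x"
        using xs(2) by (simp add: ren_def replace_nth)
    qed
    finally show "subst (ren (act c)) k \<in> S" .
  next
    assume all: "\<forall>c\<in>team_seqs. subst (ren (act c)) k \<in> S"
    show "k \<in> S"
    proof (rule ccontr)
      assume "k \<notin> S"
      then obtain cs where cs: "length cs = length xs" "\<forall>c\<in>set cs. is_Nm c" "Inc (zip cs xs) \<in> S"
        "subst (ren (replace xs cs)) k \<notin> S"
        using not_atom_S[OF _ k, of xs] xs xs_Bd by blast
      then obtain c where c: "c \<in> team_seqs" "map (\<lambda>y. val (act c y)) xs = map val cs"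
        using team_seqs_exists[of cs xs] xs_Bd by blast
      have "sat canonical {val} (subst (ren (replace xs cs)) k) \<longleftrightarrow> sat canonical {val} (subst (ren (act c)) k)"
        unfolding sat_atom_ren[OF k]
      proof -
        have "val (replace xs cs x) = val (act c x)" if "x \<in> fv k" for x
        proof -
          obtain i where i: "i < length xs" "x = xs ! i" using \<open>x \<in> fv k\<close> xs(1) by (metis in_set_conv_nth)
          then show ?thesis
            using arg_cong[OF c(2), of "\<lambda>l. l ! i"] xs(2) cs(1) by (simp add: replace_nth)
        qed
        then show "sat canonical {\<lambda>y. val (replace xs cs y)} k \<longleftrightarrow> sat canonical {\<lambda>y. val (act c y)} k"
          using sat_agree[of "{()}" k "\<lambda>_ y. val (replace xs cs y)" "\<lambda>_ y. val (act c y)" canonical] by simp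
      qed
      moreover have "sat canonical {val} (subst (ren (act c)) k)" using all in_S c(1) by blast
      moreover have "subst (ren (replace xs cs)) k \<in> S \<longleftrightarrow> sat canonical {val} (subst (ren (replace xs cs)) k)"
      proof (rule atom_canonical)
        show "is_atom (subst (ren (replace xs cs)) k)" using k by (cases k) auto
        have "replace xs cs ` set xs = set cs" using map_replace[OF xs(2) cs(1)] by (metis list.set_map)
        then show "fv (subst (ren (replace xs cs)) k) \<subseteq> Collect is_Nm"
          using fv_subst_ren_subset[of "replace xs cs" k] xs(1) cs(2) by blast
      qed
      ultimately show False using cs(4) by blast
    qed
  qed
  then show ?thesis unfolding sat k_def[symmetric] using in_S by blast
qed

text \<open>A member of the team gives an inclusion of Henkin variables in \<open>xs\<close>, hence by transitivity in \<open>ys\<close>,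
  and this is realized in the team.  If the atom is not in the set, \<open>IncWit\<close> yields a tuple included
  in \<open>xs\<close> but not in \<open>ys\<close>; a member that takes these values for \<open>xs\<close> has no match for \<open>ys\<close>.\<close>

lemma truth_Inc:
  fixes ps :: "(('f, 'r) hvar \<times> ('f, 'r) hvar) list"
  assumes "\<theta> ` fv (Inc ps :: ('f, 'r) efm) \<inter> range Bd = {}"
  shows "subst (ren \<theta>) (Inc ps) \<in> S \<longleftrightarrow> sat canonical (team_of \<theta>) (Inc ps)"
proof -
  define xs where "xs = map (\<lambda>p. \<theta> (fst p)) ps"
  define ys where "ys = map (\<lambda>p. \<theta> (snd p)) ps"
  have len: "length xs = length ys" by (simp add: xs_def ys_def)
  have Bd: "x \<notin> range Bd" if "x \<in> set xs \<union> set ys" for x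
    using that assms by (auto simp: xs_def ys_def)
  have 1: "subst (ren \<theta>) (Inc ps) = (Inc (zip xs ys) :: ('f, 'r) efm)"
    unfolding subst_ren_Inc xs_def ys_def by (simp add: zip_map_map zip_same_conv_map case_prod_unfold)
  have 2: "sat canonical (team_of \<theta>) (Inc ps) \<longleftrightarrow> (\<forall>c\<in>team_seqs. \<exists>c'\<in>team_seqs.
      map (\<lambda>y. val (act c y)) xs = map (\<lambda>y. val (act c' y)) ys)"
    by (simp add: team_of_def xs_def ys_def comp_def)
  show ?thesis unfolding 1 2
  proof
    assume inc: "Inc (zip xs ys) \<in> S"
    show "\<forall>c\<in>team_seqs. \<exists>c'\<in>team_seqs. map (\<lambda>y. val (act c y)) xs = map (\<lambda>y. val (act c' y)) ys"
    proof
      fix c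
      assume c: "c \<in> team_seqs"
      have "Inc (zip (map (act c) xs) xs) \<in> S" by (rule team_seqs_Inc[OF c]) (use Bd in auto)
      then have "Inc (zip (map (act c) xs) ys) \<in> S" by (rule Inc_trans_S[OF _ inc]) (use len in auto)
      then obtain c' where "c' \<in> team_seqs" "map (\<lambda>y. val (act c' y)) ys = map val (map (act c) xs)"
        using team_seqs_exists[of "map (act c) xs" ys] len act_is_Nm[OF c] Bd
        by (metis (no_types, lifting) UnCI in_set_conv_nth length_map nth_map)
      then show "\<exists>c'\<in>team_seqs. map (\<lambda>y. val (act c y)) xs = map (\<lambda>y. val (act c' y)) ys"
        by (intro bexI[of _ c']) (simp_all add: comp_def)
    qed
  next
    assume all: "\<forall>c\<in>team_seqs. \<exists>c'\<in>team_seqs. map (\<lambda>y. val (act c y)) xs = map (\<lambda>y. val (act c' y)) ys"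
    show "Inc (zip xs ys) \<in> S"
    proof (rule ccontr)
      assume "Inc (zip xs ys) \<notin> S"
      then obtain cs where cs: "length cs = length xs" "\<forall>c\<in>set cs. is_Nm c" "Inc (zip cs xs) \<in> S"
        "Inc (zip cs ys) \<notin> S"
        using not_Inc_S[OF _ len] Bd by blast
      obtain c where c: "c \<in> team_seqs" "map (\<lambda>y. val (act c y)) xs = map val cs"
        using team_seqs_exists[OF cs(3,1)] cs(2) Bd by blast
      then obtain c' where c': "c' \<in> team_seqs" "map val cs = map (\<lambda>y. val (act c' y)) ys"
        using all by metis
      have "Inc (zip (map (act c') ys) ys) \<in> S" by (rule team_seqs_Inc[OF c'(1)]) (use Bd in auto)
      moreover have "list_all2 (\<lambda>c d. Eq (Var c) (Var d) \<in> S) (map (act c') ys) cs"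
        unfolding list_all2_conv_all_nth
      proof (intro conjI allI impI)
        fix j
        assume j: "j < length (map (act c') ys)"
        have "val (act c' (ys ! j)) = val (cs ! j)"
          using arg_cong[OF c'(2), of "\<lambda>l. l ! j"] j cs(1) len by simp
        moreover have "is_Nm (act c' (ys ! j))" "is_Nm (cs ! j)"
          using act_is_Nm[OF c'(1)] Bd cs(1,2) len j by auto
        ultimately show "Eq (Var (map (act c') ys ! j)) (Var (cs ! j)) \<in> S"
          using j val_eq by simp
      qed (use cs(1) len in simp)
      ultimately have "Inc (zip cs ys) \<in> S" by (rule_tac Inc_replace_S) auto
      then show False using cs(4) by simp
    qed
  qed
qed

lemma team_upd_team_of:
  "is_Nm d \<Longrightarrow> team_upd (team_of \<theta>) x (val d) = team_of (\<theta>(x := d))"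
  unfolding team_of_def team_upd_image by (rule image_cong) (auto simp: fun_eq_iff)

lemma subst1_ren_upd:
  assumes "x \<in> range Bd" "\<theta> ` (fv \<phi> - {x}) \<inter> range Bd = {}" "bv \<phi> \<subseteq> range Bd"
  shows "subst1 (subst (ren (\<theta>(x := x))) \<phi>) (Var d) x = subst (ren (\<theta>(x := d))) \<phi>"
proof -
  have safe: "safe (\<theta>(x := x)) \<phi>" using assms(2,3) by (auto simp: safe_def)
  show ?thesis unfolding subst1_Var subst_ren_comp[OF safe]
    using assms(1,2) by (intro subst_cong) (auto simp: ren_def)
qed

text \<open>The connectives follow from maximality and the quantifiers from the Henkin witnesses.  The renaming
  \<open>\<theta>\<close> records the Henkin variables that instantiate the quantifiers passed so far.\<close>

lemma truth:
  fixes \<phi> :: "('f, 'r) efm"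
  shows "bv \<phi> \<subseteq> range Bd \<Longrightarrow> \<theta> ` fv \<phi> \<inter> range Bd = {} \<Longrightarrow>
    subst (ren \<theta>) \<phi> \<in> S \<longleftrightarrow> sat canonical (team_of \<theta>) \<phi>"
proof (induction \<phi> arbitrary: \<theta>)
  case (Eq t u)
  show ?case by (rule truth_atom) (use Eq.prems in auto)
next
  case (Rel R ts)
  show ?case by (rule truth_atom) (use Rel.prems in auto)
next
  case (Inc ps)
  show ?case by (rule truth_Inc[OF Inc.prems(2)])
next
  case (Dneg \<phi>)
  have "team_of \<theta> \<noteq> {}" using team_seqs_nonempty by (simp add: team_of_def)
  moreover have "subst (ren \<theta>) \<phi> \<in> S \<longleftrightarrow> sat canonical (team_of \<theta>) \<phi>"
    using Dneg.prems by (intro Dneg.IH) auto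
  ultimately show ?case by (simp add: Dneg_S)
next
  case (And \<phi> \<psi>)
  have "subst (ren \<theta>) \<phi> \<in> S \<longleftrightarrow> sat canonical (team_of \<theta>) \<phi>" using And.prems by (intro And.IH(1)) auto
  moreover have "subst (ren \<theta>) \<psi> \<in> S \<longleftrightarrow> sat canonical (team_of \<theta>) \<psi>" using And.prems by (intro And.IH(2)) auto
  ultimately show ?case by (simp add: And_S)
next
  case (Or1 \<phi> \<psi>)
  have "subst (ren \<theta>) \<phi> \<in> S \<longleftrightarrow> sat canonical (team_of \<theta>) \<phi>" using Or1.prems by (intro Or1.IH(1)) auto
  moreover have "subst (ren \<theta>) \<psi> \<in> S \<longleftrightarrow> sat canonical (team_of \<theta>) \<psi>" using Or1.prems by (intro Or1.IH(2)) auto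
  ultimately show ?case by (simp add: Or1_S)
next
  case (Ex1 x \<phi>)
  have x: "x \<in> range Bd" "bv \<phi> \<subseteq> range Bd" "\<theta> ` (fv \<phi> - {x}) \<inter> range Bd = {}"
    using Ex1.prems by auto
  have IH: "subst (ren (\<theta>(x := d))) \<phi> \<in> S \<longleftrightarrow> sat canonical (team_upd (team_of \<theta>) x (val d)) \<phi>"
    if d: "is_Nm d" for d
    unfolding team_upd_team_of[OF d] by (rule Ex1.IH) (use x d in auto)
  have "subst (ren \<theta>) (Ex1 x \<phi>) \<in> S \<longleftrightarrow> (\<exists>d. is_Nm d \<and> subst (ren (\<theta>(x := d))) \<phi> \<in> S)"
    using Ex1_S[of "subst (ren (\<theta>(x := x))) \<phi>" x] subst1_ren_upd[OF x(1,3,2)] x(2)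
    by (simp add: ren_def[of \<theta> x])
  also have "\<dots> \<longleftrightarrow> sat canonical (team_of \<theta>) (Ex1 x \<phi>)" using IH by (auto simp: canonical_def)
  finally show ?case .
next
  case (All1 x \<phi>)
  have x: "x \<in> range Bd" "bv \<phi> \<subseteq> range Bd" "\<theta> ` (fv \<phi> - {x}) \<inter> range Bd = {}"
    using All1.prems by auto
  have IH: "subst (ren (\<theta>(x := d))) \<phi> \<in> S \<longleftrightarrow> sat canonical (team_upd (team_of \<theta>) x (val d)) \<phi>"
    if d: "is_Nm d" for d
    unfolding team_upd_team_of[OF d] by (rule All1.IH) (use x d in auto)
  have "subst (ren \<theta>) (All1 x \<phi>) \<in> S \<longleftrightarrow> (\<forall>d. is_Nm d \<longrightarrow> subst (ren (\<theta>(x := d))) \<phi> \<in> S)"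
    using All1_S[of "subst (ren (\<theta>(x := x))) \<phi>" x] subst1_ren_upd[OF x(1,3,2)] x(2)
    by (simp add: ren_def[of \<theta> x])
  also have "\<dots> \<longleftrightarrow> sat canonical (team_of \<theta>) (All1 x \<phi>)" using IH by (auto simp: canonical_def)
  finally show ?case .
qed

end

section \<open>Bounding the size of the model\<close>

text \<open>An infinite set is equinumerous with its square, so lists can be coded by iterated pairing; the
  first component tells the empty list from the others.\<close>

lemma inj_list_code:
  assumes "infinite (UNIV :: 'm set)"
  obtains e :: "'m list \<Rightarrow> 'm" where "inj e"
proof -
  have "\<exists>p. bij_betw p ((UNIV :: 'm set) \<times> (UNIV :: 'm set)) (UNIV :: 'm set)"
    using card_of_Times_same_infinite[OF assms] by (simp only: card_of_ordIso)
  then obtain p :: "'m \<times> 'm \<Rightarrow> 'm" where p: "inj p" by (auto simp: bij_betw_def)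
  obtain a :: 'm where "a \<notin> {undefined}" using ex_fresh[OF assms, of "{undefined}"] by auto
  then obtain b where ab: "a \<noteq> b" by blast
  define e where "e = rec_list (p (a, a)) (\<lambda>x _ r. p (b, p (x, r)))"
  have e: "e [] = p (a, a)" "e (x # xs) = p (b, p (x, e xs))" for x xs by (simp_all add: e_def)
  have "e xs = e ys \<Longrightarrow> xs = ys" for xs ys
  proof (induction xs arbitrary: ys)
    case Nil
    then show ?case using p ab by (cases ys) (auto simp: e inj_eq)
  next
    case (Cons x xs)
    then show ?case using p ab by (cases ys) (auto simp: e inj_eq)
  qed
  then show thesis using that by (meson injI)
qed

context
  fixes e :: "'m list \<Rightarrow> 'm" and fcode :: "'f \<Rightarrow> 'm" and rcode :: "'r \<Rightarrow> 'm" and ncode :: "nat \<Rightarrow> 'm"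
  assumes inj: "inj e" "inj fcode" "inj rcode" "inj ncode"
begin

primrec code_tm :: "('f, 'm) tm \<Rightarrow> 'm" where
  "code_tm (Var x) = e [ncode 0, x]"
| "code_tm (Fn f ts) = e (ncode 1 # fcode f # map code_tm ts)"

primrec code_fm :: "('f, 'r, 'm) fm \<Rightarrow> 'm" where
  "code_fm (Eq t u) = e [ncode 0, code_tm t, code_tm u]"
| "code_fm (Rel R ts) = e (ncode 1 # rcode R # map code_tm ts)"
| "code_fm (Inc ps) = e (ncode 2 # map (\<lambda>(x, y). e [x, y]) ps)"
| "code_fm (Dneg \<phi>) = e [ncode 3, code_fm \<phi>]"
| "code_fm (And \<phi> \<psi>) = e [ncode 4, code_fm \<phi>, code_fm \<psi>]"
| "code_fm (Or1 \<phi> \<psi>) = e [ncode 5, code_fm \<phi>, code_fm \<psi>]"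
| "code_fm (Ex1 x \<phi>) = e [ncode 6, x, code_fm \<phi>]"
| "code_fm (All1 x \<phi>) = e [ncode 7, x, code_fm \<phi>]"

primrec code_hvar :: "('f, 'r) hvar \<Rightarrow> 'm" where
  "code_hvar (Fr n) = e [ncode 0, ncode n]"
| "code_hvar (Bd n) = e [ncode 1, ncode n]"
| "code_hvar (Nm x \<phi>) = e [ncode 2, code_hvar x, code_fm (map_fm (\<lambda>x. x) (\<lambda>x. x) code_hvar \<phi>)]"

lemmas code_eqs = inj_eq[OF inj(1)] inj_eq[OF inj(2)] inj_eq[OF inj(3)] inj_eq[OF inj(4)]

lemma code_tm_inj: "code_tm t = code_tm u \<Longrightarrow> t = u"
proof (induction t arbitrary: u)
  case (Var x)
  then show ?case by (cases u) (auto simp: code_eqs)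
next
  case (Fn f ts)
  then obtain us where u: "u = Fn f us" "map code_tm ts = map code_tm us"
    by (cases u) (auto simp: code_eqs)
  then have "ts = us" using Fn.IH by (metis (no_types, lifting) list.inj_map_strong)
  then show ?case using u by simp
qed

lemma inj_code_tm: "inj code_tm"
  by (rule injI) (rule code_tm_inj)

lemma code_fm_inj: "code_fm \<phi> = code_fm \<psi> \<Longrightarrow> \<phi> = \<psi>"
proof (induction \<phi> arbitrary: \<psi>)
  case (Inc ps)
  have "inj (\<lambda>(x, y). e [x, y])" by (auto simp: inj_def code_eqs)
  then show ?case using Inc by (cases \<psi>) (auto simp: code_eqs inj_map_eq_map)
next
  case (Rel R ts)
  then show ?case by (cases \<psi>) (auto simp: code_eqs inj_map_eq_map[OF inj_code_tm])
next
  case (Eq t u)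
  then show ?case by (cases \<psi>) (auto simp: code_eqs inj_eq[OF inj_code_tm])
next
  case (Dneg \<phi>)
  from Dneg.prems show ?case by (cases \<psi>) (auto simp: code_eqs dest: Dneg.IH)
next
  case (And \<phi> \<phi>')
  from And.prems show ?case by (cases \<psi>) (auto simp: code_eqs dest: And.IH)
next
  case (Or1 \<phi> \<phi>')
  from Or1.prems show ?case by (cases \<psi>) (auto simp: code_eqs dest: Or1.IH)
next
  case (Ex1 x \<phi>)
  from Ex1.prems show ?case by (cases \<psi>) (auto simp: code_eqs dest: Ex1.IH)
next
  case (All1 x \<phi>)
  from All1.prems show ?case by (cases \<psi>) (auto simp: code_eqs dest: All1.IH)
qed

lemma code_hvar_inj: "code_hvar c = code_hvar d \<Longrightarrow> c = d"
proof (induction c arbitrary: d)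
  case (Nm x \<phi>)
  from Nm.prems obtain y \<psi> where d: "d = Nm y \<psi>" and xy: "code_hvar x = code_hvar y"
    and eq: "code_fm (map_fm (\<lambda>x. x) (\<lambda>x. x) code_hvar \<phi>) = code_fm (map_fm (\<lambda>x. x) (\<lambda>x. x) code_hvar \<psi>)"
    by (cases d) (auto simp: code_eqs)
  have "x = y" by (rule Nm.IH(1)[OF xy])
  moreover have "\<phi> = \<psi>"
    by (rule fm.inj_map_strong[OF _ _ _ code_fm_inj[OF eq]]) (auto intro: Nm.IH(2))
  ultimately show ?case using d by simp
qed (case_tac d; auto simp: code_eqs)+

lemma inj_code_hvar: "inj code_hvar"
  by (rule injI) (rule code_hvar_inj)

end

lemma inj_hvar_exists:
  assumes "\<exists>g :: 'f + 'r + nat \<Rightarrow> 'm. inj g"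
  obtains g :: "('f, 'r) hvar \<Rightarrow> 'm" where "inj g"
proof -
  obtain k :: "'f + 'r + nat \<Rightarrow> 'm" where k: "inj k" using assms by blast
  let ?n = "\<lambda>n. k (Inr (Inr n))"
  have inj: "inj (\<lambda>f. k (Inl f))" "inj (\<lambda>R. k (Inr (Inl R)))" "inj ?n"
    using k by (auto simp: inj_def)
  have "infinite (UNIV :: 'm set)"
    using inj(3) by (metis finite_subset infinite_iff_countable_subset subset_UNIV)
  then obtain e :: "'m list \<Rightarrow> 'm" where "inj e" by (rule inj_list_code)
  from inj_code_hvar[OF this inj] show thesis by (rule that)
qed

section \<open>Strong completeness\<close>

text \<open>A finite part of the given set is renamed back: \<open>Fr i\<close> to the free variable it stands for and the
  rest to new variables.  The result is interderivable with the original formulas.\<close>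

lemma finitely_realizable_alpha_nf:
  fixes \<Gamma> :: "('f, 'r, 'v) fm set"
  assumes inf: "infinite (UNIV :: 'v set)" and countable: "countable (fvs \<Gamma>)" and "\<not> \<Gamma> \<turnstile> bot_fm"
  shows "finitely_realizable TYPE('v) ((\<lambda>\<gamma>. alpha_nf \<gamma> (\<lambda>y. Fr (to_nat_on (fvs \<Gamma>) y)) 0) ` \<Gamma>)"
  unfolding finitely_realizable_def
proof (intro allI impI)
  let ?\<rho> = "\<lambda>y. Fr (to_nat_on (fvs \<Gamma>) y) :: ('f, 'r) hvar"
  fix S0 :: "('f, 'r) efm set"
  assume "finite S0" "S0 \<subseteq> (\<lambda>\<gamma>. alpha_nf \<gamma> ?\<rho> 0) ` \<Gamma>"
  then obtain \<Delta> where \<Delta>: "finite \<Delta>" "\<Delta> \<subseteq> \<Gamma>" "S0 = (\<lambda>\<gamma>. alpha_nf \<gamma> ?\<rho> 0) ` \<Delta>"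
    by (meson finite_subset_image)
  define h0 where "h0 = (\<lambda>c :: ('f, 'r) hvar. case c of Fr i \<Rightarrow> from_nat_into (fvs \<Gamma>) i | _ \<Rightarrow> undefined)"
  have sub: "fvs \<Delta> \<subseteq> fvs \<Gamma>" using \<Delta>(2) by (auto simp: fvs_def)
  have h0: "h0 (?\<rho> y) = y" if "y \<in> fvs \<Delta>" for y
    using that sub countable by (auto simp: h0_def)
  have "finite (?\<rho> ` fvs \<Delta>)" "finite (vset S0)" "inj_on h0 (?\<rho> ` fvs \<Delta>)"
    using \<Delta>(1,3) finite_fvs h0 by (auto simp: inj_on_def)
  from extend_inj[OF this inf] obtain h :: "('f, 'r) hvar \<Rightarrow> 'v" where
    h: "inj_on h (?\<rho> ` fvs \<Delta> \<union> vset S0)" "\<forall>x\<in>?\<rho> ` fvs \<Delta>. h x = h0 x" by blast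
  have "\<not> mv h ` S0 \<turnstile> bot_fm"
  proof
    assume bot: "mv h ` S0 \<turnstile> bot_fm"
    have "\<Gamma> \<turnstile> bot_fm"
    proof (rule cut_set[OF _ bot])
      show "finite (mv h ` S0)" using \<Delta>(1,3) by simp
      fix \<alpha>
      assume "\<alpha> \<in> mv h ` S0"
      then obtain \<gamma> where \<gamma>: "\<gamma> \<in> \<Delta>" "\<alpha> = mv h (alpha_nf \<gamma> ?\<rho> 0)" using \<Delta>(3) by auto
      have fv: "fv \<gamma> \<subseteq> fvs \<Delta>" using \<gamma>(1) by (auto simp: fvs_def)
      have "{subst (ren (\<lambda>x. x)) \<gamma>} \<turnstile> \<alpha>"
        unfolding \<gamma>(2)
      proof (rule conjunct2[OF alpha_nf_deq[OF inf]])
        show "inj_on h (vars (alpha_nf \<gamma> ?\<rho> 0))"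
          by (rule inj_on_subset[OF h(1)]) (use \<gamma>(1) \<Delta>(3) in auto)
        show "y = h (?\<rho> y)" if "y \<in> fv \<gamma>" for y using that fv h(2) h0 by auto
      qed (auto simp: safe_def)
      then show "\<Gamma> \<turnstile> \<alpha>" using \<gamma>(1) \<Delta>(2) by (auto intro: Weaken)
    qed
    then show False using assms(3) by simp
  qed
  moreover have "inj_on h (vset S0)" using h(1) by (rule inj_on_subset) auto
  ultimately show "\<exists>h :: ('f, 'r) hvar \<Rightarrow> 'v. realizes h S0" by (auto simp: realizes_def)
qed

text \<open>The canonical team has values for all variables \<open>Fr i\<close>; it is read as a team over the original
  free variables.\<close>

lemma model_existence:
  fixes \<Gamma> :: "('f, 'r, 'v) fm set"
  assumes inf: "infinite (UNIV :: 'v set)" "infinite (UNIV :: 'f set)"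
    and card: "\<exists>g :: 'f + 'r + nat \<Rightarrow> 'm. inj g"
    and countable: "countable (fvs \<Gamma>)" and con: "\<not> \<Gamma> \<turnstile> bot_fm"
  obtains M :: "('f, 'r, 'm) struct" and X where
    "M \<in> structures" "team M (fvs \<Gamma>) X" "X \<noteq> {}" "\<And>\<gamma>. \<gamma> \<in> \<Gamma> \<Longrightarrow> sat M X \<gamma>"
proof -
  let ?\<rho> = "\<lambda>y. Fr (to_nat_on (fvs \<Gamma>) y) :: ('f, 'r) hvar"
  let ?T = "(\<lambda>\<gamma>. alpha_nf \<gamma> ?\<rho> 0) ` \<Gamma>"
  have vT: "\<not> is_Nm y" if "y \<in> vset ?T" for y
    using that fv_alpha_nf[of _ ?\<rho> 0] bv_alpha_nf[of _ ?\<rho> 0] by (fastforce simp: vars_eq)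
  obtain S where S: "?T \<subseteq> S" "Henkin_set TYPE('v) S"
    using Henkin_set_exists[OF inf finitely_realizable_alpha_nf[OF inf(1) countable con] vT] by blast
  obtain g :: "('f, 'r) hvar \<Rightarrow> 'm" where g: "inj g" by (rule inj_hvar_exists[OF card])
  interpret Henkin_set S "TYPE('v)" by (rule S(2))
  interpret canonical_model S "TYPE('v)" g by unfold_locales (rule g)
  define X where "X = (\<lambda>c y. if y \<in> fvs \<Gamma> then val (act c (?\<rho> y)) else undefined) ` team_seqs"
  have "sat canonical X \<gamma>" if \<gamma>: "\<gamma> \<in> \<Gamma>" for \<gamma>
  proof -
    have "subst (ren (\<lambda>x. x)) (alpha_nf \<gamma> ?\<rho> 0) \<in> S" using S(1) \<gamma> by auto
    moreover have "bv (alpha_nf \<gamma> ?\<rho> 0) \<subseteq> range Bd" using bv_alpha_nf[of \<gamma> ?\<rho> 0] by auto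
    moreover have "(\<lambda>x. x) ` fv (alpha_nf \<gamma> ?\<rho> 0) \<inter> range Bd = {}" using fv_alpha_nf[of \<gamma> ?\<rho> 0] by auto
    ultimately have "sat canonical (team_of (\<lambda>x. x)) (alpha_nf \<gamma> ?\<rho> 0)" using truth by blast
    then have "sat canonical ((\<lambda>c y. val (act c (?\<rho> y))) ` team_seqs) \<gamma>"
      unfolding team_of_def by (subst (asm) sat_alpha_nf) auto
    also have "sat canonical ((\<lambda>c y. val (act c (?\<rho> y))) ` team_seqs) \<gamma> = sat canonical X \<gamma>"
      unfolding X_def using \<gamma> by (intro sat_agree) (auto simp: fvs_def)
    finally show ?thesis .
  qed
  moreover have "team canonical (fvs \<Gamma>) X"
    by (auto simp: team_def X_def intro!: val_carrier act_is_Nm)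
  moreover have "X \<noteq> {}" using team_seqs_nonempty by (simp add: X_def)
  ultimately show thesis using that canonical_structure by blast
qed

lemma completeness:
  fixes \<Gamma> :: "('f, 'r, 'v) fm set"
  assumes inf: "infinite (UNIV :: 'v set)" "infinite (UNIV :: 'f set)"
    and card: "\<exists>g :: 'f + 'r + nat \<Rightarrow> 'm. inj g"
    and countable: "countable (fvs (insert \<phi> \<Gamma>))"
    and ent: "entails (structures :: ('f, 'r, 'm) struct set) \<Gamma> \<phi>"
  shows "\<Gamma> \<turnstile> \<phi>"
proof (rule RAA, rule ccontr)
  assume con: "\<not> insert (Dneg \<phi>) \<Gamma> \<turnstile> bot_fm"
  have fvs: "fvs (insert (Dneg \<phi>) \<Gamma>) = fvs (insert \<phi> \<Gamma>)" by (simp add: fvs_def)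
  have cnt: "countable (fvs (insert (Dneg \<phi>) \<Gamma>))" using countable fvs by simp
  obtain M :: "('f, 'r, 'm) struct" and X where M: "M \<in> structures" "X \<noteq> {}"
    "team M (fvs (insert \<phi> \<Gamma>)) X" and sat: "\<And>\<gamma>. \<gamma> \<in> insert (Dneg \<phi>) \<Gamma> \<Longrightarrow> sat M X \<gamma>"
    using model_existence[OF inf card cnt con] fvs by metis
  have "sat M X \<phi>" using ent M sat unfolding entails_def by blast
  then show False using sat[of "Dneg \<phi>"] M(2) by simp
qed

lemma two_elements_iff:
  assumes "x \<noteq> y" "X \<noteq> {}"
  shows "sat M X (two_elements x y) \<longleftrightarrow> (\<exists>a\<in>carrier M. \<exists>b\<in>carrier M. a \<noteq> b)"
  using assms by (auto simp: two_elements_def team_upd_def)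

text \<open>In a nonempty team \<open>two_elements x y\<close> says that the carrier has two elements, and the empty team
  satisfies everything.\<close>

lemma entails_models:
  fixes \<Gamma> :: "('f, 'r, 'v) fm set"
  assumes "x \<noteq> y"
  shows "entails (models :: ('f, 'r, 'm) struct set) \<Gamma> \<phi> \<longleftrightarrow>
    entails (structures :: ('f, 'r, 'm) struct set) (insert (two_elements x y) \<Gamma>) \<phi>"
proof -
  have fvs: "fvs (insert \<phi> (insert (two_elements x y) \<Gamma>)) = fvs (insert \<phi> \<Gamma>)"
    by (auto simp: fvs_def two_elements_def)
  show ?thesis
  proof
    assume L: "entails (models :: ('f, 'r, 'm) struct set) \<Gamma> \<phi>"
    show "entails (structures :: ('f, 'r, 'm) struct set) (insert (two_elements x y) \<Gamma>) \<phi>"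
      unfolding entails_def fvs
    proof (intro ballI allI impI)
      fix M :: "('f, 'r, 'm) struct" and V X
      assume *: "M \<in> structures" "team M V X" "fvs (insert \<phi> \<Gamma>) \<subseteq> V"
        "\<forall>\<psi>\<in>insert (two_elements x y) \<Gamma>. sat M X \<psi>"
      show "sat M X \<phi>"
      proof (cases "X = {}")
        case True
        then show ?thesis using sat_empty *(1) by simp
      next
        case False
        then have "M \<in> models" using two_elements_iff[OF assms False] * by (auto simp: models_def)
        then show ?thesis using L * unfolding entails_def by blast
      qed
    qed
  next
    assume R: "entails (structures :: ('f, 'r, 'm) struct set) (insert (two_elements x y) \<Gamma>) \<phi>"
    show "entails (models :: ('f, 'r, 'm) struct set) \<Gamma> \<phi>"
      unfolding entails_def
    proof (intro ballI allI impI)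
      fix M :: "('f, 'r, 'm) struct" and V X
      assume *: "M \<in> models" "team M V X" "fvs (insert \<phi> \<Gamma>) \<subseteq> V" "\<forall>\<psi>\<in>\<Gamma>. sat M X \<psi>"
      then have M: "M \<in> structures" by (simp add: models_def)
      have "sat M X (two_elements x y)"
        using two_elements_iff[OF assms, of X M] * sat_empty[OF M] by (cases "X = {}") (auto simp: models_def)
      then show "sat M X \<phi>" using R M * unfolding entails_def fvs by blast
    qed
  qed
qed

theorem corollary4p11:
  fixes \<Gamma> :: "('f, 'r, 'v) fm set" and \<phi> :: "('f, 'r, 'v) fm" and x y :: 'v
  assumes "infinite (UNIV :: 'v set)"
    and "countable (fvs (insert \<phi> \<Gamma>))"
    and "infinite (- all_fsyms (insert \<phi> \<Gamma>))"
    and "infinite (- all_rsyms (insert \<phi> \<Gamma>))"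
    and "\<exists>g :: 'f + 'r + nat \<Rightarrow> 'm. inj g"
    and "x \<noteq> y"
  shows "(entails (structures :: ('f, 'r, 'm) struct set) \<Gamma> \<phi> \<longleftrightarrow> \<Gamma> \<turnstile> \<phi>) \<and>
    (entails (models :: ('f, 'r, 'm) struct set) \<Gamma> \<phi> \<longleftrightarrow> insert (two_elements x y) \<Gamma> \<turnstile> \<phi>)"
proof -
  have inf: "infinite (UNIV :: 'f set)"
    using assms(3) finite_subset subset_UNIV by blast
  have "countable (fvs (insert \<phi> (insert (two_elements x y) \<Gamma>)))"
    using assms(2) by (simp add: fvs_def two_elements_def)
  then show ?thesis
    unfolding entails_models[OF assms(6)]
    using completeness[OF assms(1) inf assms(5)] soundness_entails[OF assms(1)] assms(2) by blast
qed

end
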